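(* Let $G$ be a finite group with a Sylow tower and let $\chi$ be an irreducible complex character of $G$. Then $\chi(g)$ is zero or a root of unity for at least $|G|/2$ elements $g\in G$.
   Context: A finite group $G$ has a Sylow tower if there is a series $1=G_0\le G_1\le\cdots\le G_k=G$ of normal subgroups of $G$ such that, for each $i=1,\dots,k$, the quotient $G_i/G_{i-1}$ is isomorphic to a Sylow $p_i$-subgroup of $G$, where $p_1,\dots,p_k$ are the distinct primes dividing $|G|$ in some order. (The trivial group has a Sylow tower with $k=0$.) *)

theory Defs
  imports
    "HOL-Algebra.Coset"
    "HOL-Computational_Algebra.Primes"
    "Jordan_Normal_Form.VS_Connect"
begin

hide_const (open) Polynomial.order

definition sylow_subgroup :: "('a, 'b) monoid_scheme \<Rightarrow> nat \<Rightarrow> 'a set \<Rightarrow> bool" where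
  "sylow_subgroup G p P \<longleftrightarrow>
     Factorial_Ring.prime p \<and> subgroup P G \<and> card P = p ^ multiplicity p (order G)"

text \<open>The bijection \<open>p\<close> expresses that \<open>p 1, \<dots>, p k\<close> lists the distinct primes dividing
  the order of \<open>G\<close>, each exactly once. Normality is required in \<open>G\<close>, not only in the next
  term of the series.\<close>

definition has_sylow_tower :: "('a, 'b) monoid_scheme \<Rightarrow> bool" where
  "has_sylow_tower G \<longleftrightarrow>
     (\<exists>(k :: nat) (N :: nat \<Rightarrow> 'a set) (p :: nat \<Rightarrow> nat).
        N 0 = {\<one>\<^bsub>G\<^esub>} \<and> N k = carrier G \<and>
        (\<forall>i\<le>k. N i \<lhd> G) \<and>
        (\<forall>i\<in>{1..k}. N (i - 1) \<subseteq> N i) \<and>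
        bij_betw p {1..k} (prime_factors (order G)) \<and>
        (\<forall>i\<in>{1..k}. \<exists>P. sylow_subgroup G (p i) P \<and>
           (G\<lparr>carrier := N i\<rparr>) Mod (N (i - 1)) \<cong> G\<lparr>carrier := P\<rparr>))"

abbreviation GL :: "nat \<Rightarrow> complex mat monoid" where
  "GL n \<equiv> units_of (ring_mat TYPE(complex) n ())"

abbreviation complex_space :: "nat \<Rightarrow> (complex, complex vec) module" where
  "complex_space n \<equiv> module_vec TYPE(complex) n"

definition irreducible_rep ::
    "('a, 'b) monoid_scheme \<Rightarrow> nat \<Rightarrow> ('a \<Rightarrow> complex mat) \<Rightarrow> bool" where
  "irreducible_rep G n \<rho> \<longleftrightarrow>
     \<rho> \<in> hom G (GL n) \<and> n > 0 \<and>
     (\<forall>W. VectorSpace.subspace class_ring W (complex_space n) \<and>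
          (\<forall>g\<in>carrier G. \<forall>w\<in>W. \<rho> g *\<^sub>v w \<in> W)
        \<longrightarrow> W = {0\<^sub>v n} \<or> W = carrier_vec n)"

definition mat_trace :: "'a :: comm_monoid_add mat \<Rightarrow> 'a" where
  "mat_trace A = (\<Sum>i<dim_row A. A $$ (i, i))"

text \<open>Values of \<open>\<chi>\<close> outside the carrier are irrelevant and left unconstrained.\<close>

definition irreducible_character ::
    "('a, 'b) monoid_scheme \<Rightarrow> ('a \<Rightarrow> complex) \<Rightarrow> bool" where
  "irreducible_character G \<chi> \<longleftrightarrow>
     (\<exists>n \<rho>. irreducible_rep G n \<rho> \<and> (\<forall>g\<in>carrier G. \<chi> g = mat_trace (\<rho> g)))"

definition root_of_unity :: "complex \<Rightarrow> bool" where
  "root_of_unity z \<longleftrightarrow> (\<exists>m::nat. m > 0 \<and> z ^ m = 1)"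

end

theory Submission
  imports
    Defs
    "HOL-Number_Theory.Cong"
    "HOL-Algebra.Multiplicative_Group"
    "Jordan_Normal_Form.DL_Rank"
    "Jordan_Normal_Form.Spectral_Radius"
begin

text \<open>Why the theorem holds. Let \<open>N\<close> be a normal subgroup of \<open>G\<close> whose index is a power of a prime
\<open>q\<close> not dividing \<open>|N|\<close>, and let \<open>coset_norm g\<close> be the mean of \<open>|\<chi>|\<^sup>2\<close> over the coset
\<open>gN\<close>. By orthogonality the mean of \<open>coset_norm\<close> over \<open>G\<close> is 1. Averaging in addition over
the Galois conjugation \<open>g \<mapsto> g\<^sup>j\<close>, where \<open>j\<close> runs through the units modulo a power of \<open>q\<close>,
gives a function on \<open>G/N\<close> that still has mean 1 and whose values are severely restricted.

Every coset of \<open>N\<close> contains a \<open>q\<close>-element \<open>x\<close>. With \<open>C\<close> the centralizer of \<open>x\<close> in \<open>N\<close>, the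
\<open>N\<close>-conjugates of the elements \<open>xy\<close> with \<open>y \<in> C\<close> cover \<open>xN\<close> uniformly (\<open>sum_coset_cent\<close>), so the
coset is described by the function \<open>y \<mapsto> \<chi>(xy)\<close> on \<open>C\<close>. As \<open>x\<close> is central in \<open>\<langle>x\<rangle>C\<close>, Schur's
lemma gives \<open>\<chi>(x\<^sup>jy) = \<Sum>\<^sub>b \<alpha>\<^sub>b(j) b(y)\<close> with irreducible characters \<open>b\<close> of \<open>C\<close> and generalized
characters \<open>\<alpha>\<^sub>b\<close> of a cyclic \<open>q\<close>-group, whence \<open>coset_norm (x\<^sup>j) = \<Sum>\<^sub>b |\<alpha>\<^sub>b(j)|\<^sup>2\<close> for units \<open>j\<close>.
An elementary computation with the coefficients of \<open>\<alpha>\<^sub>b\<close> (\<open>virtual_char_cases\<close>) shows that the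
average of \<open>|\<alpha>\<^sub>b(j)|\<^sup>2\<close> over the units \<open>j\<close> is either 0, or 1 with \<open>\<alpha>\<^sub>b(1)\<close> a root of unity, or
greater than 1; and if \<open>q\<close> divides \<open>\<alpha>\<^sub>b(0)\<close>, then it is 0 or at least 2.

Two cases remain. If no Galois-averaged coset norm is 0, all are at least 1, hence all are equal to 1.
Then each coset has exactly one \<open>b\<close> with \<open>\<alpha>\<^sub>b(1) \<noteq> 0\<close>, so \<open>\<chi>(xy)\<close> is a root of unity times
\<open>b(y)\<close>, and the statement for \<open>C\<close>, a subgroup of \<open>N\<close>, gives half of every coset. If some averaged
norm is 0, then, because \<open>j \<mapsto> coset_norm (x\<^sup>j)\<close> is itself a generalized character
(\<open>coset_norm_virtual_char\<close>), \<open>q\<close> divides the integer \<open>coset_norm 1\<close>. The same congruence then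
forces \<open>q\<close> to divide \<open>\<Sum>\<^sub>b \<alpha>\<^sub>b(0)\<^sup>2\<close> on every coset, and the nonzero averaged norms are all at
least 2 (\<open>galois_norm_gap\<close>). Since the mean is 1, at least half of the cosets have norm 0, and
\<open>\<chi>\<close> vanishes on them.

The theorem follows by climbing the tower. The inductive statement concerns all subgroups of the
terms of the tower, because the centralizers \<open>C\<close> need not be terms themselves.\<close>

hide_const (open) Polynomial.order

section \<open>Generalized characters of cyclic groups of prime power order\<close>

lemma sum_lessThan_add:
  fixes f :: "nat \<Rightarrow> 'a :: comm_monoid_add"
  shows "(\<Sum>l<m + k. f l) = (\<Sum>l<m. f l) + (\<Sum>l<k. f (l + m))"
  by (induction k) (auto simp: add_ac)

definition unity_root :: "nat \<Rightarrow> complex" where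
  "unity_root Q = cis (2 * pi / real Q)"

lemma unity_root_power: "unity_root Q ^ k = cis (2 * pi * real k / real Q)"
  by (simp add: unity_root_def DeMoivre mult_ac)

lemma unity_root_power_self: "Q > 0 \<Longrightarrow> unity_root Q ^ Q = 1"
  by (simp add: unity_root_power)

lemma unity_root_eq_iff:
  assumes "k < Q" "l < Q"
  shows "unity_root Q ^ k = unity_root Q ^ l \<longleftrightarrow> k = l"
  using bij_betw_imp_inj_on[OF bij_betw_roots_unity[of Q]] assms
  by (auto simp: unity_root_power inj_on_def)

lemma unity_root_exhaust:
  assumes "z ^ Q = 1" "Q > 0"
  obtains k where "k < Q" "z = unity_root Q ^ k"
  using bij_betw_imp_surj_on[OF bij_betw_roots_unity[OF assms(2)]] assms
  by (auto simp: unity_root_power image_def set_eq_iff)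

lemma norm_unity_root [simp]: "norm (unity_root Q) = 1"
  by (simp add: unity_root_def)

lemma cnj_eq_inverse:
  fixes z :: complex
  shows "norm z = 1 \<Longrightarrow> cnj z = inverse z"
  by (metis complex_cnj_cnj complex_cnj_inverse complex_cnj_one inverse_unique mult.commute
      complex_norm_square of_real_1 power_one)

lemma sum_root_powers:
  assumes "w ^ Q = (1::complex)"
  shows "(\<Sum>j<Q. w ^ j) = (if w = 1 then of_nat Q else 0)"
  using assms by (simp add: geometric_sum)

lemma unity_root_ratio:
  assumes "k < Q" "l < Q"
  shows "(unity_root Q ^ k * cnj (unity_root Q ^ l)) ^ Q = 1"
    "unity_root Q ^ k * cnj (unity_root Q ^ l) = 1 \<longleftrightarrow> k = l"
proof -
  have c: "cnj (unity_root Q ^ l) = inverse (unity_root Q ^ l)"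
    by (rule cnj_eq_inverse) (simp add: norm_power)
  have nz: "unity_root Q \<noteq> 0" using norm_unity_root[of Q] by (metis norm_zero zero_neq_one)
  show "(unity_root Q ^ k * cnj (unity_root Q ^ l)) ^ Q = 1"
    using unity_root_power_self[of Q] assms unfolding c
    by (simp add: power_mult_distrib power_inverse flip: power_mult)
       (simp add: power_mult mult.commute[of _ Q])
  show "unity_root Q ^ k * cnj (unity_root Q ^ l) = 1 \<longleftrightarrow> k = l"
    unfolding c using nz unity_root_eq_iff[OF assms] by (simp add: field_simps)
qed

text \<open>The \<open>\<int>\<close>-combinations of the linear characters \<open>j \<mapsto> \<zeta>\<^sup>k\<^sup>j\<close> of \<open>\<int>/Q\<close>, viewed as \<open>Q\<close>-periodic
functions on the natural numbers. The value at 0 is the sum of the coefficients; the values at the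
units \<open>j\<close> are the Galois conjugates of the value at 1, so this encodes arithmetic in \<open>\<int>[\<zeta>]\<close>
without any field theory.\<close>

definition virtual_char :: "nat \<Rightarrow> (nat \<Rightarrow> complex) \<Rightarrow> bool" where
  "virtual_char Q f \<longleftrightarrow>
     (\<exists>c :: nat \<Rightarrow> int. \<forall>j. f j = (\<Sum>k<Q. of_int (c k) * (unity_root Q ^ k) ^ j))"

text \<open>The roots need not be distinct or of exact order \<open>Q\<close>: collecting equal ones gives the coefficients.\<close>

lemma virtual_char_sum_roots:
  assumes "finite I" "Q > 0" "\<And>i. i \<in> I \<Longrightarrow> \<mu> i ^ Q = 1"
  shows "virtual_char Q (\<lambda>j. \<Sum>i\<in>I. of_int (w i) * \<mu> i ^ j)"
proof -
  have "\<exists>k. i \<in> I \<longrightarrow> k < Q \<and> \<mu> i = unity_root Q ^ k" for i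
    using unity_root_exhaust[of "\<mu> i" Q] assms by metis
  then obtain \<kappa> where \<kappa>: "\<And>i. i \<in> I \<Longrightarrow> \<kappa> i < Q \<and> \<mu> i = unity_root Q ^ \<kappa> i" by metis
  define c where "c k = (\<Sum>i\<in>{i\<in>I. \<kappa> i = k}. w i)" for k
  have "(\<Sum>i\<in>I. of_int (w i) * \<mu> i ^ j) = (\<Sum>k<Q. of_int (c k) * (unity_root Q ^ k) ^ j)" for j
  proof -
    have "(\<Sum>i\<in>I. of_int (w i) * \<mu> i ^ j) =
      (\<Sum>k<Q. \<Sum>i\<in>{i\<in>I. \<kappa> i = k}. of_int (w i) * \<mu> i ^ j)"
      by (rule sum.group[symmetric]) (use assms \<kappa> in auto)
    also have "\<dots> = (\<Sum>k<Q. of_int (c k) * (unity_root Q ^ k) ^ j)"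
      by (intro sum.cong refl) (use \<kappa> in \<open>auto simp: c_def sum_distrib_right\<close>)
    finally show ?thesis .
  qed
  then show ?thesis unfolding virtual_char_def by blast
qed

lemma virtual_char_sum:
  assumes "\<And>i. i \<in> I \<Longrightarrow> virtual_char Q (f i)"
  shows "virtual_char Q (\<lambda>j. \<Sum>i\<in>I. f i j)"
proof -
  have "\<exists>c :: nat \<Rightarrow> int. i \<in> I \<longrightarrow> (\<forall>j. f i j = (\<Sum>k<Q. of_int (c k) * (unity_root Q ^ k) ^ j))" for i
    using assms unfolding virtual_char_def by blast
  then obtain c :: "_ \<Rightarrow> nat \<Rightarrow> int" where c: "\<And>i j. i \<in> I \<Longrightarrow>
      f i j = (\<Sum>k<Q. of_int (c i k) * (unity_root Q ^ k) ^ j)" by metis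
  have "(\<Sum>i\<in>I. f i j) = (\<Sum>k<Q. of_int (\<Sum>i\<in>I. c i k) * (unity_root Q ^ k) ^ j)" for j
    using sum.swap[of "\<lambda>i k. of_int (c i k) * (unity_root Q ^ k) ^ j" "{..<Q}" I]
    by (simp add: c sum_distrib_right)
  then show ?thesis unfolding virtual_char_def by (intro exI[of _ "\<lambda>k. \<Sum>i\<in>I. c i k"]) blast
qed

lemma virtual_char_diff:
  assumes "virtual_char Q f" "virtual_char Q g"
  shows "virtual_char Q (\<lambda>j. f j - g j)"
proof -
  obtain c d :: "nat \<Rightarrow> int" where "\<And>j. f j = (\<Sum>k<Q. of_int (c k) * (unity_root Q ^ k) ^ j)"
    "\<And>j. g j = (\<Sum>k<Q. of_int (d k) * (unity_root Q ^ k) ^ j)"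
    using assms unfolding virtual_char_def by blast
  then have "f j - g j = (\<Sum>k<Q. of_int (c k - d k) * (unity_root Q ^ k) ^ j)" for j
    by (simp add: sum_subtractf algebra_simps)
  then show ?thesis unfolding virtual_char_def by (intro exI[of _ "\<lambda>k. c k - d k"]) blast
qed

text \<open>The conjugate of a root of unity is a root of unity, so \<open>|f|\<^sup>2\<close> is again a combination of roots.\<close>

lemma virtual_char_mult_cnj:
  assumes "virtual_char Q f" "Q > 0"
  shows "virtual_char Q (\<lambda>j. f j * cnj (f j))"
proof -
  obtain c :: "nat \<Rightarrow> int" where c: "\<And>j. f j = (\<Sum>k<Q. of_int (c k) * (unity_root Q ^ k) ^ j)"
    using assms unfolding virtual_char_def by blast
  have "f j * cnj (f j) = (\<Sum>(k,l)\<in>{..<Q} \<times> {..<Q}.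
      of_int (c k * c l) * (unity_root Q ^ k * cnj (unity_root Q ^ l)) ^ j)" for j
    unfolding c by (simp add: sum_product sum.cartesian_product power_mult_distrib mult_ac)
  moreover have "virtual_char Q (\<lambda>j. \<Sum>(k,l)\<in>{..<Q} \<times> {..<Q}.
      of_int (c k * c l) * (unity_root Q ^ k * cnj (unity_root Q ^ l)) ^ j)"
    using virtual_char_sum_roots[of "{..<Q} \<times> {..<Q}" Q
        "\<lambda>(k,l). unity_root Q ^ k * cnj (unity_root Q ^ l)" "\<lambda>(k,l). c k * c l"]
      unity_root_ratio(1) assms(2) by (auto simp: case_prod_beta)
  ultimately show ?thesis by presburger
qed

lemma parseval:
  assumes "Q > 0"
  shows "(\<Sum>j<Q. (norm (\<Sum>k<Q. of_int (c k) * (unity_root Q ^ k) ^ j))\<^sup>2) =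
    real Q * of_int (\<Sum>k<Q. (c k)\<^sup>2)"
proof -
  let ?\<omega> = "\<lambda>k l. unity_root Q ^ k * cnj (unity_root Q ^ l)"
  have "complex_of_real (\<Sum>j<Q. (norm (\<Sum>k<Q. of_int (c k) * (unity_root Q ^ k) ^ j))\<^sup>2) =
     (\<Sum>j<Q. \<Sum>k<Q. \<Sum>l<Q. of_int (c k * c l) * ?\<omega> k l ^ j)"
    unfolding of_real_sum complex_norm_square
    by (simp add: sum_product power_mult_distrib mult_ac)
  also have "\<dots> = (\<Sum>k<Q. \<Sum>j<Q. \<Sum>l<Q. of_int (c k * c l) * ?\<omega> k l ^ j)"
    by (rule sum.swap)
  also have "\<dots> = (\<Sum>k<Q. \<Sum>l<Q. \<Sum>j<Q. of_int (c k * c l) * ?\<omega> k l ^ j)"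
    by (intro sum.cong refl sum.swap)
  also have "\<dots> = (\<Sum>k<Q. \<Sum>l<Q. if k = l then of_nat Q * of_int ((c k)\<^sup>2) else 0)"
  proof (intro sum.cong refl)
    fix k l assume "k \<in> {..<Q}" "l \<in> {..<Q}"
    then have "(\<Sum>j<Q. ?\<omega> k l ^ j) = (if k = l then of_nat Q else 0)"
      using sum_root_powers[OF unity_root_ratio(1)] unity_root_ratio(2) by simp
    then show "(\<Sum>j<Q. of_int (c k * c l) * ?\<omega> k l ^ j) =
        (if k = l then of_nat Q * of_int ((c k)\<^sup>2) else 0)"
      unfolding sum_distrib_left[symmetric] by (auto simp: power2_eq_square)
  qed
  also have "\<dots> = complex_of_real (real Q * of_int (\<Sum>k<Q. (c k)\<^sup>2))"
    by (simp add: sum_distrib_left)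
  finally show ?thesis by (simp only: of_real_eq_iff)
qed

lemma sum_blocks:
  fixes f :: "nat \<Rightarrow> 'a :: comm_monoid_add"
  shows "(\<Sum>k<q * M. f k) = (\<Sum>s<q. \<Sum>r<M. f (r + s * M))"
  by (induction q) (auto simp: sum_lessThan_add add.commute[of M])

text \<open>For a prime \<open>q\<close> and \<open>M\<close> a power of \<open>q\<close>, these are the units modulo \<open>qM\<close>.\<close>

definition units_below :: "nat \<Rightarrow> nat \<Rightarrow> nat set" where
  "units_below q M = {j. j < q * M \<and> \<not> q dvd j}"

lemma finite_units_below [simp]: "finite (units_below q M)"
  by (simp add: units_below_def)

lemma sum_units_below:
  fixes f :: "nat \<Rightarrow> 'a :: comm_monoid_add"
  assumes "q > 0"
  shows "(\<Sum>j<q * M. f j) = (\<Sum>j\<in>units_below q M. f j) + (\<Sum>i<M. f (q * i))"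
proof -
  have e: "{j. j < q * M \<and> q dvd j} = (\<lambda>i. q * i) ` {..<M}"
    using assms by (auto simp: dvd_def)
  have "(\<Sum>j<q * M. f j) = (\<Sum>j\<in>units_below q M \<union> {j. j < q * M \<and> q dvd j}. f j)"
    by (intro sum.cong) (auto simp: units_below_def)
  also have "\<dots> = (\<Sum>j\<in>units_below q M. f j) + (\<Sum>j\<in>{j. j < q * M \<and> q dvd j}. f j)"
    by (intro sum.union_disjoint) (auto simp: units_below_def)
  also have "(\<Sum>j\<in>{j. j < q * M \<and> q dvd j}. f j) = (\<Sum>i<M. f (q * i))"
    unfolding e using assms by (subst sum.reindex) (auto simp: inj_on_def)
  finally show ?thesis .
qed

lemma card_units_below:
  assumes "q > 0"
  shows "card (units_below q M) = (q - 1) * M"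
  using sum_units_below[OF assms, of "\<lambda>_. 1::nat" M] by (simp add: algebra_simps)

text \<open>This is the sum of \<open>(x s - x t)\<^sup>2\<close> over all pairs \<open>s < t\<close>; it measures how far \<open>x\<close> is from being constant.\<close>

definition dispersion :: "nat \<Rightarrow> (nat \<Rightarrow> int) \<Rightarrow> int" where
  "dispersion q x = int q * (\<Sum>s<q. (x s)\<^sup>2) - (\<Sum>s<q. x s)\<^sup>2"

lemma dispersion_shift: "dispersion q (\<lambda>s. x s - v) = dispersion q x"
proof -
  have a: "(\<Sum>s<q. (x s - v)\<^sup>2) = (\<Sum>s<q. (x s)\<^sup>2) - 2 * v * (\<Sum>s<q. x s) + int q * v\<^sup>2"
    by (simp add: power2_diff sum.distrib sum_subtractf sum_distrib_left algebra_simps)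
  have b: "(\<Sum>s<q. x s - v) = (\<Sum>s<q. x s) - int q * v"
    by (simp add: sum_subtractf)
  show ?thesis
    unfolding dispersion_def a b by (simp add: power2_eq_square algebra_simps)
qed

text \<open>Subtracting a constant does not change the dispersion, so the sum of the entries may be assumed to be
its residue \<open>r\<close> modulo \<open>q\<close>. With \<open>p\<close> the sum of the squares, the dispersion is \<open>qp - r\<^sup>2\<close>. If
\<open>r = 0\<close>, a nonzero integer vector with sum 0 has at least two nonzero entries, so \<open>p \<ge> 2\<close>. If
\<open>r > 0\<close>, then \<open>p \<ge> r\<close> gives at least \<open>r(q - r) \<ge> q - 1\<close>, and equality leaves only the indicator of
one position or of all positions but one.\<close>

lemma dispersion_cases:
  assumes "q \<ge> 2"
  obtains (const) v where "\<And>s. s < q \<Longrightarrow> x s = v" "dispersion q x = 0"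
  | (multiple) "int q dvd (\<Sum>s<q. x s)" "dispersion q x \<ge> 2 * int q"
  | (single) v e s\<^sub>0 where "\<not> int q dvd (\<Sum>s<q. x s)" "dispersion q x = int q - 1" "s\<^sub>0 < q" "e = 1 \<or> e = -1"
      "\<And>s. s < q \<Longrightarrow> x s = v + (if s = s\<^sub>0 then e else 0)"
  | (large) "\<not> int q dvd (\<Sum>s<q. x s)" "dispersion q x \<ge> int q"
proof -
  \<comment> \<open>The shift that moves the sum of the entries to its residue modulo \<open>q\<close>.\<close>
  define v where "v = (\<Sum>s<q. x s) div int q"
  define r where "r = (\<Sum>s<q. x s) mod int q"
  define y where "y s = x s - v" for s
  define p where "p = (\<Sum>s<q. (y s)\<^sup>2)"
  have r: "0 \<le> r" "r < int q" using assms by (auto simp: r_def)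
  have "(\<Sum>s<q. y s) = (\<Sum>s<q. x s) - int q * v"
    by (simp add: y_def sum_subtractf)
  then have sy: "(\<Sum>s<q. y s) = r" unfolding v_def r_def by (simp add: minus_mult_div_eq_mod)
  have D: "dispersion q x = int q * p - r\<^sup>2"
    using dispersion_shift[of q x v] by (simp add: dispersion_def sy p_def flip: y_def)
  have yy: "y s \<le> (y s)\<^sup>2" for s
  proof (cases "y s \<le> 0")
    case False
    then show ?thesis by (simp add: power2_eq_square)
  qed (meson dual_order.trans zero_le_power2)
  have pr: "p \<ge> r" unfolding p_def sy[symmetric] by (intro sum_mono yy)
  have dvd: "int q dvd (\<Sum>s<q. x s) \<longleftrightarrow> r = 0" unfolding r_def by (simp add: dvd_eq_mod_eq_0)
  show ?thesis
  proof (cases "r = 0")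
    case True
    show ?thesis
    proof (cases "\<forall>s<q. y s = 0")
      case True
      then have "dispersion q x = 0" using D \<open>r = 0\<close> by (simp add: p_def)
      then show ?thesis using True const[of v] by (simp add: y_def)
    next
      case False
      then obtain s where s: "s < q" "y s \<noteq> 0" by blast
      have "\<exists>t<q. t \<noteq> s \<and> y t \<noteq> 0"
      proof (rule ccontr)
        assume "\<not> ?thesis"
        then have "(\<Sum>s<q. y s) = (\<Sum>t\<in>{s}. y t)" using s by (intro sum.mono_neutral_right) auto
        then show False using sy True s by simp
      qed
      then obtain t where t: "t < q" "t \<noteq> s" "y t \<noteq> 0" by blast
      have "(\<Sum>u\<in>{s,t}. (y u)\<^sup>2) \<le> p" unfolding p_def using s t by (intro sum_mono2) auto
      moreover have "(y s)\<^sup>2 \<ge> 1" "(y t)\<^sup>2 \<ge> 1"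
        using s t zero_less_power2[of "y s"] zero_less_power2[of "y t"] by linarith+
      ultimately have "p \<ge> 2" using t by auto
      then have "int q * p \<ge> int q * 2" by (intro mult_left_mono) auto
      then show ?thesis using multiple dvd True D by simp
    qed
  next
    case False
    have nd: "\<not> int q dvd (\<Sum>s<q. x s)" using False dvd by simp
    show ?thesis
    proof (cases "dispersion q x \<ge> int q")
      case True
      then show ?thesis using large nd by blast
    next
      case False
      have pe: "p = r"
      proof (rule ccontr)
        assume "p \<noteq> r"
        then have "p \<ge> r + 1" using pr by simp
        then have "int q * p \<ge> int q * (r + 1)" by (intro mult_left_mono) auto
        moreover have "r * r \<le> int q * r" using r by (intro mult_right_mono) auto
        ultimately show False using False D by (simp add: power2_eq_square algebra_simps)
      qed
      have "(r - 1) * (int q - 1 - r) \<ge> 0" using r \<open>r \<noteq> 0\<close> by simp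
      moreover have "dispersion q x = (r - 1) * (int q - 1 - r) + (int q - 1)"
        using D pe by (simp add: power2_eq_square algebra_simps)
      ultimately have Dq: "dispersion q x = int q - 1" and z: "(r - 1) * (int q - 1 - r) = 0"
        using False by linarith+
      have "(\<Sum>s<q. (y s)\<^sup>2 - y s) = 0" using pe sy by (simp add: p_def sum_subtractf)
      then have "\<forall>s<q. (y s)\<^sup>2 - y s = 0"
        using yy by (subst (asm) sum_nonneg_eq_0_iff) auto
      then have y01: "y s = 0 \<or> y s = 1" if "s < q" for s using that by (auto simp: power2_eq_square)
      define B where "B = {s. s < q \<and> y s = 1}"
      have fB: "finite B" by (simp add: B_def)
      have "(\<Sum>s<q. y s) = (\<Sum>s\<in>B. 1)"
        using y01 by (intro sum.mono_neutral_cong_right) (auto simp: B_def)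
      then have cB: "int (card B) = r" using sy by simp
      from z consider "r = 1" | "r = int q - 1" by auto
      then show ?thesis
      proof cases
        case 1
        then have "card B = 1" using cB by simp
        then obtain s0 where "B = {s0}" using card_1_singletonE by blast
        then have B: "s < q \<and> y s = 1 \<longleftrightarrow> s = s0" for s unfolding B_def by auto
        have "x s = v + (if s = s0 then 1 else 0)" if "s < q" for s
          using y01[OF that] B[of s] that by (auto simp: y_def)
        then show ?thesis using single[of s0 1 v] nd Dq B[of s0] by blast
      next
        case 2
        have "card ({..<q} - B) = 1" using cB 2 fB assms
          by (subst card_Diff_subset) (auto simp: B_def)
        then obtain s0 where s0: "{..<q} - B = {s0}" using card_1_singletonE by blast
        have "s0 < q" "y s0 = 0" using s0 y01 by (auto simp: B_def)
        moreover have "y s = 1" if "s < q" "s \<noteq> s0" for s using s0 that by (auto simp: B_def)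
        ultimately have "s0 < q" "\<And>s. s < q \<Longrightarrow> x s = (v + 1) + (if s = s0 then - 1 else 0)"
          unfolding y_def by (auto simp: algebra_simps)
        then show ?thesis using single[of s0 "-1" "v + 1"] nd Dq by blast
      qed
    qed
  qed
qed

lemma unity_root_mult_power:
  assumes "q > 0"
  shows "unity_root (q * M) ^ q = unity_root M"
  using assms by (simp add: unity_root_def DeMoivre)

text \<open>The units are all residues minus the multiples of \<open>q\<close>. Restricted to multiples of \<open>q\<close>, \<open>f\<close> is a
generalized character of \<open>\<int>/M\<close> whose coefficients are the sums over the classes modulo \<open>M\<close>; the
difference of the two Parseval identities is a sum of dispersions of those classes.\<close>

lemma sum_units_norm_sq:
  assumes "q > 0" "M > 0" and f: "\<And>j. f j = (\<Sum>k<q * M. of_int (c k) * (unity_root (q * M) ^ k) ^ j)"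
  shows "(\<Sum>j\<in>units_below q M. (norm (f j))\<^sup>2) =
    real M * of_int (\<Sum>r<M. dispersion q (\<lambda>s. c (r + s * M)))"
proof -
  define C where "C r = (\<Sum>s<q. c (r + s * M))" for r
  have fq: "f (q * i) = (\<Sum>r<M. of_int (C r) * (unity_root M ^ r) ^ i)" for i
  proof -
    have p: "(unity_root (q * M) ^ (r + s * M)) ^ (q * i) = (unity_root M ^ r) ^ i" for r s
    proof -
      have "(unity_root (q * M) ^ (r + s * M)) ^ (q * i) = ((unity_root (q * M) ^ q) ^ (r + s * M)) ^ i"
        by (simp add: mult_ac flip: power_mult)
      also have "\<dots> = (unity_root M ^ (r + s * M)) ^ i"
        unfolding unity_root_mult_power[OF assms(1)] ..
      also have "unity_root M ^ (r + s * M) = unity_root M ^ r"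
        using unity_root_power_self[OF assms(2)]
        by (simp add: power_add mult.commute[of s] power_mult)
      finally show ?thesis .
    qed
    have "f (q * i) = (\<Sum>s<q. \<Sum>r<M. of_int (c (r + s * M)) * (unity_root M ^ r) ^ i)"
      unfolding f sum_blocks p ..
    also have "\<dots> = (\<Sum>r<M. \<Sum>s<q. of_int (c (r + s * M)) * (unity_root M ^ r) ^ i)"
      by (rule sum.swap)
    finally show ?thesis by (simp add: C_def sum_distrib_right)
  qed
  have "(\<Sum>j<q * M. (norm (f j))\<^sup>2) = real (q * M) * of_int (\<Sum>k<q * M. (c k)\<^sup>2)"
    unfolding f by (rule parseval) (use assms in auto)
  moreover have "(\<Sum>i<M. (norm (f (q * i)))\<^sup>2) = real M * of_int (\<Sum>r<M. (C r)\<^sup>2)"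
    unfolding fq by (rule parseval) (use assms in auto)
  moreover have "(\<Sum>k<q * M. (c k)\<^sup>2) = (\<Sum>r<M. \<Sum>s<q. (c (r + s * M))\<^sup>2)"
    unfolding sum_blocks by (rule sum.swap)
  ultimately have "(\<Sum>j\<in>units_below q M. (norm (f j))\<^sup>2) =
      real (q * M) * of_int (\<Sum>r<M. \<Sum>s<q. (c (r + s * M))\<^sup>2) - real M * of_int (\<Sum>r<M. (C r)\<^sup>2)"
    using sum_units_below[OF assms(1), of "\<lambda>j. (norm (f j))\<^sup>2" M] by simp
  also have "\<dots> = real M * of_int (\<Sum>r<M. dispersion q (\<lambda>s. c (r + s * M)))"
    by (simp add: dispersion_def C_def sum_subtractf sum_distrib_left algebra_simps)
  finally show ?thesis .
qed

lemma virtual_char_zero_int: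
  assumes "virtual_char Q f"
  obtains t :: int where "f 0 = of_int t"
proof -
  obtain c :: "nat \<Rightarrow> int" where "\<And>j. f j = (\<Sum>k<Q. of_int (c k) * (unity_root Q ^ k) ^ j)"
    using assms unfolding virtual_char_def by blast
  then have "f 0 = of_int (\<Sum>k<Q. c k)" by simp
  then show ?thesis using that by blast
qed

text \<open>The square sum over units is \<open>M\<close> times the sum of the dispersions of the coefficients in the classes
modulo \<open>M\<close>, while there are \<open>(q - 1)M\<close> units. Each nonconstant class contributes at least \<open>q - 1\<close>, so two
of them already give twice the number of units. Constant classes contribute nothing to
\<open>f\<close> at units, and multiples of \<open>q\<close> to \<open>f 0\<close>; hence if just one class is nonconstant, its sum decides
whether \<open>q\<close> divides \<open>f 0\<close>, and in the extremal case it leaves a single signed root of unity.\<close>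

lemma virtual_char_cases:
  assumes q: "q \<ge> 2" and M: "M > 0" and f: "virtual_char (q * M) f" and t: "f 0 = of_int t"
  defines "S \<equiv> (\<Sum>j\<in>units_below q M. (norm (f j))\<^sup>2)"
  obtains (zero) "int q dvd t" "S = 0" "\<And>j. j \<in> units_below q M \<Longrightarrow> f j = 0"
  | (root) "\<not> int q dvd t" "S = real (card (units_below q M))" "root_of_unity (f 1)"
  | (mid) "\<not> int q dvd t" "S > real (card (units_below q M))"
  | (large) "S \<ge> 2 * real (card (units_below q M))"
proof -
  obtain c :: "nat \<Rightarrow> int" where c: "\<And>j. f j = (\<Sum>k<q * M. of_int (c k) * (unity_root (q * M) ^ k) ^ j)"
    using f unfolding virtual_char_def by blast
  define x where "x r s = c (r + s * M)" for r s
  define D where "D r = dispersion q (x r)" for r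
  have q0: "q > 0" using q by simp
  have S: "S = real M * of_int (\<Sum>r<M. D r)"
    unfolding S_def D_def x_def by (rule sum_units_norm_sq[OF q0 M c])
  have card: "real (card (units_below q M)) = real M * (real q - 1)"
    using card_units_below[OF q0, of M] q by (simp add: of_nat_diff)
  have "complex_of_int t = of_int (\<Sum>k<q * M. c k)" using t c[of 0] by simp
  then have "t = (\<Sum>k<q * M. c k)" by (simp only: of_int_eq_iff)
  also have "\<dots> = (\<Sum>r<M. \<Sum>s<q. x r s)" unfolding sum_blocks x_def by (rule sum.swap)
  finally have tx: "t = (\<Sum>r<M. \<Sum>s<q. x r s)" .
  have Dcases: "(D r = 0 \<and> (\<exists>v. \<forall>s<q. x r s = v)) \<or> D r \<ge> int q - 1" for r
    unfolding D_def by (rule dispersion_cases[OF q, of "x r"]) (use q in auto)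
  have D0: "D r \<ge> 0" for r using Dcases[of r] q by auto
  have dvdc: "int q dvd (\<Sum>s<q. x r s)" if "D r = 0" for r
  proof -
    have "\<exists>v. \<forall>s<q. x r s = v" using Dcases[of r] that q by auto
    then obtain v where "\<forall>s<q. x r s = v" by blast
    then have "(\<Sum>s<q. x r s) = int q * v" by simp
    then show ?thesis by simp
  qed
  have f1: "f j = (\<Sum>r<M. \<Sum>s<q. of_int (x r s) * (unity_root (q * M) ^ (r + s * M)) ^ j)" for j
    unfolding c sum_blocks x_def by (rule sum.swap)
  define w where "w = unity_root (q * M)"
  have "(w ^ M) ^ 1 \<noteq> 1"
    using unity_root_eq_iff[of M "q * M" 0] q M by (simp add: w_def)
  then have wM: "w ^ M \<noteq> 1" by simp
  have wM1: "(w ^ M) ^ q = 1"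
    using unity_root_power_self[of "q * M"] q M by (simp add: w_def mult.commute flip: power_mult)
  \<comment> \<open>A constant class contributes nothing at 1, as \<open>w ^ M\<close> is a primitive \<open>q\<close>-th root of unity.\<close>
  have geo: "(\<Sum>s<q. w ^ (r + s * M)) = 0" for r
  proof -
    have "(\<Sum>s<q. w ^ (r + s * M)) = w ^ r * (\<Sum>s<q. (w ^ M) ^ s)"
      by (simp add: power_add sum_distrib_left mult.commute[of _ M] power_mult)
    then show ?thesis using sum_root_powers[OF wM1] wM by simp
  qed
  have Mn: "real M > 0" using M by simp
  show ?thesis
  proof (cases "\<forall>r<M. D r = 0")
    case True
    then have S0: "S = 0" using S by simp
    then have "f j = 0" if "j \<in> units_below q M" for j
      using that unfolding S_def by (subst (asm) sum_nonneg_eq_0_iff) auto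
    moreover have "int q dvd t" unfolding tx by (intro dvd_sum dvdc) (use True in auto)
    ultimately show ?thesis using zero S0 by blast
  next
    case False
    then obtain r where r: "r < M" "D r \<noteq> 0" by blast
    show ?thesis
    proof (cases "\<exists>r'<M. r' \<noteq> r \<and> D r' \<noteq> 0")
      case True
      then obtain r' where r': "r' < M" "r' \<noteq> r" "D r' \<noteq> 0" by blast
      have "(\<Sum>u\<in>{r,r'}. D u) \<le> (\<Sum>u<M. D u)" using r r' D0 by (intro sum_mono2) auto
      then have "(\<Sum>u<M. D u) \<ge> 2 * (int q - 1)" using Dcases[of r] Dcases[of r'] r r' by auto
      then have "real_of_int (\<Sum>u<M. D u) \<ge> real_of_int (2 * (int q - 1))" by (simp only: of_int_le_iff)
      then have "S \<ge> real M * real_of_int (2 * (int q - 1))" unfolding S by (intro mult_left_mono) auto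
      then show ?thesis using large card by (simp add: algebra_simps)
    next
      case False
      have rest: "D r' = 0" if "r' < M" "r' \<noteq> r" for r' using False that by blast
      have "(\<Sum>u<M. D u) = (\<Sum>u\<in>{r}. D u)" using r rest by (intro sum.mono_neutral_right) auto
      then have SD: "S = real M * of_int (D r)" using S by simp
      have split: "t = (\<Sum>s<q. x r s) + (\<Sum>r'\<in>{..<M} - {r}. \<Sum>s<q. x r' s)"
        unfolding tx using r by (subst sum.remove[of _ r]) auto
      have "int q dvd (\<Sum>r'\<in>{..<M} - {r}. \<Sum>s<q. x r' s)" by (intro dvd_sum dvdc) (use rest in auto)
      then have dvd: "int q dvd t \<longleftrightarrow> int q dvd (\<Sum>s<q. x r s)"
        unfolding split by (metis dvd_add_left_iff)
      from q show ?thesis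
      proof (cases rule: dispersion_cases[of q "x r"])
        case (const v)
        then show ?thesis using r D_def by auto
      next
        case multiple
        then have "real_of_int (D r) \<ge> 2 * real q" unfolding D_def by linarith
        then have "S \<ge> real M * (2 * real q)" unfolding SD by (intro mult_left_mono) auto
        then show ?thesis using large card Mn by (simp add: algebra_simps)
      next
        case (single v e s\<^sub>0)
        have "f 1 = (\<Sum>r'<M. \<Sum>s<q. of_int (x r' s) * w ^ (r' + s * M))"
          unfolding f1 w_def by simp
        also have "\<dots> = (\<Sum>r'\<in>{r}. \<Sum>s<q. of_int (x r' s) * w ^ (r' + s * M))"
        proof (rule sum.mono_neutral_right)
          show "\<forall>i\<in>{..<M} - {r}. (\<Sum>s<q. of_int (x i s) * w ^ (i + s * M)) = 0"
          proof
            fix i assume "i \<in> {..<M} - {r}"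
            then have "D i = 0" using rest by auto
            then obtain u where "\<forall>s<q. x i s = u" using Dcases[of i] q by auto
            then have "(\<Sum>s<q. of_int (x i s) * w ^ (i + s * M)) = of_int u * (\<Sum>s<q. w ^ (i + s * M))"
              by (simp add: sum_distrib_left)
            then show "(\<Sum>s<q. of_int (x i s) * w ^ (i + s * M)) = 0" using geo by simp
          qed
        qed (use r in auto)
        also have "\<dots> = (\<Sum>s<q. of_int (x r s) * w ^ (r + s * M))" by simp
        also have "\<dots> = (\<Sum>s<q. of_int v * w ^ (r + s * M) +
            (if s = s\<^sub>0 then of_int e * w ^ (r + s * M) else 0))"
          by (intro sum.cong refl) (auto simp: single(5) algebra_simps)
        also have "\<dots> = of_int e * w ^ (r + s\<^sub>0 * M)"
          using geo[of r] single(3) by (simp add: sum.distrib flip: sum_distrib_left)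
        finally have f1: "f 1 = of_int e * w ^ (r + s\<^sub>0 * M)" .
        have "f 1 ^ (2 * (q * M)) = (of_int e ^ 2) ^ (q * M) * ((w ^ (q * M)) ^ (r + s\<^sub>0 * M)) ^ 2"
          unfolding f1 by (simp add: power_mult_distrib mult_ac flip: power_mult)
        also have "\<dots> = 1" using single(4) unity_root_power_self[of "q * M"] q M by (auto simp: w_def)
        finally have "root_of_unity (f 1)" unfolding root_of_unity_def
          using q M by (intro exI[of _ "2 * (q * M)"]) auto
        then show ?thesis using root dvd single SD card q unfolding D_def[symmetric] by simp
      next
        case large
        then have "real_of_int (D r) > real q - 1" unfolding D_def by linarith
        then have "S > real M * (real q - 1)" unfolding SD using Mn by simp
        then show ?thesis using mid dvd large card by simp
      qed
    qed
  qed
qed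

text \<open>Two members that do not vanish at the units contribute at least twice the number of units, so only the
case of a single such member matters. All other members have value at 0 divisible by \<open>q\<close>,
hence \<open>q\<close> divides the sum of the squares of the values at 0 only if it divides the value of that one
member.\<close>

lemma virtual_char_family:
  assumes q: "q \<ge> 2" and M: "M > 0" and fin: "finite B"
    and f: "\<And>b. b \<in> B \<Longrightarrow> virtual_char (q * M) (f b)"
  defines "S \<equiv> (\<Sum>b\<in>B. \<Sum>j\<in>units_below q M. (norm (f b j))\<^sup>2)"
  shows "S = 0 \<or> S \<ge> real (card (units_below q M))"
    "S = real (card (units_below q M)) \<Longrightarrow>
      \<exists>b\<in>B. root_of_unity (f b 1) \<and> (\<forall>b'\<in>B. b' \<noteq> b \<longrightarrow> f b' 1 = 0)"
    "(\<Sum>b\<in>B. f b 0 * cnj (f b 0)) = of_int (int q * t) \<Longrightarrow> prime q \<Longrightarrow>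
      S = 0 \<or> S \<ge> 2 * real (card (units_below q M))"
proof -
  define T where "T b = (\<Sum>j\<in>units_below q M. (norm (f b j))\<^sup>2)" for b
  define u where "u = real (card (units_below q M))"
  have ST: "S = (\<Sum>b\<in>B. T b)" by (simp add: S_def T_def)
  have T0: "T b \<ge> 0" for b unfolding T_def by (intro sum_nonneg) auto
  have u0: "u > 0" using card_units_below[of q M] q M by (simp add: u_def)
  have one: "1 \<in> units_below q M" using q M
    by (auto simp: units_below_def intro: less_le_trans[of _ q])
  have "\<exists>t. b \<in> B \<longrightarrow> f b 0 = of_int t" for b using virtual_char_zero_int[OF f] by metis
  then obtain \<tau> where \<tau>: "\<And>b. b \<in> B \<Longrightarrow> f b 0 = of_int (\<tau> b)" by metis
  have cases: "(int q dvd \<tau> b \<and> T b = 0 \<and> f b 1 = 0) \<or>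
      (\<not> int q dvd \<tau> b \<and> T b = u \<and> root_of_unity (f b 1)) \<or>
      (\<not> int q dvd \<tau> b \<and> T b > u) \<or> T b \<ge> 2 * u" if "b \<in> B" for b
    unfolding T_def u_def
    by (rule virtual_char_cases[OF q M f[OF that] \<tau>[OF that]]) (use one in auto)
  have Tu: "T b = 0 \<or> T b \<ge> u" if "b \<in> B" for b using cases[OF that] u0 by auto
  consider "\<forall>b\<in>B. T b = 0" | b where "b \<in> B" "T b \<noteq> 0" "\<forall>b'\<in>B. b' \<noteq> b \<longrightarrow> T b' = 0"
    | b b' where "b \<in> B" "b' \<in> B" "b \<noteq> b'" "T b \<noteq> 0" "T b' \<noteq> 0" by metis
  then have "(S = 0 \<or> S \<ge> u) \<and> (S = u \<longrightarrow> (\<exists>b\<in>B. root_of_unity (f b 1) \<and> (\<forall>b'\<in>B. b' \<noteq> b \<longrightarrow> f b' 1 = 0)))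
     \<and> ((\<Sum>b\<in>B. f b 0 * cnj (f b 0)) = of_int (int q * t) \<longrightarrow> prime q \<longrightarrow> S = 0 \<or> S \<ge> 2 * u)"
  proof cases
    case 1
    then show ?thesis using ST u0 by simp
  next
    case (2 b)
    have "S = (\<Sum>b\<in>{b}. T b)" unfolding ST using 2 fin by (intro sum.mono_neutral_right) auto
    then have Sb: "S = T b" by simp
    have z: "f b' 1 = 0 \<and> int q dvd \<tau> b'" if "b' \<in> B" "b' \<noteq> b" for b'
      using cases[OF that(1)] 2(3) that u0 by auto
    have "S \<ge> 2 * u" if e: "(\<Sum>b\<in>B. f b 0 * cnj (f b 0)) = of_int (int q * t)" and p: "prime q"
    proof -
      have "(\<Sum>b\<in>B. f b 0 * cnj (f b 0)) = of_int (\<Sum>b\<in>B. (\<tau> b)\<^sup>2)"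
        using \<tau> by (simp add: power2_eq_square)
      then have "(\<Sum>b\<in>B. (\<tau> b)\<^sup>2) = int q * t" using e by (simp only: of_int_eq_iff)
      moreover have "(\<Sum>b\<in>B. (\<tau> b)\<^sup>2) = (\<tau> b)\<^sup>2 + (\<Sum>b'\<in>B - {b}. (\<tau> b')\<^sup>2)"
        using 2 fin by (subst sum.remove[of _ b]) auto
      moreover have "int q dvd (\<Sum>b'\<in>B - {b}. (\<tau> b')\<^sup>2)"
        using z by (intro dvd_sum) (auto simp: power2_eq_square)
      ultimately have "int q dvd (\<tau> b)\<^sup>2" by (metis dvd_add_left_iff dvd_triv_left)
      then have "int q dvd \<tau> b" using p by (metis prime_dvd_power prime_nat_int_transfer)
      then show ?thesis using cases[OF 2(1)] 2(2) Sb by auto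
    qed
    moreover have "S = u \<longrightarrow> root_of_unity (f b 1)" using cases[OF 2(1)] u0 Sb by auto
    ultimately show ?thesis using Sb Tu[OF 2(1)] 2(1,2) z by blast
  next
    case (3 b b')
    have "(\<Sum>b\<in>{b,b'}. T b) \<le> S" unfolding ST using 3 fin T0 by (intro sum_mono2) auto
    moreover have "T b \<ge> u" "T b' \<ge> u" using Tu 3 by blast+
    ultimately have "S \<ge> 2 * u" using 3 by simp
    then show ?thesis using u0 by auto
  qed
  then show "S = 0 \<or> S \<ge> real (card (units_below q M))"
    "S = real (card (units_below q M)) \<Longrightarrow>
      \<exists>b\<in>B. root_of_unity (f b 1) \<and> (\<forall>b'\<in>B. b' \<noteq> b \<longrightarrow> f b' 1 = 0)"
    "(\<Sum>b\<in>B. f b 0 * cnj (f b 0)) = of_int (int q * t) \<Longrightarrow> prime q \<Longrightarrow>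
      S = 0 \<or> S \<ge> 2 * real (card (units_below q M))"
    unfolding u_def by blast+
qed

lemma virtual_char_vanishing:
  assumes "q \<ge> 2" "M > 0" "virtual_char (q * M) f" "\<And>j. j \<in> units_below q M \<Longrightarrow> f j = 0"
  obtains t where "f 0 = of_int (int q * t)"
proof -
  obtain t where t: "f 0 = of_int t" using virtual_char_zero_int[OF assms(3)] by blast
  have u0: "card (units_below q M) > 0" using card_units_below[of q M] assms by simp
  from virtual_char_cases[OF assms(1-3) t] have "int q dvd t"
    by cases (use assms(4) u0 in auto)
  then obtain k where "t = int q * k" by (rule dvdE)
  then show ?thesis using that[of k] t by simp
qed

section \<open>Matrix representations and Schur's lemma\<close>

text \<open>Unfolded to closure conditions, to keep the representation theory free of the module structures in
\<open>irreducible_rep\<close>; the lemma \<open>irreducible_rep_iff\<close> below gives the translation.\<close>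

definition invariant_subspace ::
    "('a, 'b) monoid_scheme \<Rightarrow> nat \<Rightarrow> ('a \<Rightarrow> complex mat) \<Rightarrow> complex vec set \<Rightarrow> bool" where
  "invariant_subspace G n \<rho> W \<longleftrightarrow> W \<subseteq> carrier_vec n \<and> 0\<^sub>v n \<in> W \<and>
     (\<forall>v\<in>W. \<forall>w\<in>W. v + w \<in> W) \<and> (\<forall>c. \<forall>w\<in>W. c \<cdot>\<^sub>v w \<in> W) \<and>
     (\<forall>g\<in>carrier G. \<forall>w\<in>W. \<rho> g *\<^sub>v w \<in> W)"

definition mat_rep :: "('a, 'b) monoid_scheme \<Rightarrow> nat \<Rightarrow> ('a \<Rightarrow> complex mat) \<Rightarrow> bool" where
  "mat_rep G n \<rho> \<longleftrightarrow> (\<forall>g\<in>carrier G. \<rho> g \<in> carrier_mat n n) \<and> \<rho> \<one>\<^bsub>G\<^esub> = 1\<^sub>m n \<and>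
     (\<forall>g\<in>carrier G. \<forall>h\<in>carrier G. \<rho> (g \<otimes>\<^bsub>G\<^esub> h) = \<rho> g * \<rho> h)"

lemma mat_repD:
  assumes "mat_rep G n \<rho>"
  shows "g \<in> carrier G \<Longrightarrow> \<rho> g \<in> carrier_mat n n" "\<rho> \<one>\<^bsub>G\<^esub> = 1\<^sub>m n"
    "g \<in> carrier G \<Longrightarrow> h \<in> carrier G \<Longrightarrow> \<rho> (g \<otimes>\<^bsub>G\<^esub> h) = \<rho> g * \<rho> h"
  using assms by (auto simp: mat_rep_def)

lemma subspace_iff:
  "VectorSpace.subspace class_ring W (complex_space n) \<longleftrightarrow>
     W \<subseteq> carrier_vec n \<and> 0\<^sub>v n \<in> W \<and> (\<forall>v\<in>W. \<forall>w\<in>W. v + w \<in> W) \<and> (\<forall>c. \<forall>w\<in>W. c \<cdot>\<^sub>v w \<in> W)"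
proof -
  interpret vec_space "TYPE(complex)" n .
  show ?thesis
    using vec_module[of n] vectorspace_axioms
    by (auto simp: VectorSpace.subspace_def submodule_def module_vec_simps class_ring_simps)
qed

lemma hom_GL_iff:
  assumes "group G"
  shows "\<rho> \<in> hom G (GL n) \<longleftrightarrow> mat_rep G n \<rho>"
proof -
  interpret G: group G by fact
  interpret R: ring "ring_mat TYPE(complex) n ()" by (rule ring_mat)
  interpret U: group "GL n" by (rule R.units_group)
  show ?thesis
  proof
    assume h: "\<rho> \<in> hom G (GL n)"
    have U: "\<rho> g \<in> carrier (GL n)" if "g \<in> carrier G" for g using h that by (auto simp: hom_def)
    have one: "\<rho> \<one>\<^bsub>G\<^esub> = \<one>\<^bsub>GL n\<^esub>" using hom_one[OF h G.is_group U.is_group] .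
    show "mat_rep G n \<rho>" unfolding mat_rep_def
      using U h one by (auto simp: hom_def units_of_def Units_def ring_mat_def)
  next
    assume r: "mat_rep G n \<rho>"
    have "\<rho> g \<in> Units (ring_mat TYPE(complex) n ())" if g: "g \<in> carrier G" for g
    proof -
      have "\<rho> (inv\<^bsub>G\<^esub> g) * \<rho> g = 1\<^sub>m n" "\<rho> g * \<rho> (inv\<^bsub>G\<^esub> g) = 1\<^sub>m n"
        using mat_repD[OF r] g by (metis G.inv_closed G.l_inv, metis G.inv_closed G.r_inv)
      moreover have "\<rho> (inv\<^bsub>G\<^esub> g) \<in> carrier_mat n n" "\<rho> g \<in> carrier_mat n n"
        using mat_repD[OF r] g by auto
      ultimately show ?thesis
        by (auto simp: Units_def ring_mat_def)
    qed
    then show "\<rho> \<in> hom G (GL n)"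
      using mat_repD[OF r] by (auto simp: hom_def units_of_def ring_mat_def)
  qed
qed

lemma irreducible_rep_iff:
  assumes "group G"
  shows "irreducible_rep G n \<rho> \<longleftrightarrow> mat_rep G n \<rho> \<and> n > 0 \<and>
    (\<forall>W. invariant_subspace G n \<rho> W \<longrightarrow> W = {0\<^sub>v n} \<or> W = carrier_vec n)"
  unfolding irreducible_rep_def hom_GL_iff[OF assms] subspace_iff invariant_subspace_def by blast

lemma mat_trace_carrier: "A \<in> carrier_mat n m \<Longrightarrow> mat_trace A = (\<Sum>i<n. A $$ (i, i))"
  by (auto simp: mat_trace_def)

lemma mat_mult_entry:
  assumes "A \<in> carrier_mat n m" "B \<in> carrier_mat m k" "i < n" "j < k"
  shows "(A * B) $$ (i, j) = (\<Sum>l<m. A $$ (i, l) * B $$ (l, j))"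
  using assms by (auto simp: scalar_prod_def atLeast0LessThan)

lemma mat_trace_mult_comm:
  fixes A B :: "'a :: comm_semiring_1 mat"
  assumes "A \<in> carrier_mat n m" "B \<in> carrier_mat m n"
  shows "mat_trace (A * B) = mat_trace (B * A)"
proof -
  have "mat_trace (A * B) = (\<Sum>i<n. \<Sum>l<m. A $$ (i, l) * B $$ (l, i))"
    by (subst mat_trace_carrier[of _ n n], use assms in simp, intro sum.cong refl,
        simp only: lessThan_iff mat_mult_entry[OF assms])
  also have "\<dots> = (\<Sum>l<m. \<Sum>i<n. B $$ (l, i) * A $$ (i, l))"
    by (subst sum.swap) (simp add: mult.commute)
  also have "\<dots> = mat_trace (B * A)"
    by (subst mat_trace_carrier[of _ m m], use assms in simp, intro sum.cong refl,
        simp only: lessThan_iff mat_mult_entry[OF assms(2,1)])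
  finally show ?thesis .
qed

lemma mat_trace_one: "mat_trace (1\<^sub>m n :: complex mat) = of_nat n"
  by (subst mat_trace_carrier[of _ n n]) auto

text \<open>The kernel and the image of an intertwiner are invariant. A two-sided inverse is produced columnwise
from surjectivity and injectivity; it yields equal characters by \<open>isomorphic_trace_eq\<close>.\<close>

lemma Schur_invertible:
  assumes G: "group G" and \<rho>: "irreducible_rep G n \<rho>" and \<sigma>: "irreducible_rep G m \<sigma>"
    and T: "T \<in> carrier_mat n m" and comm: "\<And>g. g \<in> carrier G \<Longrightarrow> \<rho> g * T = T * \<sigma> g"
    and "T \<noteq> 0\<^sub>m n m"
  obtains R where "R \<in> carrier_mat m n" "T * R = 1\<^sub>m n" "R * T = 1\<^sub>m m"
proof -
  note r = irreducible_rep_iff[OF G, THEN iffD1, OF \<rho>]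
  note s = irreducible_rep_iff[OF G, THEN iffD1, OF \<sigma>]
  have rc: "\<rho> g \<in> carrier_mat n n" "\<sigma> g \<in> carrier_mat m m" if "g \<in> carrier G" for g
    using r s that by (auto simp: mat_rep_def)
  define K where "K = {v \<in> carrier_vec m. T *\<^sub>v v = 0\<^sub>v n}"
  define I where "I = (\<lambda>v. T *\<^sub>v v) ` carrier_vec m"
  have ccm: "T *\<^sub>v (\<sigma> g *\<^sub>v v) = \<rho> g *\<^sub>v (T *\<^sub>v v)" if "g \<in> carrier G" "v \<in> carrier_vec m" for g v
    using comm[OF that(1)] rc[OF that(1)] T that(2) by (metis assoc_mult_mat_vec)
  have nz: "\<exists>v\<in>carrier_vec m. T *\<^sub>v v \<noteq> 0\<^sub>v n"
  proof (rule ccontr)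
    assume "\<not> ?thesis"
    then have z: "T *\<^sub>v v = 0\<^sub>v n" if "v \<in> carrier_vec m" for v using that by auto
    have "T = 0\<^sub>m n m"
    proof (rule eq_matI)
      fix i j assume ij: "i < dim_row (0\<^sub>m n m)" "j < dim_col (0\<^sub>m n m)"
      have "T $$ (i,j) = (T *\<^sub>v unit_vec m j) $ i" using ij T
        by auto
      then show "T $$ (i,j) = 0\<^sub>m n m $$ (i,j)" using z ij by auto
    qed (use T in auto)
    then show False using assms by blast
  qed
  have z: "\<rho> g *\<^sub>v 0\<^sub>v n = 0\<^sub>v n" if "g \<in> carrier G" for g
    using rc[OF that] by (intro eq_vecI) auto
  have "invariant_subspace G m \<sigma> K"
    unfolding invariant_subspace_def K_def using T rc ccm
    by (auto simp: mult_add_distrib_mat_vec[OF T] mult_mat_vec[OF T] z intro: mult_mat_vec_carrier)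
  then have "K = {0\<^sub>v m} \<or> K = carrier_vec m" using s by blast
  then have K: "K = {0\<^sub>v m}" using nz unfolding K_def by blast
  have "invariant_subspace G n \<rho> I"
    unfolding invariant_subspace_def I_def
  proof (intro conjI ballI allI)
    show "0\<^sub>v n \<in> (*\<^sub>v) T ` carrier_vec m" using T by (intro image_eqI[of _ _ "0\<^sub>v m"]) auto
  next
    fix v w assume "v \<in> (*\<^sub>v) T ` carrier_vec m" "w \<in> (*\<^sub>v) T ` carrier_vec m"
    then show "v + w \<in> (*\<^sub>v) T ` carrier_vec m"
      using T by (auto simp flip: mult_add_distrib_mat_vec[OF T])
  next
    fix c w assume "w \<in> (*\<^sub>v) T ` carrier_vec m"
    then show "c \<cdot>\<^sub>v w \<in> (*\<^sub>v) T ` carrier_vec m"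
      using T by (auto simp flip: mult_mat_vec[OF T])
  next
    fix g w assume "g \<in> carrier G" "w \<in> (*\<^sub>v) T ` carrier_vec m"
    then show "\<rho> g *\<^sub>v w \<in> (*\<^sub>v) T ` carrier_vec m"
      using T rc by (auto simp flip: ccm intro!: imageI mult_mat_vec_carrier)
  qed (use T in auto)
  then have "I = {0\<^sub>v n} \<or> I = carrier_vec n" using r by blast
  then have I: "I = carrier_vec n" using nz unfolding I_def by blast
  have "\<forall>i. \<exists>v. i < n \<longrightarrow> v \<in> carrier_vec m \<and> T *\<^sub>v v = unit_vec n i"
    using I unfolding I_def by (metis image_iff unit_vec_carrier)
  then obtain f where f: "\<And>i. i < n \<Longrightarrow> f i \<in> carrier_vec m \<and> T *\<^sub>v f i = unit_vec n i" by metis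
  define R where "R = mat_of_cols m (map f [0..<n])"
  have R: "R \<in> carrier_mat m n" unfolding R_def by auto
  have colR: "col R i = f i" if "i < n" for i
    unfolding R_def using f that by (subst col_mat_of_cols) auto
  have TR: "T * R = 1\<^sub>m n"
  proof (rule mat_col_eqI)
    fix i assume "i < dim_col (1\<^sub>m n)"
    then show "col (T * R) i = col (1\<^sub>m n) i" using T R f colR by (subst col_mult2[OF T R]) auto
  qed (use T R in auto)
  have RT: "R * T = 1\<^sub>m m"
  proof (rule mat_col_eqI)
    fix j assume j: "j < dim_col (1\<^sub>m m)"
    let ?v = "col (R * T) j - unit_vec m j"
    have "T *\<^sub>v ?v = T *\<^sub>v col (R * T) j - T *\<^sub>v unit_vec m j"
      using T R j by (intro mult_minus_distrib_mat_vec) auto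
    also have "T *\<^sub>v col (R * T) j = col (T * (R * T)) j"
      using T R j by (subst col_mult2[of T n m "R * T" m]) auto
    also have "T * (R * T) = T" using T R TR by (subst assoc_mult_mat[symmetric, of T n m R n T m]) auto
    also have "T *\<^sub>v unit_vec m j = col T j" using T j
      by (intro eq_vecI) auto
    also have "col T j - col T j = 0\<^sub>v n" using T j by auto
    finally have "?v \<in> K" unfolding K_def using T R j by auto
    then have v0: "?v = 0\<^sub>v m" using K by auto
    have "col (R * T) j = unit_vec m j"
    proof (rule eq_vecI)
      fix i assume i: "i < dim_vec (unit_vec m j)"
      have "?v $ i = 0" using v0 i by simp
      then show "col (R * T) j $ i = unit_vec m j $ i" using i T R j by auto
    qed (use T R in auto)
    then show "col (R * T) j = col (1\<^sub>m m) j" using j by auto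
  qed (use T R in auto)
  show ?thesis using that R TR RT by blast
qed

text \<open>Subtracting an eigenvalue makes the intertwiner singular, so it becomes zero.\<close>

lemma Schur_scalar:
  assumes G: "group G" and \<rho>: "irreducible_rep G n \<rho>"
    and T: "T \<in> carrier_mat n n" and comm: "\<And>g. g \<in> carrier G \<Longrightarrow> \<rho> g * T = T * \<rho> g"
  obtains c where "T = c \<cdot>\<^sub>m 1\<^sub>m n"
proof -
  note r = irreducible_rep_iff[OF G, THEN iffD1, OF \<rho>]
  have rc: "\<rho> g \<in> carrier_mat n n" if "g \<in> carrier G" for g
    using r that by (auto simp: mat_rep_def)
  obtain c where "eigenvalue T c"
    using spectrum_non_empty[OF T] r unfolding spectrum_def by auto
  then obtain v where v: "v \<in> carrier_vec n" "v \<noteq> 0\<^sub>v n" "T *\<^sub>v v = c \<cdot>\<^sub>v v"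
    using T unfolding eigenvalue_def eigenvector_def by auto
  define S where "S = T - c \<cdot>\<^sub>m 1\<^sub>m n"
  have S: "S \<in> carrier_mat n n" unfolding S_def using T by auto
  have Sv: "S *\<^sub>v v = 0\<^sub>v n" unfolding S_def
    using T v by (subst minus_mult_distrib_mat_vec[of _ n n]) (auto intro!: eq_vecI)
  have "S = 0\<^sub>m n n"
  proof (rule ccontr)
    assume nz: "S \<noteq> 0\<^sub>m n n"
    have "\<rho> g * S = S * \<rho> g" if "g \<in> carrier G" for g
    proof -
      have "\<rho> g * S = \<rho> g * T - \<rho> g * (c \<cdot>\<^sub>m 1\<^sub>m n)"
        unfolding S_def using rc[OF that] T by (intro mult_minus_distrib_mat) auto
      also have "\<rho> g * (c \<cdot>\<^sub>m 1\<^sub>m n) = (c \<cdot>\<^sub>m 1\<^sub>m n) * \<rho> g"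
        using rc[OF that] by (subst mult_smult_distrib[of _ n n]) (auto simp: mult_smult_assoc_mat[of _ n n])
      also have "\<rho> g * T - (c \<cdot>\<^sub>m 1\<^sub>m n) * \<rho> g = S * \<rho> g"
        unfolding S_def comm[OF that] using rc[OF that] T by (intro minus_mult_distrib_mat[symmetric]) auto
      finally show ?thesis .
    qed
    then obtain R where R: "R \<in> carrier_mat n n" "R * S = 1\<^sub>m n"
      using Schur_invertible[OF G \<rho> \<rho> S _ nz] by metis
    have "v = R * S *\<^sub>v v" using R v by auto
    also have "\<dots> = R *\<^sub>v (S *\<^sub>v v)" using R S v by (intro assoc_mult_mat_vec) auto
    also have "\<dots> = 0\<^sub>v n" using Sv R by auto
    finally show False using v by blast
  qed
  have "T = c \<cdot>\<^sub>m 1\<^sub>m n"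
  proof (rule eq_matI)
    fix i j assume ij: "i < dim_row (c \<cdot>\<^sub>m 1\<^sub>m n)" "j < dim_col (c \<cdot>\<^sub>m 1\<^sub>m n)"
    have "S $$ (i,j) = 0" using \<open>S = 0\<^sub>m n n\<close> ij by simp
    then show "T $$ (i,j) = (c \<cdot>\<^sub>m 1\<^sub>m n) $$ (i,j)" using T ij unfolding S_def by auto
  qed (use T in auto)
  then show ?thesis using that by blast
qed

lemma isomorphic_trace_eq:
  fixes T :: "complex mat"
  assumes "T \<in> carrier_mat n m" "R \<in> carrier_mat m n" "T * R = 1\<^sub>m n"
    "A \<in> carrier_mat n n" "B \<in> carrier_mat m m" "A * T = T * B" "R * T = 1\<^sub>m m"
  shows "mat_trace A = mat_trace B"
proof -
  have "mat_trace A = mat_trace (A * (T * R))" using assms by auto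
  also have "A * (T * R) = (A * T) * R" 
    by (rule assoc_mult_mat[symmetric, OF assms(4,1,2)])
  also have "\<dots> = T * (B * R)" unfolding assms(6)
    using assms(1,2,5) by (intro assoc_mult_mat)
  also have "mat_trace \<dots> = mat_trace (B * R * T)" using assms by (intro mat_trace_mult_comm[of _ n m]) auto
  also have "B * R * T = B" using assms by (simp add: assoc_mult_mat[of B m m R n T m])
  finally show ?thesis .
qed

section \<open>Irreducible constituents\<close>

text \<open>A basis of \<open>W\<close>, extended to a basis of the whole space and written into the columns of \<open>P\<close>.
Both bases are independent sets of greatest cardinality.\<close>

lemma adapted_basis:
  fixes W :: "complex vec set"
  assumes W: "VectorSpace.subspace class_ring W (complex_space n)"
    and "W \<noteq> {0\<^sub>v n}" "W \<noteq> carrier_vec n"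
  obtains m P where "0 < m" "m < n" "P \<in> carrier_mat n n" "det P \<noteq> 0"
    "\<And>j. j < m \<Longrightarrow> col P j \<in> W"
    "\<And>w. w \<in> W \<Longrightarrow> \<exists>v\<in>carrier_vec n. w = P *\<^sub>v v \<and> (\<forall>i. m \<le> i \<and> i < n \<longrightarrow> v $ i = 0)"
proof -
  interpret vec_space "TYPE(complex)" n .
  have Wc: "W \<subseteq> carrier_vec n" using W subspace_iff by auto
  have Wsub: "submodule class_ring W V" using W by (simp add: VectorSpace.subspace_def)
  have fin: "finite S \<and> card S \<le> n" if "S \<subseteq> carrier_vec n" "lin_indpt S" for S
    using li_le_dim[of S] that by (simp add: dim_is_n)
  obtain S where S: "S \<subseteq> W" "lin_indpt S"
    and Smax: "\<And>S'. S' \<subseteq> W \<Longrightarrow> lin_indpt S' \<Longrightarrow> card S' \<le> card S"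
  proof -
    have "lin_indpt {}" by (rule finite_lin_indpt2) auto
    moreover have "\<forall>S. S \<subseteq> W \<and> lin_indpt S \<longrightarrow> card S < Suc n"
    proof (intro allI impI)
      fix S assume S: "S \<subseteq> W \<and> lin_indpt S"
      then have "S \<subseteq> carrier_vec n" using Wc by (metis order_trans)
      then show "card S < Suc n" using fin S by (metis le_imp_less_Suc)
    qed
    ultimately have "\<exists>S. (S \<subseteq> W \<and> lin_indpt S) \<and> (\<forall>S'. S' \<subseteq> W \<and> lin_indpt S' \<longrightarrow> card S' \<le> card S)"
      by (intro Lattices_Big.ex_has_greatest_nat[of _ "{}" card "Suc n"]) auto
    then show ?thesis by (elim exE conjE, intro that) auto
  qed
  have Sc: "S \<subseteq> carrier_vec n" using S Wc by auto
  have Sfin: "finite S" using fin[OF Sc] S by auto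
  have WS: "W \<subseteq> span S"
  proof
    fix w assume w: "w \<in> W"
    show "w \<in> span S"
    proof (rule ccontr)
      assume ns: "w \<notin> span S"
      then have "w \<notin> S" using in_own_span[of S] Sc by auto
      moreover have "lin_indpt (insert w S)"
        using lin_dep_iff_in_span[of S w] ns \<open>w \<notin> S\<close> S Sc w Wc by auto
      ultimately show False using Smax[of "insert w S"] w S Sfin by auto
    qed
  qed
  obtain T where T: "S \<subseteq> T" "T \<subseteq> carrier_vec n" "lin_indpt T"
    and Tmax: "\<And>S'. S \<subseteq> S' \<Longrightarrow> S' \<subseteq> carrier_vec n \<Longrightarrow> lin_indpt S' \<Longrightarrow> card S' \<le> card T"
  proof -
    have "\<forall>T. S \<subseteq> T \<and> T \<subseteq> carrier_vec n \<and> lin_indpt T \<longrightarrow> card T < Suc n"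
      using fin by (metis le_imp_less_Suc)
    then have "\<exists>T. (S \<subseteq> T \<and> T \<subseteq> carrier_vec n \<and> lin_indpt T) \<and>
        (\<forall>S'. S \<subseteq> S' \<and> S' \<subseteq> carrier_vec n \<and> lin_indpt S' \<longrightarrow> card S' \<le> card T)"
      using Sc S(2) by (intro Lattices_Big.ex_has_greatest_nat[of _ S card "Suc n"]) auto
    then show ?thesis by (elim exE conjE, intro that) auto
  qed
  have Tfin: "finite T" using fin T by auto
  have cT: "carrier_vec n \<subseteq> span T"
  proof
    fix w :: "complex vec" assume w: "w \<in> carrier_vec n"
    show "w \<in> span T"
    proof (rule ccontr)
      assume ns: "w \<notin> span T"
      then have "w \<notin> T" using in_own_span[of T] T by auto
      moreover have "lin_indpt (insert w T)"
        using lin_dep_iff_in_span[of T w] ns \<open>w \<notin> T\<close> T w by auto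
      ultimately show False using Tmax[of "insert w T"] w T Tfin by auto
    qed
  qed
  have "basis T" unfolding basis_def using T cT span_is_subset2[of T] by auto
  then have cardT: "card T = n" using dim_basis[OF Tfin] dim_is_n by simp
  obtain xs where xs: "set xs = S" "distinct xs" using finite_distinct_list[OF Sfin] by blast
  obtain ys where ys: "set ys = T - S" "distinct ys" using finite_distinct_list[of "T - S"] Tfin by blast
  define P where "P = mat_of_cols n (xs @ ys)"
  define m where "m = length xs"
  have setP: "set (xs @ ys) = T" and dP: "distinct (xs @ ys)" using xs ys T by auto
  have len: "length (xs @ ys) = n" using distinct_card[OF dP] setP cardT by simp
  have P: "P \<in> carrier_mat n n" unfolding P_def using len by (metis mat_of_cols_carrier(1))
  have cols: "cols P = xs @ ys" unfolding P_def
    using setP T by (intro cols_mat_of_cols) auto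
  have colP: "col P j = (xs @ ys) ! j" if "j < n" for j
    using cols that P by (metis carrier_matD(2) cols_nth)
  have rank: "rank P = n" using lin_indpt_full_rank[OF P] cols dP setP T by auto
  have Wsp: "\<exists>v\<in>carrier_vec n. w = P *\<^sub>v v \<and> (\<forall>i. m \<le> i \<and> i < n \<longrightarrow> v $ i = 0)" if "w \<in> W" for w
  proof -
    have "w \<in> span S" using WS that by blast
    then obtain a where a: "w = lincomb a S"
      using finite_span[OF Sfin] Sc by auto
    define b where "b x = (if x \<in> S then a x else 0)" for x
    have "lincomb a S = lincomb b T"
    proof (rule eq_vecI)
      fix i assume "i < dim_vec (lincomb b T)"
      then have i: "i < n" using lincomb_dim[OF Tfin T(2)] by simp
      show "lincomb a S $ i = lincomb b T $ i"
        unfolding lincomb_index[OF i Sc] lincomb_index[OF i T(2)]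
        by (rule sum.mono_neutral_cong_left[OF Tfin T(1)]) (auto simp: b_def)
    qed (simp add: lincomb_dim[OF Tfin T(2)] lincomb_dim[OF Sfin Sc])
    also have "\<dots> = P *\<^sub>v vec n (\<lambda>i. b (col P i))"
      using mat_mult_eq_lincomb[OF P, of b] cols dP setP by simp
    finally have "w = P *\<^sub>v vec n (\<lambda>i. b (col P i))" using a by simp
    moreover have "vec n (\<lambda>i. b (col P i)) $ i = 0" if "m \<le> i" "i < n" for i
    proof -
      have "(xs @ ys) ! i \<in> set ys" using that len unfolding m_def by (auto simp: nth_append)
      then show ?thesis using that ys colP[of i] by (simp add: b_def)
    qed
    ultimately show ?thesis by (intro bexI[of _ "vec n (\<lambda>i. b (col P i))"]) auto
  qed
  have colW: "col P j \<in> W" if "j < m" for j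
  proof -
    have "j < n" using that len m_def by auto
    then show ?thesis using that colP[of j] xs S by (auto simp: m_def nth_append)
  qed
  have "m \<noteq> 0"
  proof
    assume "m = 0"
    then have "w = 0\<^sub>v n" if w: "w \<in> W" for w
    proof -
      obtain v where v: "v \<in> carrier_vec n" "w = P *\<^sub>v v" "\<forall>i<n. v $ i = 0"
        using Wsp[OF w] \<open>m = 0\<close> by auto
      have "v = 0\<^sub>v n" using v by (intro eq_vecI) auto
      then show ?thesis using v P by (auto intro!: eq_vecI)
    qed
    then show False using assms(2) W subspace_iff[of W n] by blast
  qed
  moreover have "m \<noteq> n"
  proof
    assume "m = n"
    then have "card S = card T" using cardT xs distinct_card m_def by metis
    then have "S = T" using card_subset_eq[OF Tfin T(1)] by simp
    then have "carrier_vec n \<subseteq> W" using cT span_is_subset[OF S(1) Wsub] by simp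
    then show False using Wc assms(3) by blast
  qed
  moreover have "m \<le> n" using len m_def by auto
  ultimately show ?thesis
    using that[of m P] P Wsp colW rank det_rank_iff[OF P] by auto
qed

text \<open>In a basis adapted to an invariant subspace all matrices are block triangular. The two diagonal
blocks are representations again, on the subspace and on the quotient, and the trace is additive.\<close>

lemma reducible_rep_splits:
  assumes G: "group G" and \<rho>: "mat_rep G n \<rho>" "n > 0" "\<not> irreducible_rep G n \<rho>"
  obtains m k \<rho>\<^sub>1 \<rho>\<^sub>2 where "m < n" "k < n" "mat_rep G m \<rho>\<^sub>1" "mat_rep G k \<rho>\<^sub>2"
    "\<And>g. g \<in> carrier G \<Longrightarrow> mat_trace (\<rho> g) = mat_trace (\<rho>\<^sub>1 g) + mat_trace (\<rho>\<^sub>2 g)"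
proof -
  interpret G: group G by fact
  obtain W where W: "invariant_subspace G n \<rho> W" "W \<noteq> {0\<^sub>v n}" "W \<noteq> carrier_vec n"
    using assms irreducible_rep_iff[OF G] by blast
  have "VectorSpace.subspace class_ring W (complex_space n)"
    using W(1) by (auto simp: subspace_iff invariant_subspace_def)
  from adapted_basis[OF this W(2,3)] obtain m P where m: "0 < m" "m < n"
    and P: "P \<in> carrier_mat n n" "det P \<noteq> 0" and colW: "\<And>j. j < m \<Longrightarrow> col P j \<in> W"
    and WP: "\<And>w. w \<in> W \<Longrightarrow> \<exists>v\<in>carrier_vec n. w = P *\<^sub>v v \<and> (\<forall>i. m \<le> i \<and> i < n \<longrightarrow> v $ i = 0)"
    by metis
  obtain R where R: "R \<in> carrier_mat n n" "R * P = 1\<^sub>m n" "P * R = 1\<^sub>m n"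
    using det_non_zero_imp_unit[OF P] unfolding Units_def ring_mat_def by auto
  define k where "k = n - m"
  have n: "n = m + k" using m k_def by simp
  define \<sigma> where "\<sigma> g = R * (\<rho> g * P)" for g
  note rc = mat_repD[OF \<rho>(1)]
  have \<sigma>: "\<sigma> g \<in> carrier_mat n n" if "g \<in> carrier G" for g
    unfolding \<sigma>_def using rc(1)[OF that] R P by auto
  have \<sigma>1: "\<sigma> \<one>\<^bsub>G\<^esub> = 1\<^sub>m n" unfolding \<sigma>_def rc(2) using R P by simp
  have \<sigma>m: "\<sigma> (g \<otimes>\<^bsub>G\<^esub> h) = \<sigma> g * \<sigma> h" if g: "g \<in> carrier G" and h: "h \<in> carrier G" for g h
  proof -
    have c: "\<rho> g \<in> carrier_mat n n" "\<rho> h \<in> carrier_mat n n" using rc g h by auto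
    have "\<sigma> g * \<sigma> h = R * ((\<rho> g * P) * (R * (\<rho> h * P)))"
      unfolding \<sigma>_def using c R P by (intro assoc_mult_mat[of _ n n _ n _ n]) auto
    also have "(\<rho> g * P) * (R * (\<rho> h * P)) = \<rho> g * (P * (R * (\<rho> h * P)))"
      using c R P by (intro assoc_mult_mat[of _ n n _ n _ n]) auto
    also have "P * (R * (\<rho> h * P)) = (P * R) * (\<rho> h * P)"
      using c R P by (intro assoc_mult_mat[of _ n n _ n _ n, symmetric]) auto
    also have "\<dots> = \<rho> h * P" using c R P by simp
    also have "\<rho> g * (\<rho> h * P) = (\<rho> g * \<rho> h) * P"
      using c R P by (intro assoc_mult_mat[of _ n n _ n _ n, symmetric]) auto
    finally show ?thesis unfolding \<sigma>_def using rc(3)[OF g h] by simp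
  qed
  have tr: "mat_trace (\<sigma> g) = mat_trace (\<rho> g)" if g: "g \<in> carrier G" for g
  proof -
    have c: "\<rho> g \<in> carrier_mat n n" using rc g by auto
    have "mat_trace (\<sigma> g) = mat_trace ((\<rho> g * P) * R)"
      unfolding \<sigma>_def using c R P by (intro mat_trace_mult_comm[of _ n n]) auto
    also have "(\<rho> g * P) * R = \<rho> g * (P * R)"
      using c R P by (intro assoc_mult_mat[of _ n n _ n _ n]) auto
    finally show ?thesis using R c by simp
  qed
  have low: "\<sigma> g $$ (i, j) = 0" if g: "g \<in> carrier G" and ij: "j < m" "m \<le> i" "i < n" for g i j
  proof -
    have c: "\<rho> g \<in> carrier_mat n n" using rc g by auto
    have "\<rho> g *\<^sub>v col P j \<in> W" using W(1) colW[OF ij(1)] g by (auto simp: invariant_subspace_def)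
    then obtain v where v: "v \<in> carrier_vec n" "\<rho> g *\<^sub>v col P j = P *\<^sub>v v" "v $ i = 0"
      using WP ij by blast
    have jn: "j < n" using ij m by simp
    have "col (\<sigma> g) j = R *\<^sub>v (\<rho> g *\<^sub>v col P j)"
    proof -
      have "col (R * (\<rho> g * P)) j = R *\<^sub>v col (\<rho> g * P) j"
        using c R P jn by (intro col_mult2[of _ n n _ n]) auto
      also have "col (\<rho> g * P) j = \<rho> g *\<^sub>v col P j"
        using c P jn by (intro col_mult2[of _ n n _ n]) auto
      finally show ?thesis by (simp add: \<sigma>_def)
    qed
    also have "\<dots> = (R * P) *\<^sub>v v" unfolding v using R P v by (intro assoc_mult_mat_vec[symmetric]) auto
    also have "\<dots> = v" using R v by simp
    finally have "col (\<sigma> g) j $ i = 0" using v by simp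
    then show ?thesis using \<sigma>[OF g] ij jn by simp
  qed
  have entry: "\<sigma> (g \<otimes>\<^bsub>G\<^esub> h) $$ (i, j) =
      (\<Sum>l<m. \<sigma> g $$ (i, l) * \<sigma> h $$ (l, j)) + (\<Sum>l<k. \<sigma> g $$ (i, l + m) * \<sigma> h $$ (l + m, j))"
    if "g \<in> carrier G" "h \<in> carrier G" "i < n" "j < n" for g h i j
    unfolding \<sigma>m[OF that(1,2)] mat_mult_entry[OF \<sigma>[OF that(1)] \<sigma>[OF that(2)] that(3,4)]
    by (subst (1) n) (rule sum_lessThan_add)
  define \<rho>1 where "\<rho>1 g = mat m m (\<lambda>(i, j). \<sigma> g $$ (i, j))" for g
  define \<rho>2 where "\<rho>2 g = mat k k (\<lambda>(i, j). \<sigma> g $$ (i + m, j + m))" for g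
  have "mat_rep G m \<rho>1" unfolding mat_rep_def
  proof (intro conjI ballI)
    show "\<rho>1 g \<in> carrier_mat m m" for g unfolding \<rho>1_def by simp
    show "\<rho>1 \<one>\<^bsub>G\<^esub> = 1\<^sub>m m" unfolding \<rho>1_def \<sigma>1 using n by (intro eq_matI) auto
    fix g h assume gh: "g \<in> carrier G" "h \<in> carrier G"
    show "\<rho>1 (g \<otimes>\<^bsub>G\<^esub> h) = \<rho>1 g * \<rho>1 h"
    proof (rule eq_matI)
      fix i j assume "i < dim_row (\<rho>1 g * \<rho>1 h)" "j < dim_col (\<rho>1 g * \<rho>1 h)"
      then have ij: "i < m" "j < m" by (auto simp: \<rho>1_def)
      have "(\<rho>1 g * \<rho>1 h) $$ (i, j) = (\<Sum>l<m. \<rho>1 g $$ (i, l) * \<rho>1 h $$ (l, j))"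
        by (rule mat_mult_entry) (use ij in \<open>auto simp: \<rho>1_def\<close>)
      also have "\<dots> = (\<Sum>l<m. \<sigma> g $$ (i, l) * \<sigma> h $$ (l, j))"
        using ij by (intro sum.cong) (auto simp: \<rho>1_def)
      also have "\<dots> = \<sigma> (g \<otimes>\<^bsub>G\<^esub> h) $$ (i, j)"
        using ij gh n low[OF gh(2)] by (subst entry) (auto intro!: sum.neutral)
      finally show "\<rho>1 (g \<otimes>\<^bsub>G\<^esub> h) $$ (i, j) = (\<rho>1 g * \<rho>1 h) $$ (i, j)" using ij by (simp add: \<rho>1_def)
    qed (auto simp: \<rho>1_def)
  qed
  moreover have "mat_rep G k \<rho>2" unfolding mat_rep_def
  proof (intro conjI ballI)
    show "\<rho>2 g \<in> carrier_mat k k" for g unfolding \<rho>2_def by simp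
    show "\<rho>2 \<one>\<^bsub>G\<^esub> = 1\<^sub>m k" unfolding \<rho>2_def \<sigma>1 using n by (intro eq_matI) auto
    fix g h assume gh: "g \<in> carrier G" "h \<in> carrier G"
    show "\<rho>2 (g \<otimes>\<^bsub>G\<^esub> h) = \<rho>2 g * \<rho>2 h"
    proof (rule eq_matI)
      fix i j assume "i < dim_row (\<rho>2 g * \<rho>2 h)" "j < dim_col (\<rho>2 g * \<rho>2 h)"
      then have ij: "i < k" "j < k" by (auto simp: \<rho>2_def)
      have "(\<rho>2 g * \<rho>2 h) $$ (i, j) = (\<Sum>l<k. \<rho>2 g $$ (i, l) * \<rho>2 h $$ (l, j))"
        by (rule mat_mult_entry) (use ij in \<open>auto simp: \<rho>2_def\<close>)
      also have "\<dots> = (\<Sum>l<k. \<sigma> g $$ (i + m, l + m) * \<sigma> h $$ (l + m, j + m))"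
        using ij by (intro sum.cong) (auto simp: \<rho>2_def)
      also have "\<dots> = \<sigma> (g \<otimes>\<^bsub>G\<^esub> h) $$ (i + m, j + m)"
        using ij gh n low[OF gh(1)] by (subst entry) (auto intro!: sum.neutral)
      finally show "\<rho>2 (g \<otimes>\<^bsub>G\<^esub> h) $$ (i, j) = (\<rho>2 g * \<rho>2 h) $$ (i, j)" using ij by (simp add: \<rho>2_def)
    qed (auto simp: \<rho>2_def)
  qed
  moreover have "mat_trace (\<rho> g) = mat_trace (\<rho>1 g) + mat_trace (\<rho>2 g)" if g: "g \<in> carrier G" for g
  proof -
    have "mat_trace (\<rho> g) = (\<Sum>i<n. \<sigma> g $$ (i, i))"
      using tr[OF g] mat_trace_carrier[OF \<sigma>[OF g]] by simp
    also have "\<dots> = (\<Sum>i<m. \<sigma> g $$ (i, i)) + (\<Sum>i<k. \<sigma> g $$ (i + m, i + m))"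
      by (subst (1) n) (rule sum_lessThan_add)
    finally show ?thesis
      by (simp add: mat_trace_def \<rho>1_def \<rho>2_def)
  qed
  moreover have "m < n" "k < n" using m n by auto
  ultimately show ?thesis using that by blast
qed

text \<open>The traces of the composition factors. A list records the multiplicities.\<close>

lemma rep_trace_constituents:
  assumes G: "group G" and "mat_rep G n \<rho>"
  shows "\<exists>\<Phi>. (\<forall>\<phi>\<in>set \<Phi>. irreducible_character G \<phi>) \<and>
    (\<forall>g\<in>carrier G. mat_trace (\<rho> g) = (\<Sum>\<phi>\<leftarrow>\<Phi>. \<phi> g))"
  using assms(2)
proof (induction n arbitrary: \<rho> rule: less_induct)
  case (less n)
  consider "n = 0" | "irreducible_rep G n \<rho>" | "n > 0" "\<not> irreducible_rep G n \<rho>" by auto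
  then show ?case
  proof cases
    case 1
    then show ?thesis using less.prems by (intro exI[of _ "[]"]) (auto simp: mat_rep_def mat_trace_def)
  next
    case 2
    then show ?thesis
      by (intro exI[of _ "[\<lambda>g. mat_trace (\<rho> g)]"]) (auto simp: irreducible_character_def)
  next
    case 3
    from reducible_rep_splits[OF G less.prems 3] obtain m k \<rho>\<^sub>1 \<rho>\<^sub>2
      where *: "m < n" "k < n" "mat_rep G m \<rho>\<^sub>1" "mat_rep G k \<rho>\<^sub>2"
      "\<And>g. g \<in> carrier G \<Longrightarrow> mat_trace (\<rho> g) = mat_trace (\<rho>\<^sub>1 g) + mat_trace (\<rho>\<^sub>2 g)" by metis
    obtain \<Phi>\<^sub>1 where 1: "\<forall>\<phi>\<in>set \<Phi>\<^sub>1. irreducible_character G \<phi>"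
      "\<forall>g\<in>carrier G. mat_trace (\<rho>\<^sub>1 g) = (\<Sum>\<phi>\<leftarrow>\<Phi>\<^sub>1. \<phi> g)" using less.IH[OF *(1,3)] by blast
    obtain \<Phi>\<^sub>2 where 2: "\<forall>\<phi>\<in>set \<Phi>\<^sub>2. irreducible_character G \<phi>"
      "\<forall>g\<in>carrier G. mat_trace (\<rho>\<^sub>2 g) = (\<Sum>\<phi>\<leftarrow>\<Phi>\<^sub>2. \<phi> g)" using less.IH[OF *(2,4)] by blast
    show ?thesis
      by (rule exI[of _ "\<Phi>\<^sub>1 @ \<Phi>\<^sub>2"]) (use 1 2 *(5) in auto)
  qed
qed

section \<open>Orthogonality of irreducible characters\<close>

lemma mat_rep_restrict:
  assumes "mat_rep G n \<rho>" "subgroup H G"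
  shows "mat_rep (G\<lparr>carrier := H\<rparr>) n \<rho>"
  using assms subgroup.subset[OF assms(2)] by (auto simp: mat_rep_def subset_iff)

text \<open>A central element acts as a scalar; powers of the element act as the powers of the scalar.\<close>

lemma central_element_scalar:
  assumes G: "group G" and \<rho>: "irreducible_rep G n \<rho>" and z: "z \<in> carrier G"
    and comm: "\<And>h. h \<in> carrier G \<Longrightarrow> z \<otimes>\<^bsub>G\<^esub> h = h \<otimes>\<^bsub>G\<^esub> z"
  obtains c where "\<And>j :: nat. \<rho> (z [^]\<^bsub>G\<^esub> j) = c ^ j \<cdot>\<^sub>m 1\<^sub>m n"
    "\<And>m :: nat. z [^]\<^bsub>G\<^esub> m = \<one>\<^bsub>G\<^esub> \<Longrightarrow> c ^ m = 1"
proof -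
  interpret G: group G by fact
  have r: "mat_rep G n \<rho>" "n > 0" using \<rho> irreducible_rep_iff[OF G] by auto
  note rc = mat_repD[OF r(1)]
  have "\<rho> h * \<rho> z = \<rho> z * \<rho> h" if "h \<in> carrier G" for h
    using rc(3)[OF z that] rc(3)[OF that z] comm[OF that] by simp
  then obtain c where c: "\<rho> z = c \<cdot>\<^sub>m 1\<^sub>m n" using Schur_scalar[OF G \<rho> rc(1)[OF z]] by metis
  have p: "\<rho> (z [^]\<^bsub>G\<^esub> j) = c ^ j \<cdot>\<^sub>m 1\<^sub>m n" for j :: nat
  proof (induction j)
    case 0
    then show ?case using rc(2) by (auto intro!: eq_matI)
  next
    case (Suc j)
    then show ?case using rc(3)[of "z [^]\<^bsub>G\<^esub> j" z] z c
      by (auto intro!: eq_matI simp: mult_smult_distrib[of _ n n] mult_smult_assoc_mat[of _ n n])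
  qed
  have "c ^ m = 1" if "z [^]\<^bsub>G\<^esub> m = \<one>\<^bsub>G\<^esub>" for m :: nat
  proof -
    have "c ^ m \<cdot>\<^sub>m 1\<^sub>m n = (1\<^sub>m n :: complex mat)" using p[of m] that rc(2) by simp
    then have "(c ^ m \<cdot>\<^sub>m 1\<^sub>m n) $$ (0, 0) = (1\<^sub>m n :: complex mat) $$ (0, 0)" by simp
    then show ?thesis using r(2) by simp
  qed
  then show ?thesis using that p by blast
qed

lemma mat_trace_smult:
  assumes "A \<in> carrier_mat n n"
  shows "mat_trace (c \<cdot>\<^sub>m A) = c * mat_trace (A :: complex mat)"
  using assms by (simp add: mat_trace_carrier[of _ n n] sum_distrib_left)

lemma irreducible_character_constituents:
  assumes G: "group G" and H: "subgroup H G" and \<chi>: "irreducible_character G \<chi>"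
  shows "\<exists>\<Phi>. (\<forall>\<phi>\<in>set \<Phi>. irreducible_character (G\<lparr>carrier := H\<rparr>) \<phi>) \<and>
    (\<forall>h\<in>H. \<chi> h = (\<Sum>\<phi>\<leftarrow>\<Phi>. \<phi> h))"
proof -
  obtain n \<rho> where \<rho>: "irreducible_rep G n \<rho>" "\<And>g. g \<in> carrier G \<Longrightarrow> \<chi> g = mat_trace (\<rho> g)"
    using \<chi> unfolding irreducible_character_def by blast
  have "mat_rep (G\<lparr>carrier := H\<rparr>) n \<rho>"
    using mat_rep_restrict[OF _ H] \<rho>(1) irreducible_rep_iff[OF G] by blast
  from rep_trace_constituents[OF subgroup.subgroup_is_group[OF H G] this]
  show ?thesis using \<rho>(2) subgroup.subset[OF H] by (auto simp: subset_iff)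
qed

lemma (in group) inv_eq_pow:
  assumes "finite (carrier G)" "g \<in> carrier G"
  shows "inv g = g [^] (order G - 1)"
proof (rule inv_equality)
  have "order G > 0" using assms(1) order_gt_0_iff_finite by simp
  then have "g [^] (order G - 1) \<otimes> g = g [^] order G"
    using assms(2) nat_pow_Suc[of g "order G - 1"] by simp
  then show "g [^] (order G - 1) \<otimes> g = \<one>" using pow_order_eq_1[OF assms(2)] by simp
qed (use assms in auto)

text \<open>On its own centralizer \<open>g\<close> is central, so in every constituent of the restriction \<open>g\<close> is a scalar
root of unity, and the inverse of a root of unity is its conjugate.\<close>

lemma irreducible_character_inv:
  assumes G: "group G" and fin: "finite (carrier G)" and \<chi>: "irreducible_character G \<chi>"
    and g: "g \<in> carrier G"
  shows "\<chi> (inv\<^bsub>G\<^esub> g) = cnj (\<chi> g)"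
proof -
  interpret G: group G by fact
  define H where "H = {h \<in> carrier G. g \<otimes>\<^bsub>G\<^esub> h = h \<otimes>\<^bsub>G\<^esub> g}"
  have H: "subgroup H G"
  proof (rule G.subgroupI)
    show "H \<subseteq> carrier G" "H \<noteq> {}" using g by (auto simp: H_def)
    fix a assume a: "a \<in> H"
    then have ac: "a \<in> carrier G" "g \<otimes>\<^bsub>G\<^esub> a = a \<otimes>\<^bsub>G\<^esub> g" by (auto simp: H_def)
    have "inv\<^bsub>G\<^esub> a \<otimes>\<^bsub>G\<^esub> g = inv\<^bsub>G\<^esub> a \<otimes>\<^bsub>G\<^esub> (g \<otimes>\<^bsub>G\<^esub> a) \<otimes>\<^bsub>G\<^esub> inv\<^bsub>G\<^esub> a"
      using ac(1) g by (simp add: G.m_assoc)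
    also have "\<dots> = g \<otimes>\<^bsub>G\<^esub> inv\<^bsub>G\<^esub> a"
      unfolding ac(2) using ac(1) g by (simp add: G.m_assoc[symmetric])
    finally show "inv\<^bsub>G\<^esub> a \<in> H" using ac(1) by (simp add: H_def)
  next
    fix a b assume "a \<in> H" "b \<in> H"
    then show "a \<otimes>\<^bsub>G\<^esub> b \<in> H" using g by (simp add: H_def G.m_assoc) (metis G.m_assoc)
  qed
  let ?H = "G\<lparr>carrier := H\<rparr>"
  interpret H: group ?H using subgroup.subgroup_is_group[OF H G] .
  define N where "N = order G"
  have N0: "N > 0" using fin G.order_gt_0_iff_finite by (simp add: N_def)
  have gN: "g [^]\<^bsub>G\<^esub> N = \<one>\<^bsub>G\<^esub>" using G.pow_order_eq_1[OF g] by (simp add: N_def)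
  have gi: "inv\<^bsub>G\<^esub> g = g [^]\<^bsub>G\<^esub> (N - 1)"
    using G.inv_eq_pow[OF fin g] by (simp add: N_def)
  have pow: "x [^]\<^bsub>?H\<^esub> (j::nat) = x [^]\<^bsub>G\<^esub> j" for x j by (simp add: G.nat_pow_consistent[symmetric])
  obtain \<Phi> where \<Phi>: "\<forall>\<phi>\<in>set \<Phi>. irreducible_character ?H \<phi>" "\<forall>h\<in>H. \<chi> h = (\<Sum>\<phi>\<leftarrow>\<Phi>. \<phi> h)"
    using irreducible_character_constituents[OF G H \<chi>] by blast
  have gH: "g \<in> H" "inv\<^bsub>G\<^esub> g \<in> H" using g subgroup.m_inv_closed[OF H] by (auto simp: H_def)
  have "\<phi> (inv\<^bsub>G\<^esub> g) = cnj (\<phi> g)" if \<phi>: "\<phi> \<in> set \<Phi>" for \<phi>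
  proof -
    obtain n \<rho> where \<rho>: "irreducible_rep ?H n \<rho>" "\<And>g. g \<in> H \<Longrightarrow> \<phi> g = mat_trace (\<rho> g)"
      using bspec[OF \<Phi>(1) \<phi>] unfolding irreducible_character_def by auto
    obtain c where c: "\<And>j :: nat. \<rho> (g [^]\<^bsub>?H\<^esub> j) = c ^ j \<cdot>\<^sub>m 1\<^sub>m n"
      "\<And>m :: nat. g [^]\<^bsub>?H\<^esub> m = \<one>\<^bsub>?H\<^esub> \<Longrightarrow> c ^ m = 1"
      using central_element_scalar[OF H.is_group \<rho>(1), of g] gH by (auto simp: H_def)
    have cN: "c ^ N = 1" using c(2)[of N] gN by (simp add: pow)
    then have "norm c ^ N = 1" by (metis norm_one norm_power)
    then have "norm c = 1" using N0 power_eq_imp_eq_base[of "norm c" N 1] by simp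
    then have "cnj c = inverse c" by (rule cnj_eq_inverse)
    moreover have "c ^ (N - 1) * c = 1" using cN N0 by (metis Suc_diff_1 power_Suc2)
    ultimately have cc: "cnj c = c ^ (N - 1)" by (metis inverse_unique mult.commute)
    have "\<phi> (inv\<^bsub>G\<^esub> g) = c ^ (N - 1) * of_nat n"
      using \<rho>(2)[OF gH(2)] c(1)[of "N - 1"] gi
      by (simp add: pow mat_trace_smult[of _ n] mat_trace_one)
    moreover have "\<phi> g = c * of_nat n"
      using \<rho>(2)[OF gH(1)] c(1)[of 1] g
      by (simp add: pow mat_trace_smult[of _ n] mat_trace_one)
    ultimately show ?thesis using cc by simp
  qed
  then have "(\<Sum>\<phi>\<leftarrow>\<Phi>. \<phi> (inv\<^bsub>G\<^esub> g)) = (\<Sum>\<phi>\<leftarrow>\<Phi>. cnj (\<phi> g))" by (metis (mono_tags, lifting) map_eq_conv)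
  also have "\<dots> = cnj (\<Sum>\<phi>\<leftarrow>\<Phi>. \<phi> g)" by (induction \<Phi>) auto
  finally show ?thesis using \<Phi>(2) gH by simp
qed

lemma sum_group_translate:
  assumes "group G" "h \<in> carrier G"
  shows "(\<Sum>g\<in>carrier G. f (h \<otimes>\<^bsub>G\<^esub> g)) = (\<Sum>g\<in>carrier G. f g)"
proof -
  interpret group G by fact
  have "bij_betw (\<lambda>g. h \<otimes>\<^bsub>G\<^esub> g) (carrier G) (carrier G)"
    using assms(2) inj_on_multc by (intro bij_betw_byWitness[of _ "\<lambda>g. inv\<^bsub>G\<^esub> h \<otimes>\<^bsub>G\<^esub> g"])
      (auto simp: m_assoc[symmetric])
  then show ?thesis by (rule sum.reindex_bij_betw)
qed

text \<open>The average over the group of \<open>\<rho>(g) E \<sigma>(g\<^sup>-\<^sup>1)\<close>, with \<open>E\<close> the matrix unit in position \<open>(i, j)\<close>.\<close>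

lemma averaged_intertwiner:
  assumes G: "group G" and \<rho>: "mat_rep G n \<rho>" and \<sigma>: "mat_rep G m \<sigma>"
    and ij: "i < n" "j < m" and h: "h \<in> carrier G"
  defines "T \<equiv> mat n m (\<lambda>(a, b). \<Sum>g\<in>carrier G. \<rho> g $$ (a, i) * \<sigma> (inv\<^bsub>G\<^esub> g) $$ (j, b))"
  shows "\<rho> h * T = T * \<sigma> h"
proof -
  interpret G: group G by fact
  note r = mat_repD[OF \<rho>] and s = mat_repD[OF \<sigma>]
  have T: "T \<in> carrier_mat n m" by (simp add: T_def)
  show ?thesis
  proof (rule eq_matI)
    fix a b assume "a < dim_row (T * \<sigma> h)" "b < dim_col (T * \<sigma> h)"
    then have ab: "a < n" "b < m" using T s(1)[OF h] by auto
    have "(\<rho> h * T) $$ (a, b) = (\<Sum>c<n. \<rho> h $$ (a, c) * (\<Sum>g\<in>carrier G. \<rho> g $$ (c, i) * \<sigma> (inv\<^bsub>G\<^esub> g) $$ (j, b)))"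
      unfolding mat_mult_entry[OF r(1)[OF h] T ab] using ab by (simp add: T_def)
    also have "\<dots> = (\<Sum>g\<in>carrier G. \<Sum>c<n. \<rho> h $$ (a, c) * \<rho> g $$ (c, i) * \<sigma> (inv\<^bsub>G\<^esub> g) $$ (j, b))"
      by (subst sum.swap) (simp add: sum_distrib_left mult_ac)
    also have "\<dots> = (\<Sum>g\<in>carrier G. \<rho> (h \<otimes>\<^bsub>G\<^esub> g) $$ (a, i) * \<sigma> (inv\<^bsub>G\<^esub> g) $$ (j, b))"
      by (intro sum.cong refl)
        (simp add: r(3)[OF h] mat_mult_entry[OF r(1)[OF h] r(1)] ab ij sum_distrib_right)
    also have "\<dots> = (\<Sum>g\<in>carrier G. \<rho> (h \<otimes>\<^bsub>G\<^esub> g) $$ (a, i) * \<sigma> (inv\<^bsub>G\<^esub> (h \<otimes>\<^bsub>G\<^esub> g) \<otimes>\<^bsub>G\<^esub> h) $$ (j, b))"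
      by (intro sum.cong refl) (simp add: h G.inv_mult_group G.m_assoc)
    also have "\<dots> = (\<Sum>g\<in>carrier G. \<rho> g $$ (a, i) * \<sigma> (inv\<^bsub>G\<^esub> g \<otimes>\<^bsub>G\<^esub> h) $$ (j, b))"
      by (rule sum_group_translate[OF G h])
    also have "\<dots> = (\<Sum>g\<in>carrier G. \<Sum>c<m. \<rho> g $$ (a, i) * \<sigma> (inv\<^bsub>G\<^esub> g) $$ (j, c) * \<sigma> h $$ (c, b))"
      by (intro sum.cong refl)
        (simp add: s(3)[OF _ h] mat_mult_entry[OF s(1) s(1)[OF h]] ab ij sum_distrib_left mult_ac)
    also have "\<dots> = (\<Sum>c<m. (\<Sum>g\<in>carrier G. \<rho> g $$ (a, i) * \<sigma> (inv\<^bsub>G\<^esub> g) $$ (j, c)) * \<sigma> h $$ (c, b))"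
      by (subst sum.swap) (simp add: sum_distrib_right)
    also have "\<dots> = (T * \<sigma> h) $$ (a, b)"
      unfolding mat_mult_entry[OF T s(1)[OF h] ab] using ab by (simp add: T_def)
    finally show "(\<rho> h * T) $$ (a, b) = (T * \<sigma> h) $$ (a, b)" .
  qed (use T r(1)[OF h] s(1)[OF h] in auto)
qed

lemma sum_trace_product:
  assumes G: "group G" and \<rho>: "mat_rep G n \<rho>" and \<sigma>: "mat_rep G m \<sigma>"
  shows "(\<Sum>g\<in>carrier G. mat_trace (\<rho> g) * mat_trace (\<sigma> (inv\<^bsub>G\<^esub> g))) =
    (\<Sum>a<n. \<Sum>b<m. \<Sum>g\<in>carrier G. \<rho> g $$ (a, a) * \<sigma> (inv\<^bsub>G\<^esub> g) $$ (b, b))"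
proof -
  interpret G: group G by fact
  note r = mat_repD[OF \<rho>] and s = mat_repD[OF \<sigma>]
  have "(\<Sum>g\<in>carrier G. mat_trace (\<rho> g) * mat_trace (\<sigma> (inv\<^bsub>G\<^esub> g))) =
      (\<Sum>g\<in>carrier G. \<Sum>a<n. \<Sum>b<m. \<rho> g $$ (a, a) * \<sigma> (inv\<^bsub>G\<^esub> g) $$ (b, b))"
    by (intro sum.cong refl) (simp add: mat_trace_carrier[OF r(1)] mat_trace_carrier[OF s(1)] sum_product)
  also have "\<dots> = (\<Sum>a<n. \<Sum>g\<in>carrier G. \<Sum>b<m. \<rho> g $$ (a, a) * \<sigma> (inv\<^bsub>G\<^esub> g) $$ (b, b))"
    by (rule sum.swap)
  also have "\<dots> = (\<Sum>a<n. \<Sum>b<m. \<Sum>g\<in>carrier G. \<rho> g $$ (a, a) * \<sigma> (inv\<^bsub>G\<^esub> g) $$ (b, b))"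
    by (intro sum.cong refl sum.swap)
  finally show ?thesis .
qed

text \<open>If some averaged matrix unit is nonzero, it is an isomorphism and the characters agree; otherwise all
products of matrix coefficients sum to 0. For equal characters a single representation \<open>\<rho>\<close> can be used
for both, each averaged matrix unit is a scalar, and its trace shows that the scalar is \<open>|G|/n\<close> for a
diagonal matrix unit.\<close>

lemma irreducible_character_orthogonality:
  assumes G: "group G" and fin: "finite (carrier G)"
    and \<phi>: "irreducible_character G \<phi>" and \<psi>: "irreducible_character G \<psi>"
  shows "(\<Sum>g\<in>carrier G. \<phi> g * cnj (\<psi> g)) =
    (if \<forall>g\<in>carrier G. \<phi> g = \<psi> g then of_nat (order G) else 0)"
proof -
  interpret G: group G by fact
  obtain n \<rho> where \<rho>: "irreducible_rep G n \<rho>" "\<And>g. g \<in> carrier G \<Longrightarrow> \<phi> g = mat_trace (\<rho> g)"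
    using \<phi> unfolding irreducible_character_def by blast
  obtain m \<sigma> where \<sigma>: "irreducible_rep G m \<sigma>" "\<And>g. g \<in> carrier G \<Longrightarrow> \<psi> g = mat_trace (\<sigma> g)"
    using \<psi> unfolding irreducible_character_def by blast
  have r: "mat_rep G n \<rho>" "n > 0" and s: "mat_rep G m \<sigma>" "m > 0"
    using \<rho> \<sigma> irreducible_rep_iff[OF G] by auto
  have inv: "cnj (\<psi> g) = \<psi> (inv\<^bsub>G\<^esub> g)" if "g \<in> carrier G" for g
    using irreducible_character_inv[OF G fin \<psi> that] by simp
  show ?thesis
  proof (cases "\<forall>g\<in>carrier G. \<phi> g = \<psi> g")
    case False
    have "(\<Sum>g\<in>carrier G. \<rho> g $$ (a, i) * \<sigma> (inv\<^bsub>G\<^esub> g) $$ (j, b)) = 0"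
      if "a < n" "i < n" "j < m" "b < m" for a i j b
    proof -
      define T where "T = mat n m (\<lambda>(a, b). \<Sum>g\<in>carrier G. \<rho> g $$ (a, i) * \<sigma> (inv\<^bsub>G\<^esub> g) $$ (j, b))"
      have T: "T \<in> carrier_mat n m" by (simp add: T_def)
      have comm: "\<rho> h * T = T * \<sigma> h" if "h \<in> carrier G" for h
        unfolding T_def by (rule averaged_intertwiner[OF G r(1) s(1) \<open>i < n\<close> \<open>j < m\<close> that])
      have "T = 0\<^sub>m n m"
      proof (rule ccontr)
        assume "T \<noteq> 0\<^sub>m n m"
        from Schur_invertible[OF G \<rho>(1) \<sigma>(1) T comm this]
        obtain R where R: "R \<in> carrier_mat m n" "T * R = 1\<^sub>m n" "R * T = 1\<^sub>m m" by blast
        have "\<phi> g = \<psi> g" if g: "g \<in> carrier G" for g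
          using isomorphic_trace_eq[OF T R(1,2) mat_repD(1)[OF r(1) g] mat_repD(1)[OF s(1) g] comm[OF g] R(3)]
            \<rho>(2)[OF g] \<sigma>(2)[OF g] by simp
        then show False using False by blast
      qed
      then have "T $$ (a, b) = 0" using that by simp
      then show ?thesis using that by (simp add: T_def)
    qed
    then have "(\<Sum>g\<in>carrier G. mat_trace (\<rho> g) * mat_trace (\<sigma> (inv\<^bsub>G\<^esub> g))) = 0"
      unfolding sum_trace_product[OF G r(1) s(1)]  by (intro sum.neutral[of "{..<n}"] sum.neutral[of "{..<m}"] ballI) simp
    then have "(\<Sum>g\<in>carrier G. \<phi> g * cnj (\<psi> g)) = 0" using \<rho>(2) \<sigma>(2) inv by simp
    then show ?thesis unfolding if_not_P[OF False] .
  next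
    case True
    define c where "c i j = (\<Sum>g\<in>carrier G. \<rho> g $$ (0, i) * \<rho> (inv\<^bsub>G\<^esub> g) $$ (j, 0))" for i j
    note rr = mat_repD[OF r(1)]
    \<comment> \<open>The scalar of the averaged matrix unit \<open>(i, j)\<close> can be read off at position \<open>(0, 0)\<close>.\<close>
    have scalar: "(\<Sum>g\<in>carrier G. \<rho> g $$ (a, i) * \<rho> (inv\<^bsub>G\<^esub> g) $$ (j, b)) = (if a = b then c i j else 0)"
      if "a < n" "i < n" "j < n" "b < n" for a i j b
    proof -
      define T where "T = mat n n (\<lambda>(a, b). \<Sum>g\<in>carrier G. \<rho> g $$ (a, i) * \<rho> (inv\<^bsub>G\<^esub> g) $$ (j, b))"
      have T: "T \<in> carrier_mat n n" by (simp add: T_def)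
      have comm: "\<rho> h * T = T * \<rho> h" if "h \<in> carrier G" for h
        unfolding T_def by (rule averaged_intertwiner[OF G r(1) r(1) \<open>i < n\<close> \<open>j < n\<close> that])
      obtain d where d: "T = d \<cdot>\<^sub>m 1\<^sub>m n" using Schur_scalar[OF G \<rho>(1) T comm] by blast
      have "T $$ (0, 0) = d" using d r(2) by simp
      then have "d = c i j" using r(2) by (simp add: T_def c_def)
      moreover have "T $$ (a, b) = (if a = b then d else 0)" using d that by simp
      ultimately show ?thesis using that by (simp add: T_def)
    qed
    have c: "of_nat n * c i i = of_nat (order G)" if i: "i < n" for i
    proof -
      have "of_nat n * c i i = (\<Sum>a<n. \<Sum>g\<in>carrier G. \<rho> g $$ (a, i) * \<rho> (inv\<^bsub>G\<^esub> g) $$ (i, a))"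
        using scalar i by simp
      also have "\<dots> = (\<Sum>g\<in>carrier G. \<Sum>a<n. \<rho> (inv\<^bsub>G\<^esub> g) $$ (i, a) * \<rho> g $$ (a, i))"
        by (subst sum.swap) (simp add: mult.commute)
      also have "\<dots> = (\<Sum>g\<in>carrier G. (\<rho> (inv\<^bsub>G\<^esub> g) * \<rho> g) $$ (i, i))"
        by (intro sum.cong refl) (simp add: mat_mult_entry[OF rr(1) rr(1)] i)
      also have "\<dots> = (\<Sum>g\<in>carrier G. 1)"
        by (intro sum.cong refl) (simp add: rr(3)[symmetric] rr(2) i)
      finally show ?thesis by (simp add: Coset.order_def)
    qed
    have "(\<Sum>g\<in>carrier G. \<phi> g * cnj (\<psi> g)) =
        (\<Sum>g\<in>carrier G. mat_trace (\<rho> g) * mat_trace (\<rho> (inv\<^bsub>G\<^esub> g)))"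
      using True \<rho>(2) inv by (intro sum.cong refl) (metis G.inv_closed)
    also have "\<dots> = (\<Sum>a<n. \<Sum>b<n. if a = b then c a b else 0)"
      unfolding sum_trace_product[OF G r(1) r(1)] using scalar by (intro sum.cong refl) auto
    also have "\<dots> = (\<Sum>a<n. c a a)" by simp
    also have "\<dots> = (\<Sum>a<n. of_nat (order G) / of_nat n)"
      using c r(2) by (intro sum.cong refl) (auto simp: field_simps)
    also have "\<dots> = of_nat (order G)" using r(2) by simp
    finally show ?thesis using True by simp
  qed
qed

lemma irreducible_character_conj:
  assumes G: "group G" and \<chi>: "irreducible_character G \<chi>" and gh: "g \<in> carrier G" "h \<in> carrier G"
  shows "\<chi> (h \<otimes>\<^bsub>G\<^esub> g \<otimes>\<^bsub>G\<^esub> inv\<^bsub>G\<^esub> h) = \<chi> g"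
proof -
  interpret G: group G by fact
  obtain n \<rho> where \<rho>: "irreducible_rep G n \<rho>" "\<And>g. g \<in> carrier G \<Longrightarrow> \<chi> g = mat_trace (\<rho> g)"
    using \<chi> unfolding irreducible_character_def by blast
  have r: "mat_rep G n \<rho>" using \<rho> irreducible_rep_iff[OF G] by auto
  note rr = mat_repD[OF r]
  have "\<chi> (h \<otimes>\<^bsub>G\<^esub> g \<otimes>\<^bsub>G\<^esub> inv\<^bsub>G\<^esub> h) = mat_trace (\<rho> (h \<otimes>\<^bsub>G\<^esub> g) * \<rho> (inv\<^bsub>G\<^esub> h))"
    using \<rho>(2) rr(3) gh by simp
  also have "\<dots> = mat_trace (\<rho> (inv\<^bsub>G\<^esub> h) * \<rho> (h \<otimes>\<^bsub>G\<^esub> g))"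
    using rr(1) gh by (intro mat_trace_mult_comm[of _ n n]) auto
  also have "\<rho> (inv\<^bsub>G\<^esub> h) * \<rho> (h \<otimes>\<^bsub>G\<^esub> g) = \<rho> g"
    using gh by (simp add: rr(3)[symmetric] G.m_assoc[symmetric])
  finally show ?thesis using \<rho>(2) gh by simp
qed

lemma smult_mat_mult_vec:
  fixes A :: "complex mat"
  assumes "A \<in> carrier_mat n m" "w \<in> carrier_vec m"
  shows "(c \<cdot>\<^sub>m A) *\<^sub>v w = c \<cdot>\<^sub>v (A *\<^sub>v w)"
  using assms by (intro eq_vecI) (auto simp: scalar_prod_def sum_distrib_left mult_ac)

text \<open>A linear character scales the matrices by nonzero numbers, so the invariant subspaces are unchanged.\<close>

lemma irreducible_character_twist:
  assumes G: "group G" and \<chi>: "irreducible_character G \<chi>"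
    and \<theta>: "\<theta> \<one>\<^bsub>G\<^esub> = 1" "\<And>g h. g \<in> carrier G \<Longrightarrow> h \<in> carrier G \<Longrightarrow> \<theta> (g \<otimes>\<^bsub>G\<^esub> h) = \<theta> g * \<theta> h"
  shows "irreducible_character G (\<lambda>g. \<theta> g * \<chi> g)"
proof -
  interpret G: group G by fact
  obtain n \<rho> where \<rho>: "irreducible_rep G n \<rho>" "\<And>g. g \<in> carrier G \<Longrightarrow> \<chi> g = mat_trace (\<rho> g)"
    using \<chi> unfolding irreducible_character_def by blast
  have r: "mat_rep G n \<rho>" "n > 0" and
    irr: "\<And>W. invariant_subspace G n \<rho> W \<Longrightarrow> W = {0\<^sub>v n} \<or> W = carrier_vec n"
    using \<rho>(1) unfolding irreducible_rep_iff[OF G] by blast+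
  note rr = mat_repD[OF r(1)]
  define \<sigma> where "\<sigma> g = \<theta> g \<cdot>\<^sub>m \<rho> g" for g
  have nz: "\<theta> g \<noteq> 0" if "g \<in> carrier G" for g
    using \<theta>(2)[of g "inv\<^bsub>G\<^esub> g"] that \<theta>(1) by auto
  have "mat_rep G n \<sigma>" unfolding mat_rep_def
  proof (intro conjI ballI)
    fix g h assume gh: "g \<in> carrier G" "h \<in> carrier G"
    show "\<sigma> (g \<otimes>\<^bsub>G\<^esub> h) = \<sigma> g * \<sigma> h"
      unfolding \<sigma>_def \<theta>(2)[OF gh] rr(3)[OF gh] using rr(1)[OF gh(1)] rr(1)[OF gh(2)]
      by (auto intro!: eq_matI simp: mult_smult_distrib[of _ n n _ n] mult_smult_assoc_mat[of _ n n _ n])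
  qed (use rr \<theta> in \<open>auto simp: \<sigma>_def intro!: eq_matI\<close>)
  moreover have "W = {0\<^sub>v n} \<or> W = carrier_vec n" if W: "invariant_subspace G n \<sigma> W" for W
  proof (rule irr)
    have "\<rho> g *\<^sub>v w \<in> W" if g: "g \<in> carrier G" and w: "w \<in> W" for g w
    proof -
      have wc: "w \<in> carrier_vec n" using W w by (auto simp: invariant_subspace_def)
      have "\<sigma> g *\<^sub>v w \<in> W" using W g w by (auto simp: invariant_subspace_def)
      then have "inverse (\<theta> g) \<cdot>\<^sub>v (\<sigma> g *\<^sub>v w) \<in> W" using W by (auto simp: invariant_subspace_def)
      moreover have "inverse (\<theta> g) \<cdot>\<^sub>v (\<sigma> g *\<^sub>v w) = \<rho> g *\<^sub>v w"
        unfolding \<sigma>_def using rr(1)[OF g] wc nz[OF g]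
        by (simp add: smult_mat_mult_vec[of _ n n] smult_smult_assoc)
      ultimately show ?thesis by simp
    qed
    then show "invariant_subspace G n \<rho> W" using W by (auto simp: invariant_subspace_def)
  qed
  ultimately have "irreducible_rep G n \<sigma>" using irreducible_rep_iff[OF G] r(2) by blast
  moreover have "\<theta> g * \<chi> g = mat_trace (\<sigma> g)" if "g \<in> carrier G" for g
    using \<rho>(2)[OF that] rr(1)[OF that] by (simp add: \<sigma>_def mat_trace_smult)
  ultimately show ?thesis unfolding irreducible_character_def by blast
qed

text \<open>Every element of \<open>G\<close> acts as a scalar multiple of an element of \<open>C\<close>, so \<open>C\<close> has no more invariant
subspaces than \<open>G\<close>.\<close>

lemma irreducible_character_central_product:
  assumes G: "group G" and \<chi>: "irreducible_character G \<chi>" and x: "x \<in> carrier G"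
    and central: "\<And>h. h \<in> carrier G \<Longrightarrow> x \<otimes>\<^bsub>G\<^esub> h = h \<otimes>\<^bsub>G\<^esub> x"
    and C: "subgroup C G" and gen: "\<And>g. g \<in> carrier G \<Longrightarrow> \<exists>j::nat. \<exists>c\<in>C. g = x [^]\<^bsub>G\<^esub> j \<otimes>\<^bsub>G\<^esub> c"
  obtains \<mu> where "irreducible_character (G\<lparr>carrier := C\<rparr>) \<chi>"
    "\<And>m::nat. x [^]\<^bsub>G\<^esub> m = \<one>\<^bsub>G\<^esub> \<Longrightarrow> \<mu> ^ m = 1"
    "\<And>(j::nat) c. c \<in> C \<Longrightarrow> \<chi> (x [^]\<^bsub>G\<^esub> j \<otimes>\<^bsub>G\<^esub> c) = \<mu> ^ j * \<chi> c"
proof -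
  interpret G: group G by fact
  obtain n \<rho> where \<rho>: "irreducible_rep G n \<rho>" "\<And>g. g \<in> carrier G \<Longrightarrow> \<chi> g = mat_trace (\<rho> g)"
    using \<chi> unfolding irreducible_character_def by blast
  have r: "mat_rep G n \<rho>" "n > 0" and
    irr: "\<And>W. invariant_subspace G n \<rho> W \<Longrightarrow> W = {0\<^sub>v n} \<or> W = carrier_vec n"
    using \<rho>(1) unfolding irreducible_rep_iff[OF G] by blast+
  note rr = mat_repD[OF r(1)]
  obtain \<mu> where \<mu>: "\<And>j :: nat. \<rho> (x [^]\<^bsub>G\<^esub> j) = \<mu> ^ j \<cdot>\<^sub>m 1\<^sub>m n"
    "\<And>m :: nat. x [^]\<^bsub>G\<^esub> m = \<one>\<^bsub>G\<^esub> \<Longrightarrow> \<mu> ^ m = 1"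
    using central_element_scalar[OF G \<rho>(1) x central] by blast
  have Cc: "c \<in> carrier G" if "c \<in> C" for c using that subgroup.subset[OF C] by blast
  have xc: "\<rho> (x [^]\<^bsub>G\<^esub> j \<otimes>\<^bsub>G\<^esub> c) = \<mu> ^ j \<cdot>\<^sub>m \<rho> c" if "c \<in> C" for j :: nat and c
    using rr(3)[of "x [^]\<^bsub>G\<^esub> j" c] rr(1)[OF Cc[OF that]] x Cc[OF that] \<mu>(1)
    by (simp add: mult_smult_assoc_mat[of _ n n _ n])
  have irrC: "W = {0\<^sub>v n} \<or> W = carrier_vec n" if W: "invariant_subspace (G\<lparr>carrier := C\<rparr>) n \<rho> W" for W
  proof (rule irr)
    have "\<rho> g *\<^sub>v w \<in> W" if g: "g \<in> carrier G" and w: "w \<in> W" for g w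
    proof -
      obtain j :: nat and c where c: "c \<in> C" "g = x [^]\<^bsub>G\<^esub> j \<otimes>\<^bsub>G\<^esub> c" using gen[OF g] by blast
      have wc: "w \<in> carrier_vec n" using W w by (auto simp: invariant_subspace_def)
      have "\<rho> g *\<^sub>v w = \<mu> ^ j \<cdot>\<^sub>v (\<rho> c *\<^sub>v w)"
        unfolding c(2) xc[OF c(1)] by (rule smult_mat_mult_vec[OF rr(1)[OF Cc[OF c(1)]] wc])
      then show ?thesis using W w c(1) by (auto simp: invariant_subspace_def)
    qed
    then show "invariant_subspace G n \<rho> W" using W by (auto simp: invariant_subspace_def)
  qed
  have "irreducible_rep (G\<lparr>carrier := C\<rparr>) n \<rho>"
    using irreducible_rep_iff[OF subgroup.subgroup_is_group[OF C G]] mat_rep_restrict[OF r(1) C] r(2) irrC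
    by blast
  then have "irreducible_character (G\<lparr>carrier := C\<rparr>) \<chi>"
    unfolding irreducible_character_def using \<rho>(2) Cc by auto
  moreover have "\<chi> (x [^]\<^bsub>G\<^esub> j \<otimes>\<^bsub>G\<^esub> c) = \<mu> ^ j * \<chi> c" if "c \<in> C" for j :: nat and c
    using \<rho>(2) xc[OF that] x Cc[OF that] rr(1)[OF Cc[OF that]] by (simp add: mat_trace_smult[of _ n])
  ultimately show ?thesis using that \<mu>(2) by blast
qed

section \<open>Normal subgroups with a coprime quotient of prime power exponent\<close>

lemma (in group) finite_mult_closed_subgroup:
  assumes "finite (carrier G)" "H \<subseteq> carrier G" "\<one> \<in> H"
    and closed: "\<And>a b. a \<in> H \<Longrightarrow> b \<in> H \<Longrightarrow> a \<otimes> b \<in> H"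
  shows "subgroup H G"
proof (rule subgroupI)
  fix a assume a: "a \<in> H"
  have "a [^] (k::nat) \<in> H" for k by (induction k) (use a assms in auto)
  then show "inv a \<in> H" using inv_eq_pow assms a by auto
qed (use assms in auto)

text \<open>Applied with the normal subgroup itself and with a centralizer in it.\<close>

lemma (in group) normalized_cyclic_product_subgroup:
  assumes fin: "finite (carrier G)" and K: "subgroup K G" and x: "x \<in> carrier G"
    and norm: "\<And>k. k \<in> K \<Longrightarrow> inv x \<otimes> k \<otimes> x \<in> K"
  shows "subgroup {x [^] j \<otimes> k | (j::nat) k. k \<in> K} G"
proof (rule finite_mult_closed_subgroup[OF fin])
  have Kc: "k \<in> carrier G" if "k \<in> K" for k using that subgroup.subset[OF K] by blast
  show "{x [^] j \<otimes> k | (j::nat) k. k \<in> K} \<subseteq> carrier G" using x Kc by auto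
  have "\<one> = x [^] (0::nat) \<otimes> \<one>" using x by simp
  then show "\<one> \<in> {x [^] j \<otimes> k | (j::nat) k. k \<in> K}" using subgroup.one_closed[OF K] by blast
  have np: "\<exists>k'\<in>K. k \<otimes> x [^] j = x [^] j \<otimes> k'" if "k \<in> K" for k and j :: nat
    using that
  proof (induction j arbitrary: k)
    case 0
    then show ?case using Kc by auto
  next
    case (Suc j)
    obtain k' where k': "k' \<in> K" "k \<otimes> x [^] j = x [^] j \<otimes> k'" using Suc by blast
    have "k \<otimes> x [^] Suc j = (k \<otimes> x [^] j) \<otimes> x" using x Kc Suc.prems by (simp add: m_assoc)
    also have "\<dots> = x [^] j \<otimes> (x \<otimes> (inv x \<otimes> k' \<otimes> x))"
      unfolding k'(2) using x Kc[OF k'(1)] by (simp add: m_assoc[symmetric])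
    also have "\<dots> = x [^] Suc j \<otimes> (inv x \<otimes> k' \<otimes> x)" using x Kc[OF k'(1)] by (simp add: m_assoc)
    finally show ?case using norm[OF k'(1)] by blast
  qed
  fix a b assume "a \<in> {x [^] j \<otimes> k | (j::nat) k. k \<in> K}" "b \<in> {x [^] j \<otimes> k | (j::nat) k. k \<in> K}"
  then obtain i j :: nat and k l where *: "k \<in> K" "l \<in> K" "a = x [^] i \<otimes> k" "b = x [^] j \<otimes> l" by blast
  obtain k' where k': "k' \<in> K" "k \<otimes> x [^] j = x [^] j \<otimes> k'" using np[OF *(1)] by blast
  have "a \<otimes> b = x [^] i \<otimes> (k \<otimes> x [^] j) \<otimes> l" using * Kc x by (simp add: m_assoc)
  also have "\<dots> = x [^] (i + j) \<otimes> (k' \<otimes> l)"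
    unfolding k'(2) using * Kc x k'(1) by (simp add: m_assoc nat_pow_mult[symmetric])
  finally show "a \<otimes> b \<in> {x [^] j \<otimes> k | (j::nat) k. k \<in> K}"
    using subgroup.m_closed[OF K k'(1) *(2)] by blast
qed

definition zero_or_root :: "complex \<Rightarrow> bool" where
  "zero_or_root z \<longleftrightarrow> z = 0 \<or> root_of_unity z"

lemma zero_or_root_mult:
  assumes "root_of_unity w" "zero_or_root z"
  shows "zero_or_root (w * z)"
proof (cases "z = 0")
  case False
  then obtain m n where "m > 0" "w ^ m = 1" "n > 0" "z ^ n = 1"
    using assms by (auto simp: zero_or_root_def root_of_unity_def)
  moreover have "(w * z) ^ (m * n) = (w ^ m) ^ n * (z ^ n) ^ m"
    by (simp add: power_mult_distrib mult.commute flip: power_mult)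
  ultimately show ?thesis
    unfolding zero_or_root_def root_of_unity_def by (intro disjI2 exI[of _ "m * n"]) auto
qed (simp add: zero_or_root_def)

text \<open>The setting of one step up the tower. The quotient enters only through its exponent, \<open>powN\<close>: unlike
a formula for the group order, this condition visibly passes to a subgroup \<open>K\<close> with
\<open>N \<inter> K\<close> in place of \<open>N\<close>.\<close>

locale coprime_extension = group G for G (structure) +
  fixes N :: "'a set" and q a :: nat and \<chi> :: "'a \<Rightarrow> complex"
  assumes fin: "finite (carrier G)"
    and N: "N \<lhd> G"
    and q: "prime q"
    and powN: "g \<in> carrier G \<Longrightarrow> g [^] (q ^ a) \<in> N"
    and cop: "coprime q (card N)"
    and \<chi>: "irreducible_character G \<chi>"
begin

text \<open>\<open>M\<close> kills the quotient. Working modulo \<open>Q = qM\<close> instead keeps \<open>U\<close> the set of units modulo a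
nontrivial power of \<open>q\<close> even if the quotient is trivial.\<close>

definition M where "M = q ^ a"
definition Q where "Q = q * M"
definition U where "U = units_below q M"

lemma q2: "q \<ge> 2" and M0: "M > 0" and Q0: "Q > 0" and q_dvd_Q: "q dvd Q"
  using prime_ge_2_nat[OF q] by (auto simp: M_def Q_def)

lemma Q_power: "Q = q ^ Suc a" by (simp add: Q_def M_def)

lemma subN: "subgroup N G" using N normal_imp_subgroup by blast
lemma Nc: "n \<in> N \<Longrightarrow> n \<in> carrier G" using subgroup.subset[OF subN] by blast
lemma finN: "finite N" by (rule finite_subset[OF subgroup.subset[OF subN] fin])
lemma cardN0: "card N > 0" using finN subgroup.one_closed[OF subN] by (auto simp: card_gt_0_iff)

lemma N_conj: "n \<in> N \<Longrightarrow> g \<in> carrier G \<Longrightarrow> g \<otimes> n \<otimes> inv g \<in> N" "n \<in> N \<Longrightarrow> g \<in> carrier G \<Longrightarrow> inv g \<otimes> n \<otimes> g \<in> N"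
  using normal.inv_op_closed1[OF N] normal.inv_op_closed2[OF N] by auto

lemma coprime_Q_N: "coprime Q (card N)"
  unfolding Q_power using cop by simp

lemma pow_card_N: "n \<in> N \<Longrightarrow> n [^] (card N) = \<one>"
proof -
  assume n: "n \<in> N"
  interpret S: group "G\<lparr>carrier := N\<rparr>" by (rule subgroup.subgroup_is_group[OF subN is_group])
  have "n [^]\<^bsub>G\<lparr>carrier := N\<rparr>\<^esub> order (G\<lparr>carrier := N\<rparr>) = \<one>" using S.pow_order_eq_1 n by simp
  then show ?thesis by (simp add: Coset.order_def nat_pow_consistent[symmetric])
qed

lemma pow_Q_N: "g \<in> carrier G \<Longrightarrow> g [^] Q \<in> N"
proof -
  assume g: "g \<in> carrier G"
  have "g [^] Q = (g [^] q) [^] M" using g by (simp add: Q_def nat_pow_pow)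
  then show ?thesis using powN[of "g [^] q"] g by (simp add: M_def)
qed

lemma pow_in_N: "n \<in> N \<Longrightarrow> n [^] (j::nat) \<in> N"
  by (induction j) (use subgroup.one_closed[OF subN] subgroup.m_closed[OF subN] in auto)

lemma pow_QN: "g \<in> carrier G \<Longrightarrow> g [^] (Q * card N) = \<one>"
  using pow_card_N[OF pow_Q_N, of g] by (simp add: nat_pow_pow)

lemma pow_cong_QN:
  assumes "g \<in> carrier G" "[i = j] (mod Q * card N)"
  shows "g [^] (i::nat) = g [^] (j::nat)"
proof -
  have *: "g [^] i = g [^] (i mod (Q * card N))" for i :: nat
  proof -
    have "g [^] i = g [^] (Q * card N * (i div (Q * card N)) + i mod (Q * card N))" by simp
    also have "\<dots> = (g [^] (Q * card N)) [^] (i div (Q * card N)) \<otimes> g [^] (i mod (Q * card N))"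
      using assms(1) by (simp only: nat_pow_mult[symmetric] nat_pow_pow)
    finally show ?thesis using pow_QN[OF assms(1)] assms(1) by simp
  qed
  show ?thesis using *[of i] *[of j] assms(2) by (simp add: cong_def)
qed

text \<open>Raising to the power \<open>e\<close> extracts the \<open>q\<close>-part of an element.\<close>

definition e where "e = (SOME e. [e = 1] (mod Q) \<and> [e = 0] (mod card N))"

lemma e: "[e = 1] (mod Q)" "[e = 0] (mod card N)"
  using someI_ex[OF binary_chinese_remainder_nat[OF coprime_Q_N, of 1 0]] by (auto simp: e_def)

lemma pow_e_N: "n \<in> N \<Longrightarrow> n [^] e = \<one>"
proof -
  assume n: "n \<in> N"
  obtain t where "e = card N * t" using e(2) by (auto simp: cong_0_iff)
  then show ?thesis using pow_card_N[OF n] Nc[OF n] by (simp add: nat_pow_pow[symmetric])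
qed

definition q_elements where "q_elements = {x \<in> carrier G. x [^] Q = \<one>}"

lemma q_element_pow_cong:
  assumes x: "x \<in> q_elements" and c: "[i = j] (mod Q)"
  shows "x [^] (i::nat) = x [^] (j::nat)"
proof -
  have xc: "x \<in> carrier G" using x by (simp add: q_elements_def)
  have "x [^] i = x [^] (i mod Q)" for i :: nat
  proof -
    have "x [^] i = x [^] (Q * (i div Q) + i mod Q)" by simp
    also have "\<dots> = (x [^] Q) [^] (i div Q) \<otimes> x [^] (i mod Q)"
      using xc by (simp only: nat_pow_mult[symmetric] nat_pow_pow)
    finally show ?thesis using x by (simp add: q_elements_def)
  qed
  from this[of i] this[of j] c show ?thesis by (simp add: cong_def)
qed

lemma pow_e_Q:
  assumes "x \<in> q_elements"
  shows "x [^] e = x"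
  using q_element_pow_cong[OF assms, of e 1] e(1) assms by (simp add: q_elements_def)

lemma pow_e_q_element: "g \<in> carrier G \<Longrightarrow> g [^] e \<in> q_elements"
proof -
  assume g: "g \<in> carrier G"
  have "[e * Q = 0] (mod Q * card N)" using e(2) by (auto simp: cong_0_iff)
  then have "g [^] (e * Q) = g [^] (0::nat)" by (rule pow_cong_QN[OF g])
  then show ?thesis using g by (simp add: q_elements_def nat_pow_pow)
qed

text \<open>The coset of \<open>g ^ i\<close> depends only on \<open>i\<close> modulo \<open>Q\<close>, since \<open>g ^ Q\<close> lies in \<open>N\<close>.\<close>

lemma pow_cong_coset:
  assumes g: "g \<in> carrier G" and c: "[i = j] (mod Q)"
  shows "\<exists>n\<in>N. g [^] (i::nat) = g [^] (j::nat) \<otimes> n"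
proof -
  have up: "\<exists>n\<in>N. g [^] (k + Q * s) = g [^] k \<otimes> n" for k s :: nat
    using pow_in_N[OF pow_Q_N[OF g], of s] g by (metis nat_pow_mult nat_pow_pow)
  have dn: "\<exists>n\<in>N. g [^] k = g [^] (k + Q * s) \<otimes> n" for k s :: nat
  proof -
    obtain n where n: "n \<in> N" "g [^] (k + Q * s) = g [^] k \<otimes> n" using up by blast
    then have "g [^] k = g [^] (k + Q * s) \<otimes> inv n" using g Nc[OF n(1)] by (simp add: m_assoc)
    then show ?thesis using subgroup.m_inv_closed[OF subN n(1)] by blast
  qed
  show ?thesis
  proof (cases "i \<le> j")
    case True
    then obtain s where "j = i + Q * s" using c by (metis cong_le_nat cong_sym mult.commute add.commute)
    then show ?thesis using dn by blast
  next
    case False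
    then obtain s where "i = j + Q * s" using c by (metis cong_le_nat nat_le_linear mult.commute add.commute)
    then show ?thesis using up by blast
  qed
qed

text \<open>The mean of \<open>|\<chi>|\<^sup>2\<close> over the coset \<open>gN\<close>; equivalently, the character of \<open>G/N\<close> on the
\<open>N\<close>-endomorphisms of the module of \<open>\<chi>\<close>.\<close>

definition coset_norm where "coset_norm g = (\<Sum>n\<in>N. (norm (\<chi> (g \<otimes> n)))\<^sup>2) / real (card N)"

lemma sum_translate_N:
  assumes "n\<^sub>0 \<in> N" "g \<in> carrier G"
  shows "(\<Sum>n\<in>N. f (g \<otimes> n\<^sub>0 \<otimes> n)) = (\<Sum>n\<in>N. f (g \<otimes> n))"
proof -
  interpret S: group "G\<lparr>carrier := N\<rparr>" by (rule subgroup.subgroup_is_group[OF subN is_group])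
  have "(\<Sum>n\<in>N. f (g \<otimes> (n\<^sub>0 \<otimes> n))) = (\<Sum>n\<in>N. f (g \<otimes> n))"
    using sum_group_translate[OF S.is_group, of n\<^sub>0 "\<lambda>n. f (g \<otimes> n)"] assms by simp
  then show ?thesis using assms Nc by (simp add: m_assoc cong: sum.cong)
qed

lemma coset_norm_coset: "n\<^sub>0 \<in> N \<Longrightarrow> g \<in> carrier G \<Longrightarrow> coset_norm (g \<otimes> n\<^sub>0) = coset_norm g"
  unfolding coset_norm_def using sum_translate_N[of n\<^sub>0 g "\<lambda>z. (norm (\<chi> z))\<^sup>2"] by simp

lemma coset_norm_cong: "g \<in> carrier G \<Longrightarrow> [i = j] (mod Q) \<Longrightarrow> coset_norm (g [^] (i::nat)) = coset_norm (g [^] (j::nat))"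
  using pow_cong_coset coset_norm_coset by (metis nat_pow_closed)

lemma coset_norm_nonneg: "coset_norm g \<ge> 0"
  unfolding coset_norm_def by (intro divide_nonneg_nonneg sum_nonneg) auto

lemma coprime_units: "j \<in> U \<Longrightarrow> coprime j Q"
proof -
  assume "j \<in> U"
  then have "coprime q j" using q by (simp add: U_def units_below_def prime_imp_coprime)
  then show ?thesis unfolding Q_power by (simp add: coprime_commute)
qed

lemma one_U: "1 \<in> U"
  using q2 M0 by (auto simp: U_def units_below_def intro: less_le_trans[of _ q])

lemma sum_translate_right:
  assumes "h \<in> carrier G"
  shows "(\<Sum>g\<in>carrier G. f (g \<otimes> h)) = (\<Sum>g\<in>carrier G. f g)"
proof -
  have "bij_betw (\<lambda>g. g \<otimes> h) (carrier G) (carrier G)"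
    using assms by (intro bij_betw_byWitness[of _ "\<lambda>g. g \<otimes> inv h"]) (auto simp: m_assoc)
  then show ?thesis by (rule sum.reindex_bij_betw)
qed

lemma sum_coset_average:
  fixes f :: "'a \<Rightarrow> real"
  shows "(\<Sum>g\<in>carrier G. \<Sum>n\<in>N. f (g \<otimes> n)) = real (card N) * (\<Sum>g\<in>carrier G. f g)"
proof -
  have "(\<Sum>g\<in>carrier G. \<Sum>n\<in>N. f (g \<otimes> n)) = (\<Sum>n\<in>N. \<Sum>g\<in>carrier G. f (g \<otimes> n))" by (rule sum.swap)
  also have "\<dots> = (\<Sum>n\<in>N. \<Sum>g\<in>carrier G. f g)" by (intro sum.cong refl sum_translate_right Nc)
  finally show ?thesis by simp
qed

lemma sum_coset_norm: "(\<Sum>g\<in>carrier G. coset_norm g) = real (order G)"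
proof -
  have "complex_of_real (\<Sum>g\<in>carrier G. (norm (\<chi> g))\<^sup>2) = (\<Sum>g\<in>carrier G. \<chi> g * cnj (\<chi> g))"
    by (simp only: of_real_sum complex_norm_square)
  also have "\<dots> = complex_of_real (real (order G))"
    using irreducible_character_orthogonality[OF is_group fin \<chi> \<chi>] by simp
  finally have n: "(\<Sum>g\<in>carrier G. (norm (\<chi> g))\<^sup>2) = real (order G)" by (simp only: of_real_eq_iff)
  show ?thesis
    using sum_coset_average[of "\<lambda>z. (norm (\<chi> z))\<^sup>2"] n cardN0
    unfolding coset_norm_def sum_divide_distrib[symmetric] by simp
qed

text \<open>Modulo \<open>N\<close>, raising to the power \<open>j\<close> agrees with raising to a power \<open>k\<close> that is coprime to the
exponent of \<open>G\<close>, and the latter permutes \<open>G\<close>.\<close>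

lemma sum_coset_norm_pow:
  assumes j: "j \<in> U"
  shows "(\<Sum>g\<in>carrier G. coset_norm (g [^] j)) = real (order G)"
proof -
  obtain k where k: "[k = j] (mod Q)" "[k = 1] (mod card N)"
    using binary_chinese_remainder_nat[OF coprime_Q_N] by blast
  have "coprime k Q" using coprime_units[OF j] k(1) by (metis cong_imp_coprime cong_sym)
  moreover have "coprime k (card N)" using k(2) by (metis cong_imp_coprime cong_sym coprime_1_left)
  ultimately have "coprime k (Q * card N)" by simp
  then obtain u where u: "[k * u = Suc 0] (mod Q * card N)" using cong_solve_coprime_nat by blast
  have inj: "inj_on (\<lambda>g. g [^] k) (carrier G)"
  proof (rule inj_on_inverseI[of _ "\<lambda>g. g [^] u"])
    fix g assume g: "g \<in> carrier G"
    show "(g [^] k) [^] u = g" using pow_cong_QN[OF g u] g by (simp add: nat_pow_pow)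
  qed
  have "(\<lambda>g. g [^] k) ` carrier G = carrier G"
    using endo_inj_surj[OF fin _ inj] by auto
  then have bij: "bij_betw (\<lambda>g. g [^] k) (carrier G) (carrier G)" using inj by (simp add: bij_betw_def)
  have "(\<Sum>g\<in>carrier G. coset_norm (g [^] j)) = (\<Sum>g\<in>carrier G. coset_norm (g [^] k))"
    by (intro sum.cong refl coset_norm_cong) (use k cong_sym in auto)
  also have "\<dots> = (\<Sum>g\<in>carrier G. coset_norm g)" by (rule sum.reindex_bij_betw[OF bij])
  finally show ?thesis using sum_coset_norm by simp
qed

definition cent where "cent x = {n \<in> N. x \<otimes> n = n \<otimes> x}"

lemma cent_subgroup: "x \<in> carrier G \<Longrightarrow> subgroup (cent x) G"
proof (rule finite_mult_closed_subgroup[OF fin])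
  assume x: "x \<in> carrier G"
  show "cent x \<subseteq> carrier G" "\<one> \<in> cent x" using Nc subgroup.one_closed[OF subN] x by (auto simp: cent_def)
  fix m n assume "m \<in> cent x" "n \<in> cent x"
  then have mn: "m \<in> N" "n \<in> N" "x \<otimes> m = m \<otimes> x" "x \<otimes> n = n \<otimes> x" by (auto simp: cent_def)
  have "x \<otimes> (m \<otimes> n) = (x \<otimes> m) \<otimes> n" using x Nc mn(1,2) by (simp add: m_assoc)
  also have "\<dots> = m \<otimes> (x \<otimes> n)" unfolding mn(3) using x Nc mn(1,2) by (simp add: m_assoc)
  also have "\<dots> = m \<otimes> n \<otimes> x" unfolding mn(4) using x Nc mn(1,2) by (simp add: m_assoc)
  finally show "m \<otimes> n \<in> cent x" using subgroup.m_closed[OF subN] mn by (simp add: cent_def)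
qed

lemma cent_sub: "cent x \<subseteq> N" by (auto simp: cent_def)

lemma commute_pow:
  assumes "x \<in> carrier G" "y \<in> carrier G" "x \<otimes> y = y \<otimes> x"
  shows "x [^] (j::nat) \<otimes> y = y \<otimes> x [^] j"
proof (induction j)
  case (Suc j)
  have "x [^] Suc j \<otimes> y = x [^] j \<otimes> (x \<otimes> y)" using assms by (simp add: m_assoc)
  also have "\<dots> = (x [^] j \<otimes> y) \<otimes> x" using assms by (simp add: m_assoc)
  also have "\<dots> = y \<otimes> x [^] Suc j" unfolding Suc using assms by (simp add: m_assoc)
  finally show ?case .
qed (use assms in simp)

lemma cent_pow_sub: "x \<in> carrier G \<Longrightarrow> cent x \<subseteq> cent (x [^] (j::nat))"
  using commute_pow Nc by (auto simp: cent_def)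

lemma cent_pow: 
  assumes x: "x \<in> q_elements" and j: "j \<in> U"
  shows "cent (x [^] j) = cent x"
proof
  have xc: "x \<in> carrier G" "x [^] Q = \<one>" using x by (auto simp: q_elements_def)
  obtain u where u: "[j * u = Suc 0] (mod Q)" using cong_solve_coprime_nat[OF coprime_units[OF j]] by blast
  have "(x [^] j) [^] u = x"
    using q_element_pow_cong[OF x u] xc by (simp add: nat_pow_pow)
  then show "cent (x [^] j) \<subseteq> cent x" using cent_pow_sub[of "x [^] j" u] xc by simp
  show "cent x \<subseteq> cent (x [^] j)" using cent_pow_sub xc by blast
qed

lemma q_elements_pow: "x \<in> q_elements \<Longrightarrow> x [^] (j::nat) \<in> q_elements"
proof -
  assume x: "x \<in> q_elements"
  then have xc: "x \<in> carrier G" "x [^] Q = \<one>" by (auto simp: q_elements_def)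
  have "(x [^] j) [^] Q = (x [^] Q) [^] j" using xc(1) by (simp add: nat_pow_pow mult.commute)
  then show ?thesis using xc by (simp add: q_elements_def)
qed

text \<open>Conjugation \<open>(n, y) \<mapsto> n(xy)n\<^sup>-\<^sup>1\<close> maps \<open>N \<times> C\<close> to \<open>xN\<close>, where \<open>C\<close> is the centralizer. The
\<open>q\<close>-part of the image is \<open>nxn\<^sup>-\<^sup>1\<close>, so \<open>n\<close> is determined up to \<open>C\<close> and each fibre has at most
\<open>|C|\<close> elements. As \<open>|N||C|\<close> pairs are spread over \<open>|N|\<close> elements, every fibre has exactly \<open>|C|\<close>
elements. This replaces an appeal to the conjugacy of Sylow subgroups in \<open>\<langle>x\<rangle>N\<close>.\<close>

lemma sum_coset_cent:
  fixes f :: "'a \<Rightarrow> real"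
  assumes x: "x \<in> q_elements"
    and f: "\<And>n z. n \<in> N \<Longrightarrow> z \<in> carrier G \<Longrightarrow> f (n \<otimes> z \<otimes> inv n) = f z"
  shows "real (card (cent x)) * (\<Sum>n\<in>N. f (x \<otimes> n)) = real (card N) * (\<Sum>y\<in>cent x. f (x \<otimes> y))"
proof -
  have xc: "x \<in> carrier G" "x [^] Q = \<one>" using x by (auto simp: q_elements_def)
  have finC: "finite (cent x)" by (rule finite_subset[OF cent_sub finN])
  define Z where "Z = (\<lambda>n. x \<otimes> n) ` N"
  have injx: "inj_on (\<lambda>n. x \<otimes> n) N" using xc Nc by (auto simp: inj_on_def)
  have cardZ: "card Z = card N" unfolding Z_def by (rule card_image[OF injx])
  have finZ: "finite Z" unfolding Z_def using finN by simp
  define \<Phi> where "\<Phi> = (\<lambda>(n, y). n \<otimes> (x \<otimes> y) \<otimes> inv n)"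
  define F where "F z = {p \<in> N \<times> cent x. \<Phi> p = z}" for z
  have y: "y \<in> N" "x \<otimes> y = y \<otimes> x" "y \<in> carrier G" if "y \<in> cent x" for y using that Nc by (auto simp: cent_def)
  have \<Phi>Z: "\<Phi> p \<in> Z" if "p \<in> N \<times> cent x" for p
  proof -
    obtain n y where p: "p = (n, y)" "n \<in> N" "y \<in> cent x" using \<open>p \<in> N \<times> cent x\<close> by auto
    have "n \<otimes> (x \<otimes> y) \<otimes> inv n = x \<otimes> ((inv x \<otimes> n \<otimes> x) \<otimes> (y \<otimes> inv n))"
      using xc Nc[OF p(2)] y(3)[OF p(3)] by (simp add: m_assoc) (simp add: m_assoc[symmetric])
    moreover have "(inv x \<otimes> n \<otimes> x) \<otimes> (y \<otimes> inv n) \<in> N"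
      using N_conj(2)[OF p(2) xc(1)] y(1)[OF p(3)] p(2) subgroup.m_closed[OF subN] subgroup.m_inv_closed[OF subN] by auto
    ultimately show ?thesis unfolding Z_def \<Phi>_def p by auto
  qed
  have pe: "(x \<otimes> y) [^] e = x" if "y \<in> cent x" for y
  proof -
    have "(x \<otimes> y) [^] e = x [^] e \<otimes> y [^] e" by (rule pow_mult_distrib[OF y(2)[OF that] xc(1) y(3)[OF that]])
    then show ?thesis using pow_e_Q[OF x] pow_e_N[OF y(1)[OF that]] xc by simp
  qed
  have conj_pow: "(n \<otimes> z \<otimes> inv n) [^] k = n \<otimes> z [^] k \<otimes> inv n" if "n \<in> carrier G" "z \<in> carrier G" for n z and k :: nat
  proof (induction k)
    case (Suc k)
    have "(n \<otimes> z \<otimes> inv n) [^] Suc k = (n \<otimes> z [^] k \<otimes> inv n) \<otimes> (n \<otimes> z \<otimes> inv n)" using Suc by simp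
    moreover have "inv n \<otimes> (n \<otimes> (z \<otimes> inv n)) = z \<otimes> inv n" using that by (simp add: m_assoc[symmetric])
    ultimately show ?case using that by (simp add: m_assoc)
  qed (use that in simp)
  have Fle: "card (F z) \<le> card (cent x)" for z
  proof (cases "F z = {}")
    case False
    then obtain n0 y0 where p0: "n0 \<in> N" "y0 \<in> cent x" "\<Phi> (n0, y0) = z" unfolding F_def by auto
    have z: "z = n0 \<otimes> (x \<otimes> y0) \<otimes> inv n0" using p0 by (simp add: \<Phi>_def)
    have ze: "z [^] e = n \<otimes> x \<otimes> inv n" if "(n, y') \<in> F z" for n y'
    proof -
      have ny: "n \<in> carrier G" "y' \<in> cent x" "z = n \<otimes> (x \<otimes> y') \<otimes> inv n"
        using that Nc by (auto simp: F_def \<Phi>_def)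
      show ?thesis unfolding ny(3) using conj_pow[OF ny(1), of "x \<otimes> y'" e] pe[OF ny(2)] xc y(3)[OF ny(2)] by simp
    qed
    have p0F: "(n0, y0) \<in> F z" using p0 by (simp add: F_def)
    have map: "inv n0 \<otimes> n \<in> cent x" if p: "(n, y') \<in> F z" for n y'
    proof -
      have nN: "n \<in> N" using p by (simp add: F_def)
      note c = Nc[OF nN] Nc[OF p0(1)]
      have eq: "n0 \<otimes> x \<otimes> inv n0 = n \<otimes> x \<otimes> inv n" using ze[OF p] ze[OF p0F] by simp
      have "x \<otimes> (inv n0 \<otimes> n) = inv n0 \<otimes> (n0 \<otimes> x \<otimes> inv n0) \<otimes> n"
        using c xc by (simp add: m_assoc[symmetric])
      also have "\<dots> = (inv n0 \<otimes> n) \<otimes> x" unfolding eq using c xc by (simp add: m_assoc)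
      finally show ?thesis using nN p0(1) subgroup.m_closed[OF subN] subgroup.m_inv_closed[OF subN]
        by (simp add: cent_def)
    qed
    have "inj_on (\<lambda>p. inv n0 \<otimes> fst p) (F z)"
    proof (rule inj_onI)
      fix p p' assume p: "p \<in> F z" "p' \<in> F z" "inv n0 \<otimes> fst p = inv n0 \<otimes> fst p'"
      obtain n y1 n' y2 where pp: "p = (n, y1)" "p' = (n', y2)" by fastforce
      have c: "n \<in> carrier G" "n' \<in> carrier G" "y1 \<in> carrier G" "y2 \<in> carrier G"
        using p(1,2) pp Nc y(3) by (auto simp: F_def)
      have nn: "n = n'" using p(3) pp Nc[OF p0(1)] c by simp
      have "n \<otimes> (x \<otimes> y1) \<otimes> inv n = n \<otimes> (x \<otimes> y2) \<otimes> inv n"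
        using p(1,2) pp nn by (simp add: F_def \<Phi>_def)
      then have "y1 = y2" using c xc by simp
      then show "p = p'" using pp nn by simp
    qed
    moreover have "(\<lambda>p. inv n0 \<otimes> fst p) ` F z \<subseteq> cent x" using map by auto
    ultimately show ?thesis using card_inj_on_le finC by blast
  qed simp
  have tot: "(\<Sum>z\<in>Z. card (F z)) = (\<Sum>z\<in>Z. card (cent x))"
  proof -
    have "(\<Sum>z\<in>Z. card (F z)) = (\<Sum>z\<in>Z. \<Sum>p\<in>{p \<in> N \<times> cent x. \<Phi> p = z}. 1)" by (simp add: F_def)
    also have "\<dots> = (\<Sum>p\<in>N \<times> cent x. 1)"
      by (rule sum.group) (use finN finC finZ \<Phi>Z in auto)
    finally show ?thesis using cardZ by (simp add: card_cartesian_product)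
  qed
  have Feq: "card (F z) = card (cent x)" if "z \<in> Z" for z
  proof (rule ccontr)
    assume "card (F z) \<noteq> card (cent x)"
    then have "(\<Sum>z\<in>Z. card (F z)) < (\<Sum>z\<in>Z. card (cent x))"
      using le_neq_implies_less[OF Fle] Fle that finZ by (intro sum_strict_mono_ex1 bexI[of _ z]) auto
    then show False using tot by simp
  qed
  have "real (card N) * (\<Sum>y\<in>cent x. f (x \<otimes> y)) = (\<Sum>n\<in>N. \<Sum>y\<in>cent x. f (\<Phi> (n, y)))"
    using f xc y by (simp add: \<Phi>_def)
  also have "\<dots> = (\<Sum>p\<in>N \<times> cent x. f (\<Phi> p))" by (simp add: sum.cartesian_product)
  also have "\<dots> = (\<Sum>z\<in>Z. \<Sum>p\<in>{p \<in> N \<times> cent x. \<Phi> p = z}. f (\<Phi> p))"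
    by (rule sum.group[symmetric]) (use finN finC finZ \<Phi>Z in auto)
  also have "\<dots> = (\<Sum>z\<in>Z. real (card (F z)) * f z)"
    by (intro sum.cong refl) (simp add: F_def)
  also have "\<dots> = real (card (cent x)) * (\<Sum>z\<in>Z. f z)" using Feq by (simp add: sum_distrib_left)
  also have "(\<Sum>z\<in>Z. f z) = (\<Sum>n\<in>N. f (x \<otimes> n))" unfolding Z_def by (simp add: sum.reindex[OF injx])
  finally show ?thesis by simp
qed

lemma xN_unique_power:
  assumes x: "x \<in> q_elements" and "(x [^] (d::nat)) \<in> N"
  shows "x [^] d = \<one>"
proof -
  have xc: "x \<in> carrier G" using x by (simp add: q_elements_def)
  have "x [^] d = (x [^] d) [^] e" using pow_e_Q[OF q_elements_pow[OF x]] by simp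
  then show ?thesis using pow_e_N[OF assms(2)] by simp
qed

text \<open>The expansion of \<open>\<chi>\<close> on \<open>\<langle>x\<rangle>C\<close> in the irreducible characters of the centralizer \<open>C\<close>, with
coefficients depending on the power of \<open>x\<close>. Characters in \<open>\<B>\<close> are genuine functions, distinct as
elements exactly if they differ on \<open>C\<close>, which is what the orthonormality clause expresses.\<close>

definition cent_decomposition :: "'a \<Rightarrow> ('a \<Rightarrow> complex) set \<Rightarrow> (('a \<Rightarrow> complex) \<Rightarrow> nat \<Rightarrow> complex) \<Rightarrow> bool" where
  "cent_decomposition x \<B> \<alpha> \<longleftrightarrow> finite \<B> \<and>
     (\<forall>b\<in>\<B>. irreducible_character (G\<lparr>carrier := cent x\<rparr>) b \<and> virtual_char Q (\<alpha> b)) \<and>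
     (\<forall>b\<in>\<B>. \<forall>b'\<in>\<B>. (\<Sum>y\<in>cent x. b y * cnj (b' y)) = (if b = b' then of_nat (card (cent x)) else 0)) \<and>
     (\<forall>(j::nat). \<forall>y\<in>cent x. \<chi> (x [^] j \<otimes> y) = (\<Sum>b\<in>\<B>. \<alpha> b j * b y))"

lemma cent_decompositionD:
  assumes "cent_decomposition x \<B> \<alpha>"
  shows "finite \<B>" "\<And>b. b \<in> \<B> \<Longrightarrow> irreducible_character (G\<lparr>carrier := cent x\<rparr>) b"
    "\<And>b. b \<in> \<B> \<Longrightarrow> virtual_char Q (\<alpha> b)"
    "\<And>b b'. b \<in> \<B> \<Longrightarrow> b' \<in> \<B> \<Longrightarrow>
      (\<Sum>y\<in>cent x. b y * cnj (b' y)) = (if b = b' then of_nat (card (cent x)) else 0)"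
    "\<And>j y. y \<in> cent x \<Longrightarrow> \<chi> (x [^] (j::nat) \<otimes> y) = (\<Sum>b\<in>\<B>. \<alpha> b j * b y)"
  using assms by (simp_all add: cent_decomposition_def)

text \<open>Decompose the restriction of \<open>\<chi>\<close> to \<open>\<langle>x\<rangle>C\<close>. In each constituent the central element \<open>x\<close> is a
scalar root of unity, and constituents with the same restriction to \<open>C\<close> are collected.\<close>

lemma cent_decomposition_exists:
  assumes x: "x \<in> q_elements"
  obtains \<B> \<alpha> where "cent_decomposition x \<B> \<alpha>"
proof -
  have xc: "x \<in> carrier G" "x [^] Q = \<one>" using x by (auto simp: q_elements_def)
  define C where "C = cent x"
  have C: "subgroup C G" unfolding C_def by (rule cent_subgroup[OF xc(1)])
  have Cc: "y \<in> carrier G" "x \<otimes> y = y \<otimes> x" if "y \<in> C" for y using that Nc by (auto simp: C_def cent_def)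
  have finC: "finite C" unfolding C_def by (rule finite_subset[OF cent_sub finN])
  define H where "H = {x [^] j \<otimes> k | (j::nat) k. k \<in> C}"
  have H: "subgroup H G" unfolding H_def
  proof (rule normalized_cyclic_product_subgroup[OF fin C xc(1)])
    fix k assume k: "k \<in> C"
    have "inv x \<otimes> k \<otimes> x = inv x \<otimes> (x \<otimes> k)"
      unfolding Cc(2)[OF k] using Cc(1)[OF k] xc(1) by (simp add: m_assoc)
    also have "\<dots> = k" using Cc(1)[OF k] xc(1) by (simp add: m_assoc[symmetric])
    finally show "inv x \<otimes> k \<otimes> x \<in> C" using k by simp
  qed
  let ?H = "G\<lparr>carrier := H\<rparr>"
  have GH: "group ?H" by (rule subgroup.subgroup_is_group[OF H is_group])
  have CH: "C \<subseteq> H"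
  proof
    fix k assume "k \<in> C"
    moreover have "k = x [^] (0::nat) \<otimes> k" using Cc[OF \<open>k \<in> C\<close>] by simp
    ultimately show "k \<in> H" unfolding H_def by blast
  qed
  have xH: "x \<in> H"
  proof -
    have "x = x [^] (1::nat) \<otimes> \<one>" using xc by simp
    then show ?thesis unfolding H_def using subgroup.one_closed[OF C] by blast
  qed
  have powH: "y [^]\<^bsub>?H\<^esub> (j::nat) = y [^] j" for y j by (simp add: nat_pow_consistent[symmetric])
  obtain \<Phi> where \<Phi>: "\<forall>\<phi>\<in>set \<Phi>. irreducible_character ?H \<phi>" "\<forall>h\<in>H. \<chi> h = (\<Sum>\<phi>\<leftarrow>\<Phi>. \<phi> h)"
    using irreducible_character_constituents[OF is_group H \<chi>] by blast
  have "\<exists>\<mu>. irreducible_character (G\<lparr>carrier := C\<rparr>) \<phi> \<and> \<mu> ^ Q = 1 \<and>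
      (\<forall>(j::nat) c. c \<in> C \<longrightarrow> \<phi> (x [^] j \<otimes> c) = \<mu> ^ j * \<phi> c)" if \<phi>: "\<phi> \<in> set \<Phi>" for \<phi>
  proof -
    have ir: "irreducible_character ?H \<phi>" using \<Phi>(1) \<phi> by blast
    have central: "x \<otimes>\<^bsub>?H\<^esub> h = h \<otimes>\<^bsub>?H\<^esub> x" if hH: "h \<in> carrier ?H" for h
    proof -
      obtain j :: nat and k where h: "k \<in> C" "h = x [^] j \<otimes> k" using hH by (auto simp: H_def)
      have "x \<otimes> h = (x \<otimes> x [^] j) \<otimes> k" using h Cc xc by (simp add: m_assoc)
      also have "x \<otimes> x [^] j = x [^] j \<otimes> x" using commute_pow[OF xc(1) xc(1)] by simp
      also have "x [^] j \<otimes> x \<otimes> k = x [^] j \<otimes> (k \<otimes> x)" using Cc[OF h(1)] xc by (simp add: m_assoc)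
      also have "\<dots> = h \<otimes> x" using h Cc xc by (simp add: m_assoc)
      finally show ?thesis by simp
    qed
    have CsubH: "subgroup C ?H" by (rule subgroup_incl[OF C H CH])
    have gen: "\<exists>j::nat. \<exists>c\<in>C. g = x [^]\<^bsub>?H\<^esub> j \<otimes>\<^bsub>?H\<^esub> c" if "g \<in> carrier ?H" for g
      using that unfolding powH by (auto simp: H_def)
    obtain \<mu> where "irreducible_character (?H\<lparr>carrier := C\<rparr>) \<phi>"
      "\<And>m::nat. x [^]\<^bsub>?H\<^esub> m = \<one>\<^bsub>?H\<^esub> \<Longrightarrow> \<mu> ^ m = 1"
      "\<And>(j::nat) c. c \<in> C \<Longrightarrow> \<phi> (x [^]\<^bsub>?H\<^esub> j \<otimes>\<^bsub>?H\<^esub> c) = \<mu> ^ j * \<phi> c"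
      using irreducible_character_central_product[OF GH ir _ central CsubH gen] xH by auto
    then show ?thesis using xc(2) unfolding powH by (intro exI[of _ \<mu>]) auto
  qed
  then obtain \<mu> where \<mu>: "\<And>\<phi>. \<phi> \<in> set \<Phi> \<Longrightarrow> irreducible_character (G\<lparr>carrier := C\<rparr>) \<phi>"
      "\<And>\<phi>. \<phi> \<in> set \<Phi> \<Longrightarrow> \<mu> \<phi> ^ Q = 1"
      "\<And>\<phi> (j::nat) c. \<phi> \<in> set \<Phi> \<Longrightarrow> c \<in> C \<Longrightarrow> \<phi> (x [^] j \<otimes> c) = \<mu> \<phi> ^ j * \<phi> c"
    by metis
  define k where "k = length \<Phi>"
  define \<beta> where "\<beta> i = restrict (\<Phi> ! i) C" for i
  define \<B> where "\<B> = \<beta> ` {..<k}"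
  define \<alpha> where "\<alpha> b j = (\<Sum>i\<in>{i\<in>{..<k}. \<beta> i = b}. of_int 1 * \<mu> (\<Phi> ! i) ^ j)" for b and j :: nat
  have nth: "\<Phi> ! i \<in> set \<Phi>" if "i < k" for i using that by (simp add: k_def)
  have irrB: "irreducible_character (G\<lparr>carrier := C\<rparr>) b" if "b \<in> \<B>" for b
  proof -
    obtain i where i: "i < k" "b = \<beta> i" using \<open>b \<in> \<B>\<close> by (auto simp: \<B>_def)
    show ?thesis using \<mu>(1)[OF nth[OF i(1)]] unfolding i(2) \<beta>_def irreducible_character_def by simp
  qed
  have GC: "group (G\<lparr>carrier := C\<rparr>)" by (rule subgroup.subgroup_is_group[OF C is_group])
  have orth: "(\<Sum>y\<in>C. b y * cnj (b' y)) = (if b = b' then of_nat (card C) else 0)"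
    if b: "b \<in> \<B>" "b' \<in> \<B>" for b b'
  proof -
    have "(\<forall>g\<in>C. b g = b' g) \<longleftrightarrow> b = b'" using b by (auto simp: \<B>_def \<beta>_def restrict_def fun_eq_iff)
    then show ?thesis
      using irreducible_character_orthogonality[OF GC _ irrB[OF b(1)] irrB[OF b(2)]] finC
      by (simp add: Coset.order_def)
  qed
  have val: "\<chi> (x [^] j \<otimes> y) = (\<Sum>b\<in>\<B>. \<alpha> b j * b y)" if y: "y \<in> C" for j :: nat and y
  proof -
    have "x [^] j \<otimes> y \<in> H" using y by (auto simp: H_def)
    then have "\<chi> (x [^] j \<otimes> y) = (\<Sum>\<phi>\<leftarrow>\<Phi>. \<phi> (x [^] j \<otimes> y))" using \<Phi>(2) by blast
    also have "\<dots> = (\<Sum>i<k. (\<Phi> ! i) (x [^] j \<otimes> y))"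
      by (simp add: sum_list_sum_nth k_def atLeast0LessThan)
    also have "\<dots> = (\<Sum>i<k. of_int 1 * \<mu> (\<Phi> ! i) ^ j * \<beta> i y)"
      using \<mu>(3)[OF nth y] y by (intro sum.cong refl) (simp add: \<beta>_def)
    also have "\<dots> = (\<Sum>b\<in>\<B>. \<Sum>i\<in>{i\<in>{..<k}. \<beta> i = b}. of_int 1 * \<mu> (\<Phi> ! i) ^ j * \<beta> i y)"
      by (rule sum.group[symmetric]) (auto simp: \<B>_def)
    also have "\<dots> = (\<Sum>b\<in>\<B>. \<alpha> b j * b y)"
      unfolding \<alpha>_def sum_distrib_right by (intro sum.cong refl) auto
    finally show ?thesis .
  qed
  have "virtual_char Q (\<alpha> b)" for b
  proof -
    have "virtual_char Q (\<lambda>j. \<alpha> b j)" unfolding \<alpha>_def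
      by (rule virtual_char_sum_roots) (use Q0 \<mu>(2) nth in auto)
    then show ?thesis by simp
  qed
  then have "cent_decomposition x \<B> \<alpha>"
    using irrB orth val unfolding cent_decomposition_def C_def[symmetric] by (simp add: \<B>_def)
  then show ?thesis by (rule that)
qed

lemma \<chi>_conj: "n \<in> N \<Longrightarrow> z \<in> carrier G \<Longrightarrow> \<chi> (n \<otimes> z \<otimes> inv n) = \<chi> z"
  using irreducible_character_conj[OF is_group \<chi> _ Nc] by blast

text \<open>The mean over \<open>x\<^sup>jN\<close> is the mean over \<open>x\<^sup>jC\<close>, because a unit power of \<open>x\<close> has the same centralizer.
Orthonormality of \<open>\<B>\<close> then gives a Parseval identity. For \<open>j\<close> not a unit it fails in general, as
the centralizer grows.\<close>

lemma coset_norm_eq_sum_norms: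
  assumes x: "x \<in> q_elements" and j: "j \<in> U" and dec: "cent_decomposition x \<B> \<alpha>"
  shows "coset_norm (x [^] j) = (\<Sum>b\<in>\<B>. (norm (\<alpha> b j))\<^sup>2)"
proof -
  note orth = cent_decompositionD(4)[OF dec] and val = cent_decompositionD(5)[OF dec]
  have "finite \<B>" by (rule cent_decompositionD(1)[OF dec])
  have xc: "x \<in> carrier G" using x by (simp add: q_elements_def)
  have finC: "finite (cent x)" by (rule finite_subset[OF cent_sub finN])
  have C0: "real (card (cent x)) > 0"
    using finC subgroup.one_closed[OF cent_subgroup[OF xc]] by (auto simp: card_gt_0_iff)
  have "complex_of_real (\<Sum>y\<in>cent x. (norm (\<chi> (x [^] j \<otimes> y)))\<^sup>2) =
      (\<Sum>y\<in>cent x. \<Sum>b\<in>\<B>. \<Sum>b'\<in>\<B>. \<alpha> b j * cnj (\<alpha> b' j) * (b y * cnj (b' y)))"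
    unfolding of_real_sum complex_norm_square
    by (intro sum.cong refl) (simp add: val sum_product mult_ac)
  also have "\<dots> = (\<Sum>b\<in>\<B>. \<Sum>y\<in>cent x. \<Sum>b'\<in>\<B>. \<alpha> b j * cnj (\<alpha> b' j) * (b y * cnj (b' y)))"
    by (rule sum.swap)
  also have "\<dots> = (\<Sum>b\<in>\<B>. \<Sum>b'\<in>\<B>. \<Sum>y\<in>cent x. \<alpha> b j * cnj (\<alpha> b' j) * (b y * cnj (b' y)))"
    by (intro sum.cong refl sum.swap)
  also have "\<dots> = (\<Sum>b\<in>\<B>. \<Sum>b'\<in>\<B>. if b = b' then of_nat (card (cent x)) * (\<alpha> b j * cnj (\<alpha> b j)) else 0)"
    unfolding sum_distrib_left[symmetric] using orth by (intro sum.cong refl) auto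
  also have "\<dots> = (\<Sum>b\<in>\<B>. of_nat (card (cent x)) * (\<alpha> b j * cnj (\<alpha> b j)))" using \<open>finite \<B>\<close> by simp
  also have "\<dots> = complex_of_real (real (card (cent x)) * (\<Sum>b\<in>\<B>. (norm (\<alpha> b j))\<^sup>2))"
    unfolding of_real_mult of_real_sum complex_norm_square by (simp add: sum_distrib_left)
  finally have s: "(\<Sum>y\<in>cent x. (norm (\<chi> (x [^] j \<otimes> y)))\<^sup>2) =
      real (card (cent x)) * (\<Sum>b\<in>\<B>. (norm (\<alpha> b j))\<^sup>2)"
    by (simp only: of_real_eq_iff)
  have "real (card (cent (x [^] j))) * (\<Sum>n\<in>N. (norm (\<chi> (x [^] j \<otimes> n)))\<^sup>2) =
      real (card N) * (\<Sum>y\<in>cent (x [^] j). (norm (\<chi> (x [^] j \<otimes> y)))\<^sup>2)"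
    by (rule sum_coset_cent[OF q_elements_pow[OF x]]) (simp add: \<chi>_conj)
  then have "real (card (cent x)) * (\<Sum>n\<in>N. (norm (\<chi> (x [^] j \<otimes> n)))\<^sup>2) =
      real (card (cent x)) * (real (card N) * (\<Sum>b\<in>\<B>. (norm (\<alpha> b j))\<^sup>2))"
    unfolding cent_pow[OF x j] s by simp
  then have "(\<Sum>n\<in>N. (norm (\<chi> (x [^] j \<otimes> n)))\<^sup>2) = real (card N) * (\<Sum>b\<in>\<B>. (norm (\<alpha> b j))\<^sup>2)"
    using C0 by simp
  then show ?thesis unfolding coset_norm_def using cardN0 by simp
qed

text \<open>Unlike the expansion over the centralizer, this holds for all \<open>j\<close>, including \<open>j = 0\<close>. Its coefficients
are the Fourier coefficients of \<open>j \<mapsto> coset_norm (x\<^sup>j)\<close>, and these are the inner products of \<open>\<chi>\<close>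
with its twists by the linear characters of \<open>\<langle>x\<rangle>N/N\<close>. Inner products of characters are
integers.\<close>

lemma coset_norm_virtual_char:
  assumes x: "x \<in> q_elements"
  shows "virtual_char Q (\<lambda>j. complex_of_real (coset_norm (x [^] j)))"
proof -
  have xc: "x \<in> carrier G" "x [^] Q = \<one>" using x by (auto simp: q_elements_def)
  \<comment> \<open>The linear characters of \<open>\<langle>x\<rangle>N/N\<close> need the exact order of \<open>x\<close>, which may be smaller than \<open>Q\<close>.\<close>
  define R where "R = ord x"
  define \<zeta> where "\<zeta> = unity_root R"
  have Rdvd: "x [^] (d::nat) = \<one> \<longleftrightarrow> R dvd d" for d using pow_eq_id[OF xc(1)] by (simp add: R_def)
  have RQ: "R dvd Q" using Rdvd xc(2) by blast
  then have R0: "R > 0" using Q0 by (cases "R = 0") auto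
  have \<zeta>R: "\<zeta> ^ R = 1" unfolding \<zeta>_def by (rule unity_root_power_self[OF R0])
  have modR: "x [^] (j mod R) = x [^] j" for j :: nat
  proof -
    have "x [^] j = x [^] (R * (j div R) + j mod R)" by simp
    also have "\<dots> = (x [^] R) [^] (j div R) \<otimes> x [^] (j mod R)"
      using xc(1) by (simp only: nat_pow_mult[symmetric] nat_pow_pow)
    also have "x [^] R = \<one>" using Rdvd by simp
    finally show ?thesis using xc(1) by simp
  qed
  define H where "H = {x [^] j \<otimes> k | (j::nat) k. k \<in> N}"
  have H: "subgroup H G" unfolding H_def
    by (rule normalized_cyclic_product_subgroup[OF fin subN xc(1)]) (rule N_conj(2)[OF _ xc(1)])
  let ?H = "G\<lparr>carrier := H\<rparr>"
  have GH: "group ?H" by (rule subgroup.subgroup_is_group[OF H is_group])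
  have Hc: "h \<in> carrier G" if "h \<in> H" for h using that subgroup.subset[OF H] by blast
  have expo: "[i = j] (mod R)" if e: "x [^] i \<otimes> m = x [^] j \<otimes> n" and mn: "m \<in> N" "n \<in> N" for i j :: nat and m n
  proof -
    have *: "[i = j] (mod R)" if e: "x [^] i \<otimes> m = x [^] j \<otimes> n" and mn: "m \<in> N" "n \<in> N" and "i \<le> j"
      for i j :: nat and m n
    proof -
      have "x [^] i \<otimes> m = x [^] i \<otimes> (x [^] (j - i) \<otimes> n)"
        using e \<open>i \<le> j\<close> xc(1) Nc[OF mn(2)] by (simp add: m_assoc[symmetric] nat_pow_mult)
      then have "m = x [^] (j - i) \<otimes> n" using xc(1) Nc mn by simp
      then have "x [^] (j - i) = m \<otimes> inv n" using xc(1) Nc[OF mn(1)] Nc[OF mn(2)] by (simp add: m_assoc)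
      then have "x [^] (j - i) \<in> N" using mn subgroup.m_closed[OF subN] subgroup.m_inv_closed[OF subN] by simp
      then have "x [^] (j - i) = \<one>" by (rule xN_unique_power[OF x])
      then have "R dvd j - i" using Rdvd by simp
      then show ?thesis using \<open>i \<le> j\<close> by (metis cong_altdef_nat cong_sym)
    qed
    show ?thesis
    proof (cases "i \<le> j")
      case False
      then show ?thesis using *[OF e[symmetric] mn(2,1)] by (simp add: cong_sym)
    qed (rule *[OF e mn])
  qed
  define idx where "idx h = (SOME j::nat. \<exists>n\<in>N. h = x [^] j \<otimes> n)" for h
  have idx: "[idx (x [^] j \<otimes> n) = j] (mod R)" if n: "n \<in> N" for j :: nat and n
  proof -
    have "\<exists>n'\<in>N. x [^] j \<otimes> n = x [^] idx (x [^] j \<otimes> n) \<otimes> n'"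
      unfolding idx_def using n by (intro someI_ex[of "\<lambda>i::nat. \<exists>n'\<in>N. x [^] j \<otimes> n = x [^] i \<otimes> n'"]) blast
    then obtain n' where "n' \<in> N" "x [^] j \<otimes> n = x [^] idx (x [^] j \<otimes> n) \<otimes> n'" by blast
    then show ?thesis using expo[of _ n' j n] n by metis
  qed
  \<comment> \<open>The \<open>k\<close>-th linear character of \<open>\<langle>x\<rangle>N/N\<close>.\<close>
  define \<theta> where "\<theta> k h = (\<zeta> ^ k) ^ idx h" for k h
  have \<theta>: "\<theta> k (x [^] j \<otimes> n) = (\<zeta> ^ k) ^ j" if n: "n \<in> N" for j k :: nat and n
  proof -
    have "w ^ i = w ^ (i mod R)" if "w ^ R = 1" for w :: complex and i
    proof -
      have "w ^ i = w ^ (R * (i div R) + i mod R)" by simp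
      then show ?thesis using that by (simp only: power_add power_mult power_one mult_1)
    qed
    moreover have "(\<zeta> ^ k) ^ R = 1" using \<zeta>R by (metis mult.commute power_mult power_one)
    ultimately show ?thesis using idx[OF n, of j] unfolding \<theta>_def cong_def by metis
  qed
  have \<theta>_one: "\<theta> k \<one> = 1" for k
    using \<theta>[OF subgroup.one_closed[OF subN], of k 0] by simp
  have \<theta>_mult: "\<theta> k (g \<otimes> h) = \<theta> k g * \<theta> k h" if gh: "g \<in> H" "h \<in> H" for k g h
  proof -
    obtain i j :: nat and m n where *: "m \<in> N" "n \<in> N" "g = x [^] i \<otimes> m" "h = x [^] j \<otimes> n"
      using gh unfolding H_def by blast
    note c = Nc[OF *(1)] Nc[OF *(2)] xc(1)
    have "g \<otimes> h = x [^] i \<otimes> x [^] j \<otimes> ((inv (x [^] j) \<otimes> m \<otimes> x [^] j) \<otimes> n)"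
      unfolding *(3,4) using c by (simp add: m_assoc) (simp add: m_assoc[symmetric])
    then have "g \<otimes> h = x [^] (i + j) \<otimes> ((inv (x [^] j) \<otimes> m \<otimes> x [^] j) \<otimes> n)"
      using c by (simp add: nat_pow_mult)
    moreover have "(inv (x [^] j) \<otimes> m \<otimes> x [^] j) \<otimes> n \<in> N"
      using N_conj(2)[OF *(1), of "x [^] j"] xc(1) *(2) subgroup.m_closed[OF subN] by simp
    ultimately show ?thesis using \<theta> *(1,2) unfolding *(3,4) by (simp add: power_add)
  qed
  have bij: "bij_betw (\<lambda>(i, n). x [^] i \<otimes> n) ({..<R} \<times> N) H"
    unfolding bij_betw_def
  proof
    show "inj_on (\<lambda>(i, n). x [^] i \<otimes> n) ({..<R} \<times> N)"
    proof (rule inj_onI, clarsimp)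
      fix i m j n assume *: "i < R" "m \<in> N" "j < R" "n \<in> N" "x [^] i \<otimes> m = x [^] j \<otimes> n"
      have "i = j" using expo[OF *(5,2,4)] *(1,3) by (simp add: cong_def)
      then show "i = j \<and> m = n" using *(5) xc(1) Nc[OF *(2)] Nc[OF *(4)] by simp
    qed
    show "(\<lambda>(i, n). x [^] i \<otimes> n) ` ({..<R} \<times> N) = H"
    proof
      show "H \<subseteq> (\<lambda>(i, n). x [^] i \<otimes> n) ` ({..<R} \<times> N)"
      proof
        fix h assume "h \<in> H"
        then obtain j :: nat and n where "n \<in> N" "h = x [^] j \<otimes> n" by (auto simp: H_def)
        then have "h = (\<lambda>(i, n). x [^] i \<otimes> n) (j mod R, n)" "(j mod R, n) \<in> {..<R} \<times> N"
          using modR R0 by auto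
        then show "h \<in> (\<lambda>(i, n). x [^] i \<otimes> n) ` ({..<R} \<times> N)" by (rule image_eqI)
      qed
    qed (auto simp: H_def)
  qed
  have sumH: "(\<Sum>h\<in>H. f h) = (\<Sum>i<R. \<Sum>n\<in>N. f (x [^] i \<otimes> n))" for f :: "'a \<Rightarrow> complex"
    using sum.reindex_bij_betw[OF bij, of f] by (simp add: sum.cartesian_product case_prod_beta)
  have cardH: "card H = R * card N" using bij_betw_same_card[OF bij] by (simp add: card_cartesian_product)
  obtain \<Phi> where \<Phi>: "\<forall>\<phi>\<in>set \<Phi>. irreducible_character ?H \<phi>" "\<forall>h\<in>H. \<chi> h = (\<Sum>\<phi>\<leftarrow>\<Phi>. \<phi> h)"
    using irreducible_character_constituents[OF is_group H \<chi>] by blast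
  define r where "r = length \<Phi>"
  have irr: "irreducible_character ?H (\<Phi> ! i)" if "i < r" for i using \<Phi>(1) that by (simp add: r_def)
  have \<chi>H: "\<chi> h = (\<Sum>i<r. (\<Phi> ! i) h)" if "h \<in> H" for h
    using \<Phi>(2) that by (simp add: sum_list_sum_nth r_def atLeast0LessThan)
  have "\<exists>m::int. (\<Sum>h\<in>H. \<chi> h * cnj (\<theta> k h * \<chi> h)) = of_nat (card H) * of_int m" for k
  proof -
    define \<delta> :: "nat \<Rightarrow> nat \<Rightarrow> int" where
      "\<delta> i j = (if \<forall>h\<in>H. (\<Phi> ! i) h = \<theta> k h * (\<Phi> ! j) h then 1 else 0)" for i j
    have "(\<Sum>h\<in>H. \<chi> h * cnj (\<theta> k h * \<chi> h)) =
        (\<Sum>h\<in>H. \<Sum>i<r. \<Sum>j<r. (\<Phi> ! i) h * cnj (\<theta> k h * (\<Phi> ! j) h))"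
    proof (intro sum.cong refl)
      fix h assume h: "h \<in> H"
      have "cnj (\<theta> k h * \<chi> h) = (\<Sum>j<r. cnj (\<theta> k h * (\<Phi> ! j) h))"
        by (simp add: \<chi>H[OF h] sum_distrib_left)
      then show "\<chi> h * cnj (\<theta> k h * \<chi> h) = (\<Sum>i<r. \<Sum>j<r. (\<Phi> ! i) h * cnj (\<theta> k h * (\<Phi> ! j) h))"
        by (simp only: \<chi>H[OF h] sum_product)
    qed
    also have "\<dots> = (\<Sum>i<r. \<Sum>h\<in>H. \<Sum>j<r. (\<Phi> ! i) h * cnj (\<theta> k h * (\<Phi> ! j) h))" by (rule sum.swap)
    also have "\<dots> = (\<Sum>i<r. \<Sum>j<r. \<Sum>h\<in>H. (\<Phi> ! i) h * cnj (\<theta> k h * (\<Phi> ! j) h))"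
      by (intro sum.cong refl sum.swap)
    also have "\<dots> = (\<Sum>i<r. \<Sum>j<r. of_nat (card H) * of_int (\<delta> i j))"
    proof (intro sum.cong refl)
      fix i j assume "i \<in> {..<r}" "j \<in> {..<r}"
      then have ij: "i < r" "j < r" by auto
      have "irreducible_character ?H (\<lambda>h. \<theta> k h * (\<Phi> ! j) h)"
        by (rule irreducible_character_twist[OF GH irr[OF ij(2)]]) (use \<theta>_one \<theta>_mult in auto)
      from irreducible_character_orthogonality[OF GH _ irr[OF ij(1)] this]
      show "(\<Sum>h\<in>H. (\<Phi> ! i) h * cnj (\<theta> k h * (\<Phi> ! j) h)) = of_nat (card H) * of_int (\<delta> i j)"
        using finite_subset[OF subgroup.subset[OF H] fin] by (simp add: \<delta>_def Coset.order_def)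
    qed
    also have "\<dots> = of_nat (card H) * of_int (\<Sum>i<r. \<Sum>j<r. \<delta> i j)" by (simp add: sum_distrib_left)
    finally show ?thesis by blast
  qed
  then obtain m :: "nat \<Rightarrow> int" where m: "\<And>k. (\<Sum>h\<in>H. \<chi> h * cnj (\<theta> k h * \<chi> h)) = of_nat (card H) * of_int (m k)"
    by metis
  have mk: "of_nat R * of_int (m k) = (\<Sum>i<R. cnj ((\<zeta> ^ k) ^ i) * complex_of_real (coset_norm (x [^] i)))" for k
  proof -
    have "of_nat (card N) * (of_nat R * of_int (m k)) = (\<Sum>i<R. \<Sum>n\<in>N. cnj ((\<zeta> ^ k) ^ i) * (\<chi> (x [^] i \<otimes> n) * cnj (\<chi> (x [^] i \<otimes> n))))"
      using m[of k] unfolding sumH cardH by (simp add: \<theta> mult_ac)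
    also have "\<dots> = (\<Sum>i<R. cnj ((\<zeta> ^ k) ^ i) * (of_nat (card N) * complex_of_real (coset_norm (x [^] i))))"
    proof (intro sum.cong refl)
      fix i :: nat
      have "of_nat (card N) * complex_of_real (coset_norm (x [^] i)) = complex_of_real (\<Sum>n\<in>N. (norm (\<chi> (x [^] i \<otimes> n)))\<^sup>2)"
        unfolding coset_norm_def using cardN0 by simp
      then show "(\<Sum>n\<in>N. cnj ((\<zeta> ^ k) ^ i) * (\<chi> (x [^] i \<otimes> n) * cnj (\<chi> (x [^] i \<otimes> n)))) =
          cnj ((\<zeta> ^ k) ^ i) * (of_nat (card N) * complex_of_real (coset_norm (x [^] i)))"
        by (simp only: of_real_sum complex_norm_square sum_distrib_left)
    qed
    also have "\<dots> = of_nat (card N) * (\<Sum>i<R. cnj ((\<zeta> ^ k) ^ i) * complex_of_real (coset_norm (x [^] i)))"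
      by (simp add: sum_distrib_left mult_ac)
    finally show ?thesis using cardN0 by simp
  qed
  have inversion: "(\<Sum>k<R. of_int (m k) * (\<zeta> ^ k) ^ j) = complex_of_real (coset_norm (x [^] j))" for j :: nat
  proof -
    define j' where "j' = j mod R"
    have j': "j' < R" using R0 by (simp add: j'_def)
    have \<zeta>j: "(\<zeta> ^ k) ^ j = (\<zeta> ^ j') ^ k" for k
    proof -
      have "\<zeta> ^ j = \<zeta> ^ (R * (j div R) + j mod R)" by simp
      also have "\<dots> = \<zeta> ^ j'" using \<zeta>R by (simp only: power_add power_mult power_one mult_1 j'_def)
      finally show ?thesis by (metis mult.commute power_mult)
    qed
    have "of_nat R * (\<Sum>k<R. of_int (m k) * (\<zeta> ^ k) ^ j) =
        (\<Sum>k<R. \<Sum>i<R. (\<zeta> ^ j' * cnj (\<zeta> ^ i)) ^ k * complex_of_real (coset_norm (x [^] i)))"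
      unfolding sum_distrib_left mult.assoc[symmetric] mk sum_distrib_right \<zeta>j
      by (intro sum.cong refl) (simp add: power_mult_distrib mult_ac flip: power_mult)
    also have "\<dots> = (\<Sum>i<R. \<Sum>k<R. (\<zeta> ^ j' * cnj (\<zeta> ^ i)) ^ k * complex_of_real (coset_norm (x [^] i)))"
      by (rule sum.swap)
    also have "\<dots> = (\<Sum>i<R. if i = j' then of_nat R * complex_of_real (coset_norm (x [^] i)) else 0)"
    proof (intro sum.cong refl)
      fix i assume "i \<in> {..<R}"
      then have i: "i < R" by simp
      have "(\<Sum>k<R. (\<zeta> ^ j' * cnj (\<zeta> ^ i)) ^ k) = (if j' = i then of_nat R else 0)"
        using sum_root_powers[OF unity_root_ratio(1)[OF j' i]] unity_root_ratio(2)[OF j' i]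
        unfolding \<zeta>_def by simp
      then show "(\<Sum>k<R. (\<zeta> ^ j' * cnj (\<zeta> ^ i)) ^ k * complex_of_real (coset_norm (x [^] i))) =
          (if i = j' then of_nat R * complex_of_real (coset_norm (x [^] i)) else 0)"
        unfolding sum_distrib_right[symmetric] by auto
    qed
    also have "\<dots> = of_nat R * complex_of_real (coset_norm (x [^] j))" using j' modR by (simp add: j'_def)
    finally show ?thesis using R0 by simp
  qed
  have "virtual_char Q (\<lambda>j. \<Sum>k<R. of_int (m k) * (\<zeta> ^ k) ^ j)"
  proof (rule virtual_char_sum_roots)
    fix k
    obtain s where "Q = R * s" using RQ by blast
    then have "(\<zeta> ^ k) ^ Q = ((\<zeta> ^ R) ^ s) ^ k" by (metis mult.commute mult.left_commute power_mult)
    then show "(\<zeta> ^ k) ^ Q = 1" using \<zeta>R by simp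
  qed (use Q0 in auto)
  then show ?thesis unfolding inversion .
qed

text \<open>Up to the factor \<open>|U|\<close>, the average of the coset norm over the Galois conjugates.\<close>

definition galois_norm where "galois_norm g = (\<Sum>j\<in>U. coset_norm (g [^] j))"

lemma galois_norm_nonneg: "galois_norm g \<ge> 0"
  unfolding galois_norm_def by (intro sum_nonneg coset_norm_nonneg)

lemma sum_galois_norm: "(\<Sum>g\<in>carrier G. galois_norm g) = real (card U) * real (order G)"
proof -
  have "(\<Sum>g\<in>carrier G. galois_norm g) = (\<Sum>j\<in>U. \<Sum>g\<in>carrier G. coset_norm (g [^] j))"
    unfolding galois_norm_def by (rule sum.swap)
  then show ?thesis by (simp add: sum_coset_norm_pow)
qed

lemma galois_norm_pow_e: "g \<in> carrier G \<Longrightarrow> galois_norm (g [^] e) = galois_norm g"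
proof -
  assume g: "g \<in> carrier G"
  have "coset_norm ((g [^] e) [^] j) = coset_norm (g [^] j)" for j :: nat
  proof -
    have "[e * j = 1 * j] (mod Q)" using e(1) by (rule cong_scalar_right)
    then have "coset_norm (g [^] (e * j)) = coset_norm (g [^] j)" using coset_norm_cong[OF g] by simp
    then show ?thesis using g by (simp add: nat_pow_pow)
  qed
  then show ?thesis unfolding galois_norm_def by simp
qed

lemma galois_norm_eq_norms:
  assumes "x \<in> q_elements" "cent_decomposition x \<B> \<alpha>"
  shows "galois_norm x = (\<Sum>b\<in>\<B>. \<Sum>j\<in>U. (norm (\<alpha> b j))\<^sup>2)"
  unfolding galois_norm_def using coset_norm_eq_sum_norms[OF assms(1) _ assms(2)] by (subst sum.swap) simp

lemma galois_norm_dichotomy: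
  assumes g: "g \<in> carrier G"
  shows "galois_norm g = 0 \<or> galois_norm g \<ge> real (card U)"
proof -
  let ?x = "g [^] e"
  obtain \<B> \<alpha> where dec: "cent_decomposition (g [^] e) \<B> \<alpha>"
    by (rule cent_decomposition_exists[OF pow_e_q_element[OF g]])
  note * = cent_decompositionD[OF dec]
  show ?thesis
    using virtual_char_family(1)[OF q2 M0 *(1,3)[unfolded Q_def]]
      galois_norm_eq_norms[OF pow_e_q_element[OF g] dec] galois_norm_pow_e[OF g] by (simp add: U_def)
qed

text \<open>The minimal nonzero value of \<open>galois_norm\<close> leaves a single irreducible character \<open>b\<close> of the centralizer,
with a root of unity as coefficient. So \<open>\<chi>\<close> is zero or a root of unity at \<open>xy\<close> wherever \<open>b\<close> is so at \<open>y\<close>,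
and \<open>sum_coset_cent\<close>, applied to the indicator function, transports the proportion to the coset.\<close>

lemma half_of_coset:
  assumes IH: "\<And>C \<phi>. subgroup C G \<Longrightarrow> C \<subseteq> N \<Longrightarrow> irreducible_character (G\<lparr>carrier := C\<rparr>) \<phi> \<Longrightarrow>
      2 * card {y \<in> C. zero_or_root (\<phi> y)} \<ge> card C"
    and g: "g \<in> carrier G" and Bg: "galois_norm g = real (card U)"
  shows "2 * (\<Sum>n\<in>N. if zero_or_root (\<chi> (g \<otimes> n)) then 1 else 0 :: real) \<ge> real (card N)"
proof -
  define x where "x = g [^] e"
  define I :: "complex \<Rightarrow> real" where "I z = (if zero_or_root z then 1 else 0)" for z
  have x: "x \<in> q_elements" unfolding x_def by (rule pow_e_q_element[OF g])
  have xc: "x \<in> carrier G" using x by (simp add: q_elements_def)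
  have Bx: "galois_norm x = real (card U)" unfolding x_def using galois_norm_pow_e[OF g] Bg by simp
  have finC: "finite (cent x)" by (rule finite_subset[OF cent_sub finN])
  have C0: "real (card (cent x)) > 0"
    using finC subgroup.one_closed[OF cent_subgroup[OF xc]] by (auto simp: card_gt_0_iff)
  obtain \<B> \<alpha> where dec: "cent_decomposition x \<B> \<alpha>"
    by (rule cent_decomposition_exists[OF x])
  note * = cent_decompositionD[OF dec]
  have "\<exists>b\<in>\<B>. root_of_unity (\<alpha> b 1) \<and> (\<forall>b'\<in>\<B>. b' \<noteq> b \<longrightarrow> \<alpha> b' 1 = 0)"
    using virtual_char_family(2)[OF q2 M0 *(1,3)[unfolded Q_def]] galois_norm_eq_norms[OF x dec] Bx
    by (simp add: U_def)
  then obtain b where b: "b \<in> \<B>" "root_of_unity (\<alpha> b 1)" "\<forall>b'\<in>\<B>. b' \<noteq> b \<longrightarrow> \<alpha> b' 1 = 0" by blast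
  have val: "\<chi> (x \<otimes> y) = \<alpha> b 1 * b y" if y: "y \<in> cent x" for y
  proof -
    have "\<chi> (x \<otimes> y) = (\<Sum>b\<in>\<B>. \<alpha> b 1 * b y)" using *(5)[OF y, of 1] xc by simp
    also have "\<dots> = (\<Sum>b\<in>{b}. \<alpha> b 1 * b y)" using b *(1) by (intro sum.mono_neutral_right) auto
    finally show ?thesis by simp
  qed
  have "real (card (cent x)) \<le> 2 * real (card {y \<in> cent x. zero_or_root (b y)})"
    using IH[OF cent_subgroup[OF xc] cent_sub *(2)[OF b(1)]] by linarith
  also have "\<dots> \<le> 2 * (\<Sum>y\<in>cent x. I (\<chi> (x \<otimes> y)))"
  proof -
    have "real (card {y \<in> cent x. zero_or_root (b y)}) = (\<Sum>y\<in>cent x. I (b y))"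
      using finC by (simp add: I_def sum.If_cases Int_def)
    also have "\<dots> \<le> (\<Sum>y\<in>cent x. I (\<chi> (x \<otimes> y)))"
      using val zero_or_root_mult[OF b(2)] by (intro sum_mono) (auto simp: I_def)
    finally show ?thesis by simp
  qed
  finally have half: "real (card (cent x)) \<le> 2 * (\<Sum>y\<in>cent x. I (\<chi> (x \<otimes> y)))" .
  have "real (card (cent x)) * (\<Sum>n\<in>N. I (\<chi> (x \<otimes> n))) = real (card N) * (\<Sum>y\<in>cent x. I (\<chi> (x \<otimes> y)))"
    by (rule sum_coset_cent[OF x]) (simp add: \<chi>_conj)
  moreover have "real (card N) * real (card (cent x)) \<le> real (card N) * (2 * (\<Sum>y\<in>cent x. I (\<chi> (x \<otimes> y))))"
    using half by (intro mult_left_mono) auto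
  ultimately have "real (card (cent x)) * real (card N) \<le> real (card (cent x)) * (2 * (\<Sum>n\<in>N. I (\<chi> (x \<otimes> n))))"
    by (simp add: mult_ac)
  then have fin: "real (card N) \<le> 2 * (\<Sum>n\<in>N. I (\<chi> (x \<otimes> n)))" using C0 by simp
  obtain n0 where n0: "n0 \<in> N" "x = g \<otimes> n0"
    using pow_cong_coset[OF g e(1)] g unfolding x_def by auto
  have "(\<Sum>n\<in>N. I (\<chi> (x \<otimes> n))) = (\<Sum>n\<in>N. I (\<chi> (g \<otimes> n)))"
    unfolding n0(2) using sum_translate_N[OF n0(1) g, of "\<lambda>z. I (\<chi> z)"] by simp
  then show ?thesis using fin by (simp add: I_def)
qed

text \<open>Vanishing at one coset makes \<open>coset_norm \<one>\<close>, which does not depend on the coset, divisible by \<open>q\<close>.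
For any other coset, the generalized characters \<open>coset_norm (x\<^sup>j)\<close> and \<open>\<Sum>\<^sub>b |\<alpha>\<^sub>b(j)|\<^sup>2\<close> agree at the units,
so their values at \<open>j = 0\<close> agree modulo \<open>q\<close>.\<close>

lemma galois_norm_gap:
  assumes g0: "g\<^sub>0 \<in> carrier G" "galois_norm g\<^sub>0 = 0" and g: "g \<in> carrier G"
  shows "galois_norm g = 0 \<or> galois_norm g \<ge> 2 * real (card U)"
proof -
  have finU: "finite U" by (simp add: U_def)
  let ?x0 = "g\<^sub>0 [^] e"
  have x0: "?x0 \<in> q_elements" by (rule pow_e_q_element[OF g0(1)])
  have "galois_norm ?x0 = 0" using galois_norm_pow_e[OF g0(1)] g0(2) by simp
  then have z: "coset_norm (?x0 [^] j) = 0" if "j \<in> U" for j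
    using that finU coset_norm_nonneg unfolding galois_norm_def by (subst (asm) sum_nonneg_eq_0_iff) auto
  obtain t where t: "complex_of_real (coset_norm (?x0 [^] (0::nat))) = of_int (int q * t)"
    by (rule virtual_char_vanishing[OF q2 M0 coset_norm_virtual_char[OF x0, unfolded Q_def]]) (use z in \<open>auto simp: U_def\<close>)
  let ?x = "g [^] e"
  have x: "?x \<in> q_elements" by (rule pow_e_q_element[OF g])
  obtain \<B> \<alpha> where dec: "cent_decomposition (g [^] e) \<B> \<alpha>"
    by (rule cent_decomposition_exists[OF x])
  note * = cent_decompositionD[OF dec]
  \<comment> \<open>It vanishes at the units, so its value at 0 is divisible by \<open>q\<close>.\<close>
  define f where "f j = complex_of_real (coset_norm (?x [^] j)) - (\<Sum>b\<in>\<B>. \<alpha> b j * cnj (\<alpha> b j))" for j :: nat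
  have "virtual_char (q * M) f" unfolding f_def Q_def[symmetric]
    by (intro virtual_char_diff coset_norm_virtual_char[OF x] virtual_char_sum virtual_char_mult_cnj *(3) Q0)
  moreover have "f j = 0" if "j \<in> units_below q M" for j
  proof -
    have "complex_of_real (coset_norm (?x [^] j)) = (\<Sum>b\<in>\<B>. \<alpha> b j * cnj (\<alpha> b j))"
      unfolding coset_norm_eq_sum_norms[OF x that[folded U_def] dec] of_real_sum complex_norm_square ..
    then show ?thesis by (simp add: f_def)
  qed
  ultimately obtain s where s: "f 0 = of_int (int q * s)"
    using virtual_char_vanishing[OF q2 M0] by metis
  have "(\<Sum>b\<in>\<B>. \<alpha> b 0 * cnj (\<alpha> b 0)) = complex_of_real (coset_norm \<one>) - f 0" by (simp add: f_def)
  also have "\<dots> = of_int (int q * (t - s))" using t s by (simp add: algebra_simps)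
  finally have "(\<Sum>b\<in>\<B>. \<alpha> b 0 * cnj (\<alpha> b 0)) = of_int (int q * (t - s))" .
  from virtual_char_family(3)[OF q2 M0 *(1) *(3)[unfolded Q_def] this q]
  show ?thesis using galois_norm_eq_norms[OF x dec] galois_norm_pow_e[OF g] by (simp add: U_def)
qed

lemma galois_norm_zero_char:
  assumes g: "g \<in> carrier G" and "galois_norm g = 0"
  shows "\<chi> g = 0"
proof -
  have "coset_norm (g [^] (1::nat)) = 0"
    using assms(2) one_U coset_norm_nonneg unfolding galois_norm_def
    by (subst (asm) sum_nonneg_eq_0_iff) (auto simp: U_def)
  then have "(\<Sum>n\<in>N. (norm (\<chi> (g \<otimes> n)))\<^sup>2) = 0" using g cardN0 by (simp add: coset_norm_def)
  then have "\<forall>n\<in>N. (norm (\<chi> (g \<otimes> n)))\<^sup>2 = 0" using finN by (subst (asm) sum_nonneg_eq_0_iff) auto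
  then have "(norm (\<chi> (g \<otimes> \<one>)))\<^sup>2 = 0" using subgroup.one_closed[OF subN] by blast
  then show ?thesis using g by simp
qed

text \<open>The total of \<open>galois_norm\<close> is \<open>|U||G|\<close>. If it never vanishes, it is constantly \<open>|U|\<close>; if it vanishes
somewhere, its nonzero values are at least \<open>2|U|\<close>, so it vanishes on at least half of \<open>G\<close>.\<close>

theorem half_zero_or_root:
  assumes IH: "\<And>C \<phi>. subgroup C G \<Longrightarrow> C \<subseteq> N \<Longrightarrow> irreducible_character (G\<lparr>carrier := C\<rparr>) \<phi> \<Longrightarrow>
      2 * card {y \<in> C. zero_or_root (\<phi> y)} \<ge> card C"
  shows "2 * card {g \<in> carrier G. zero_or_root (\<chi> g)} \<ge> card (carrier G)"
proof -
  have U0: "real (card U) > 0" using one_U by (auto simp: U_def card_gt_0_iff)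
  show ?thesis
  proof (cases "\<exists>g\<^sub>0\<in>carrier G. galois_norm g\<^sub>0 = 0")
    case False
    have ge: "galois_norm g \<ge> real (card U)" if "g \<in> carrier G" for g using galois_norm_dichotomy[OF that] False that by blast
    have "(\<Sum>g\<in>carrier G. galois_norm g - real (card U)) = 0"
      using sum_galois_norm by (simp add: sum_subtractf Coset.order_def)
    then have "\<forall>g\<in>carrier G. galois_norm g - real (card U) = 0"
      using fin ge by (subst (asm) sum_nonneg_eq_0_iff) auto
    then have eq: "galois_norm g = real (card U)" if "g \<in> carrier G" for g using that by simp
    define I :: "'a \<Rightarrow> real" where "I z = (if zero_or_root (\<chi> z) then 1 else 0)" for z
    have "real (card N) * real (card (carrier G)) = (\<Sum>g\<in>carrier G. real (card N))" by simp
    also have "\<dots> \<le> (\<Sum>g\<in>carrier G. 2 * (\<Sum>n\<in>N. I (g \<otimes> n)))"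
      unfolding I_def by (intro sum_mono half_of_coset[OF IH _ eq]) auto
    also have "\<dots> = real (card N) * (2 * (\<Sum>g\<in>carrier G. I g))"
      unfolding sum_distrib_left[symmetric] sum_coset_average by simp
    finally have "real (card (carrier G)) \<le> 2 * (\<Sum>g\<in>carrier G. I g)" using cardN0 by simp
    also have "(\<Sum>g\<in>carrier G. I g) = real (card {g \<in> carrier G. zero_or_root (\<chi> g)})"
      using fin by (simp add: I_def sum.If_cases Int_def)
    finally show ?thesis by linarith
  next
    case True
    then obtain g0 where g0: "g0 \<in> carrier G" "galois_norm g0 = 0" by blast
    define Z where "Z = {g \<in> carrier G. galois_norm g = 0}"
    have finZ: "finite Z" unfolding Z_def using fin by simp
    have "2 * real (card U) * real (card (carrier G - Z)) = (\<Sum>g\<in>carrier G - Z. 2 * real (card U))" by simp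
    also have "\<dots> \<le> (\<Sum>g\<in>carrier G - Z. galois_norm g)"
      using galois_norm_gap[OF g0] by (intro sum_mono) (auto simp: Z_def)
    also have "\<dots> \<le> (\<Sum>g\<in>carrier G. galois_norm g)" using fin galois_norm_nonneg by (intro sum_mono2) auto
    also have "\<dots> = real (card U) * real (card (carrier G))" using sum_galois_norm by (simp add: Coset.order_def)
    finally have "2 * real (card (carrier G - Z)) \<le> real (card (carrier G))" using U0 by simp
    moreover have "card (carrier G - Z) + card Z = card (carrier G)"
      using fin finZ by (subst card_Diff_subset) (auto simp: Z_def card_mono)
    moreover have "card Z \<le> card {g \<in> carrier G. zero_or_root (\<chi> g)}"
      using fin galois_norm_zero_char by (intro card_mono) (auto simp: Z_def zero_or_root_def)
    ultimately show ?thesis by linarith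
  qed
qed

end

section \<open>Climbing the Sylow tower\<close>

lemma irreducible_character_trivial_group:
  assumes G: "group G" and one: "carrier G = {\<one>\<^bsub>G\<^esub>}" and \<chi>: "irreducible_character G \<chi>"
  shows "\<chi> \<one>\<^bsub>G\<^esub> = 1"
proof -
  interpret G: group G by fact
  obtain n \<rho> where \<rho>: "irreducible_rep G n \<rho>" "\<And>g. g \<in> carrier G \<Longrightarrow> \<chi> g = mat_trace (\<rho> g)"
    using \<chi> unfolding irreducible_character_def by blast
  have "\<rho> \<one>\<^bsub>G\<^esub> = 1\<^sub>m n" using \<rho>(1) irreducible_rep_iff[OF G] by (auto simp: mat_rep_def)
  then have n: "\<chi> \<one>\<^bsub>G\<^esub> = of_nat n" using \<rho>(2) by (simp add: mat_trace_one)
  have "\<chi> \<one>\<^bsub>G\<^esub> * cnj (\<chi> \<one>\<^bsub>G\<^esub>) = 1"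
    using irreducible_character_orthogonality[OF G _ \<chi> \<chi>] one by (simp add: Coset.order_def)
  then have "complex_of_nat (n * n) = of_nat 1" using n by simp
  then have "n * n = 1" by (simp only: of_nat_eq_iff)
  then show ?thesis using n by simp
qed

lemma sylow_tower_step:
  assumes G: "group G" and fin: "finite (carrier G)" and N: "N \<lhd> G" and N': "N' \<lhd> G" and sub: "N \<subseteq> N'"
    and P: "sylow_subgroup G q P" "(G\<lparr>carrier := N'\<rparr>) Mod N \<cong> G\<lparr>carrier := P\<rparr>"
  obtains a where "\<And>g. g \<in> N' \<Longrightarrow> g [^]\<^bsub>G\<^esub> (q ^ a) \<in> N" "card N' = q ^ a * card N"
proof -
  interpret G: group G by fact
  have sN': "subgroup N' G" using N' normal_imp_subgroup by blast
  let ?H = "G\<lparr>carrier := N'\<rparr>"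
  interpret H: group ?H by (rule subgroup.subgroup_is_group[OF sN' G])
  interpret NH: normal N ?H by (rule G.normal_restrict_supergroup[OF sN' N sub])
  interpret F: group "?H Mod N" by (rule NH.factorgroup_is_group)
  define a where "a = multiplicity q (Coset.order G)"
  have ord: "Coset.order (?H Mod N) = q ^ a"
    using P iso_same_card[OF P(2)] by (simp add: Coset.order_def sylow_subgroup_def a_def)
  have "g [^]\<^bsub>G\<^esub> (q ^ a) \<in> N" if g: "g \<in> N'" for g
  proof -
    have gF: "N #>\<^bsub>?H\<^esub> g \<in> carrier (?H Mod N)" using g by (auto simp: carrier_FactGroup)
    have "N #>\<^bsub>?H\<^esub> (g [^]\<^bsub>?H\<^esub> (q ^ a)) = (N #>\<^bsub>?H\<^esub> g) [^]\<^bsub>?H Mod N\<^esub> (q ^ a)"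
      using NH.FactGroup_pow[of g "q ^ a"] g by simp
    also have "\<dots> = N" using F.pow_order_eq_1[OF gF] ord by simp
    finally have "g [^]\<^bsub>?H\<^esub> (q ^ a) \<in> N"
      using H.nat_pow_closed[of g "q ^ a"] g NH.subgroup_axioms H.coset_join1[of N "g [^]\<^bsub>?H\<^esub> (q ^ a)"]
        NH.subset by simp
    then show ?thesis by (simp add: G.nat_pow_consistent[symmetric])
  qed
  moreover have "card N' = q ^ a * card N"
    using H.lagrange[OF NH.subgroup_axioms] ord by (simp add: Coset.order_def FactGroup_def)
  ultimately show ?thesis using that by blast
qed

text \<open>Induction along the tower. The divisibility statement carried along shows that each new prime does
not divide the order of the previous term. Every subgroup \<open>K\<close> of the next term \<open>N\<^sub>i\<^sub>+\<^sub>1\<close> satisfies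
the assumptions of the step with the normal subgroup \<open>N\<^sub>i \<inter> K\<close>.\<close>

theorem theoremC:
  fixes G :: "('a, 'b) monoid_scheme" and \<chi> :: "'a \<Rightarrow> complex"
  assumes "group G"
    and "finite (carrier G)"
    and "has_sylow_tower G"
    and "irreducible_character G \<chi>"
  shows "real (card {g \<in> carrier G. \<chi> g = 0 \<or> root_of_unity (\<chi> g)}) \<ge> real (order G) / 2"
proof -
  interpret G: group G by fact
  obtain k :: nat and N :: "nat \<Rightarrow> 'a set" and p :: "nat \<Rightarrow> nat" where
    N0: "N 0 = {\<one>\<^bsub>G\<^esub>}" and Nk: "N k = carrier G" and normal: "\<forall>i\<le>k. N i \<lhd> G"
    and mono: "\<forall>i\<in>{1..k}. N (i - 1) \<subseteq> N i" and p: "bij_betw p {1..k} (prime_factors (Coset.order G))"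
    and quot: "\<forall>i\<in>{1..k}. \<exists>P. sylow_subgroup G (p i) P \<and>
           (G\<lparr>carrier := N i\<rparr>) Mod (N (i - 1)) \<cong> G\<lparr>carrier := P\<rparr>"
    using assms(3) unfolding has_sylow_tower_def by blast
  have "(\<forall>r. prime r \<and> r dvd card (N i) \<longrightarrow> r \<in> p ` {1..i}) \<and>
      (\<forall>K \<phi>. subgroup K G \<and> K \<subseteq> N i \<and> irreducible_character (G\<lparr>carrier := K\<rparr>) \<phi> \<longrightarrow>
         2 * card {y \<in> K. zero_or_root (\<phi> y)} \<ge> card K)" if "i \<le> k" for i
    using that
  proof (induction i)
    case 0
    have "2 * card {y \<in> K. zero_or_root (\<phi> y)} \<ge> card K"
      if K: "subgroup K G" "K \<subseteq> N 0" "irreducible_character (G\<lparr>carrier := K\<rparr>) \<phi>" for K \<phi>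
    proof -
      have K1: "K = {\<one>\<^bsub>G\<^esub>}" using K(2) N0 subgroup.one_closed[OF K(1)] by auto
      have "\<phi> \<one>\<^bsub>G\<^esub> = 1"
        using irreducible_character_trivial_group[OF subgroup.subgroup_is_group[OF K(1) assms(1)] _ K(3)] K1 by simp
      then have "{y \<in> K. zero_or_root (\<phi> y)} = K"
        unfolding K1 zero_or_root_def root_of_unity_def by auto
      then show ?thesis by simp
    qed
    then show ?case using N0 by (auto simp: prime_gt_1_nat)
  next
    case (Suc i)
    have i: "i \<le> k" and Si: "Suc i \<in> {1..k}" using Suc.prems by auto
    note IH = Suc.IH[OF i]
    obtain P where P: "sylow_subgroup G (p (Suc i)) P"
      "(G\<lparr>carrier := N (Suc i)\<rparr>) Mod (N i) \<cong> G\<lparr>carrier := P\<rparr>" using quot Si by fastforce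
    have sub: "N i \<subseteq> N (Suc i)" using mono Si by fastforce
    obtain a where a: "\<And>g. g \<in> N (Suc i) \<Longrightarrow> g [^]\<^bsub>G\<^esub> (p (Suc i) ^ a) \<in> N i"
      "card (N (Suc i)) = p (Suc i) ^ a * card (N i)"
      using sylow_tower_step[OF assms(1,2) _ _ sub P] normal Suc.prems i by blast
    have prm: "prime (p (Suc i))" using P(1) by (simp add: sylow_subgroup_def)
    have "p (Suc i) \<notin> p ` {1..i}"
    proof
      assume "p (Suc i) \<in> p ` {1..i}"
      then obtain j where "j \<in> {1..i}" "p j = p (Suc i)" by auto
      moreover have "j \<in> {1..k}" using \<open>j \<in> {1..i}\<close> i by simp
      ultimately have "j = Suc i" using inj_onD[OF bij_betw_imp_inj_on[OF p]] Si by blast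
      then show False using \<open>j \<in> {1..i}\<close> by simp
    qed
    then have cop: "coprime (p (Suc i)) (card (N i))" using IH prm prime_imp_coprime by blast
    have 1: "r \<in> p ` {1..Suc i}" if r: "prime r" "r dvd card (N (Suc i))" for r
    proof -
      from r a(2) have "r dvd p (Suc i) ^ a \<or> r dvd card (N i)" by (simp add: prime_dvd_mult_iff)
      then show ?thesis
      proof
        assume "r dvd p (Suc i) ^ a"
        then have "r dvd p (Suc i)" using r(1) prime_dvd_power by blast
        then have "r = p (Suc i)" using r(1) prm primes_dvd_imp_eq by blast
        then show ?thesis by simp
      next
        assume "r dvd card (N i)"
        then have "r \<in> p ` {1..i}" using IH r(1) by blast
        then show ?thesis by auto
      qed
    qed
    have 2: "2 * card {y \<in> K. zero_or_root (\<phi> y)} \<ge> card K"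
      if K: "subgroup K G" "K \<subseteq> N (Suc i)" "irreducible_character (G\<lparr>carrier := K\<rparr>) \<phi>" for K \<phi>
    proof -
      let ?K = "G\<lparr>carrier := K\<rparr>"
      have gK: "group ?K" by (rule subgroup.subgroup_is_group[OF K(1) assms(1)])
      have Ni: "N i \<lhd> G" using normal i by blast
      then have sNi: "subgroup (N i) G" using normal_imp_subgroup by blast
      have nK: "N i \<inter> K \<lhd> ?K" by (rule G.normal_Int_subgroup[OF K(1) Ni])
      have "subgroup (N i \<inter> K) (G\<lparr>carrier := N i\<rparr>)"
        by (rule G.subgroup_incl[OF G.subgroups_Inter_pair[OF sNi K(1)] sNi]) auto
      then have "card (N i \<inter> K) dvd card (N i)"
        using group.lagrange[OF subgroup.subgroup_is_group[OF sNi assms(1)], symmetric]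
        by (simp add: Coset.order_def)
      then have cop': "coprime (p (Suc i)) (card (N i \<inter> K))" 
        by (rule coprime_divisors[OF dvd_refl _ cop])
      interpret E: coprime_extension ?K "N i \<inter> K" "p (Suc i)" a \<phi>
      proof (intro coprime_extension.intro coprime_extension_axioms.intro gK nK prm cop' K(3))
        show "finite (carrier ?K)" using finite_subset[OF subgroup.subset[OF K(1)] assms(2)] by simp
        fix g assume "g \<in> carrier ?K"
        then have g: "g \<in> K" by simp
        have "g [^]\<^bsub>?K\<^esub> (p (Suc i) ^ a) \<in> K"
          using monoid.nat_pow_closed[OF group.is_monoid[OF gK], of g "p (Suc i) ^ a"] g by simp
        then show "g [^]\<^bsub>?K\<^esub> (p (Suc i) ^ a) \<in> N i \<inter> K"
          using a(1)[of g] g K(2) by (auto simp: G.nat_pow_consistent[symmetric])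
      qed
      have "card (carrier ?K) \<le> 2 * card {g \<in> carrier ?K. zero_or_root (\<phi> g)}"
      proof (rule E.half_zero_or_root)
        fix C \<psi> assume C: "subgroup C ?K" "C \<subseteq> N i \<inter> K" "irreducible_character (?K\<lparr>carrier := C\<rparr>) \<psi>"
        have "subgroup C G" using G.incl_subgroup[OF K(1) C(1)] .
        then show "card C \<le> 2 * card {y \<in> C. zero_or_root (\<psi> y)}" using IH C(2,3) by simp
      qed
      then show ?thesis by simp
    qed
    show ?case using 1 2 by blast
  qed
  from this[of k] have "card (carrier G) \<le> 2 * card {y \<in> carrier G. zero_or_root (\<chi> y)}"
    using Nk assms(4) G.subgroup_self by simp
  then have "real (card (carrier G)) \<le> 2 * real (card {y \<in> carrier G. zero_or_root (\<chi> y)})" by linarith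
  then show ?thesis by (simp add: Coset.order_def zero_or_root_def)
qed

end
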